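(* There are absolute constants $C_1,c_2,C_3$ such that the following holds. Let $A\subset S^{d-1}$ be symmetric (i.e. $A=-A$), let $G_1,\dots,G_m$ be independent copies of the standard gaussian random vector in $\mathbb{R}^d$, and let $\Gamma=\sum_{i=1}^m\langle G_i,\cdot\rangle e_i:\mathbb{R}^d\to\mathbb{R}^m$ be the random matrix whose rows are $G_1,\dots,G_m$. Let $m\geq\gamma_1(A)$ and let $$\Delta\geq C_1\frac{\gamma_1(A)}{m}\log^3\left(\frac{em}{\gamma_1(A)}\right).$$ Then with probability at least $1-2\exp(-c_2\Delta m)$, $$\sup_{x\in A}\left(\frac1m\sum_{i=1}^m\left((\Gamma x)^\sharp_i-\lambda_i\right)^2\right)^{1/2}\leq C_3\sqrt{\Delta\log\left(\frac1\Delta\right)}.$$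
   Context: $S^{d-1}$ is the Euclidean unit sphere of $\mathbb{R}^d$, and $e_1,\dots,e_m$ is the standard basis of $\mathbb{R}^m$. $F_g$ is the standard normal distribution function. For $1\leq i\leq m-1$, $\lambda_i=F_g^{-1}(i/m)$, and $\lambda_m=\lambda_{m-1}$. For $v\in\mathbb{R}^m$, $v^\sharp$ is the non-decreasing rearrangement of the coordinates of $v$, so that $v^\sharp_1=\min_i v_i$ and $v^\sharp_m=\max_i v_i$. Talagrand's functional: an admissible sequence of a set $A\subset\mathbb{R}^d$ is a family $(A_s)_{s\geq 0}$ of subsets of $A$ with $|A_0|=1$ and $|A_s|\leq 2^{2^s}$ for $s\geq1$. Let $\pi_s:A\to A_s$ be the nearest point map with respect to the Euclidean distance. Then $\gamma_1(A)=\inf\sup_{x\in A}\sum_{s\geq0}2^{s}\|x-\pi_sx\|_2$, the infimum being over all admissible sequences of $A$. Absolute constants are strictly positive numbers independent of all other parameters.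
   Formalization: The formal theorem adds Δ ≤ 1/2: for Δ > 1 the root of Δ log(1/Δ) is undefined, and at or near Δ = 1 the bound tends to 0 and the claim fails (e.g. A = {±e_1}, m large); any fixed upper bound below 1 only changes the constants. *)

theory Defs
  imports "HOL-Probability.Probability"
begin

text \<open>
  The constants of the theorem must not depend on the dimension, so the dimension is a natural
  number and not a type: \<open>\<real>\<^sup>n\<close> is the set of functions on \<open>{1..n}\<close>, extended by
  \<^term>\<open>undefined\<close> outside, which is also the space of the product \<open>\<sigma>\<close>-algebra. The
  Euclidean distance is spelled out because \<^term>\<open>dist\<close> on \<^typ>\<open>nat \<Rightarrow> real\<close> is a
  different metric, that of the product topology.
\<close>

definition euclid :: "nat \<Rightarrow> (nat \<Rightarrow> real) set" where
  "euclid n = {1..n} \<rightarrow>\<^sub>E UNIV"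

definition euclid_inner :: "nat \<Rightarrow> (nat \<Rightarrow> real) \<Rightarrow> (nat \<Rightarrow> real) \<Rightarrow> real" where
  "euclid_inner n x y = (\<Sum>j=1..n. x j * y j)"

definition euclid_dist :: "nat \<Rightarrow> (nat \<Rightarrow> real) \<Rightarrow> (nat \<Rightarrow> real) \<Rightarrow> real" where
  "euclid_dist n x y = L2_set (\<lambda>j. x j - y j) {1..n}"

definition euclid_sphere :: "nat \<Rightarrow> (nat \<Rightarrow> real) set" where
  "euclid_sphere n = {x \<in> euclid n. L2_set x {1..n} = 1}"

definition euclid_uminus :: "nat \<Rightarrow> (nat \<Rightarrow> real) \<Rightarrow> (nat \<Rightarrow> real)" where
  "euclid_uminus n x = (\<lambda>j\<in>{1..n}. - x j)"

definition symmetric_set :: "nat \<Rightarrow> (nat \<Rightarrow> real) set \<Rightarrow> bool" where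
  "symmetric_set n A \<longleftrightarrow> euclid_uminus n ` A = A"

definition std_gaussian :: "nat \<Rightarrow> (nat \<Rightarrow> real) measure" where
  "std_gaussian n = (\<Pi>\<^sub>M j\<in>{1..n}. std_normal_distribution)"

definition Fg :: "real \<Rightarrow> real" where
  "Fg = cdf std_normal_distribution"

text \<open>\<^term>\<open>inv Fg\<close> is only evaluated in \<open>(0, 1)\<close>, the range of the injective function
  \<^term>\<open>Fg\<close>.\<close>

definition gauss_quantile :: "nat \<Rightarrow> nat \<Rightarrow> real" where
  "gauss_quantile m i = (if i < m then inv Fg (real i / real m)
                         else inv Fg (real (m - 1) / real m))"

definition rearrangement :: "nat \<Rightarrow> (nat \<Rightarrow> real) \<Rightarrow> nat \<Rightarrow> real" where
  "rearrangement m v i = sort (map v [1..<Suc m]) ! (i - 1)"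

definition matrix_of_rows ::
  "nat \<Rightarrow> nat \<Rightarrow> (nat \<Rightarrow> nat \<Rightarrow> real) \<Rightarrow> (nat \<Rightarrow> real) \<Rightarrow> (nat \<Rightarrow> real)" where
  "matrix_of_rows m d g x = (\<lambda>i\<in>{1..m}. euclid_inner d (g i) x)"

text \<open>The sets of an admissible sequence have to be nonempty for nearest points to exist;
  finiteness is explicit because \<^term>\<open>card\<close> is 0 on infinite sets.\<close>

definition admissible :: "'a set \<Rightarrow> (nat \<Rightarrow> 'a set) \<Rightarrow> bool" where
  "admissible A As \<longleftrightarrow>
     (\<forall>s. As s \<subseteq> A \<and> As s \<noteq> {} \<and> finite (As s)) \<and>
     card (As 0) = 1 \<and> (\<forall>s\<ge>1. card (As s) \<le> 2 ^ 2 ^ s)"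

definition nearest_point :: "nat \<Rightarrow> (nat \<Rightarrow> real) set \<Rightarrow> (nat \<Rightarrow> real) \<Rightarrow> (nat \<Rightarrow> real)" where
  "nearest_point n B x = arg_min_on (euclid_dist n x) B"

text \<open>The values are extended nonnegative reals, so that divergent sums count as \<open>\<infinity>\<close>.\<close>

definition gamma1 :: "nat \<Rightarrow> (nat \<Rightarrow> real) set \<Rightarrow> ennreal" where
  "gamma1 n A = (INF As \<in> {As. admissible A As}.
     SUP x \<in> A. \<Sum>s. ennreal (2 ^ s * euclid_dist n x (nearest_point n (As s) x)))"

end

theory Submission
  imports Defs
begin

text \<open>
  Write \<open>D = \<Delta> m\<close>, \<open>l = log (e m / \<gamma>)\<close> and \<open>n\<^sub>j = min j (m - j)\<close>, and let
  \<open>N\<^sub>x t\<close> be the number of coordinates of \<open>\<Gamma> x\<close> that are at most \<open>t\<close>. The theorem follows from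
  two uniform estimates, each valid outside an event of probability \<open>exp (- c D)\<close>:

  \<^enum> \<open>|N\<^sub>x \<lambda>\<^sub>j - j| \<le> sqrt (D n\<^sub>j) / 2\<close> for all \<open>x \<in> A\<close> and all \<open>j\<close> with
    \<open>n\<^sub>j \<ge> D\<close> (\<open>count_le_quantile\<close>);
  \<^enum> the sum of any \<open>k \<ge> D\<close> squared coordinates of \<open>\<Gamma> x\<close> is at most of order
    \<open>k log (e m / k)\<close> (\<open>sum_squares_le\<close>).

  The first one confines the \<open>i\<close>-th smallest coordinate between two quantiles whose ranks differ from
  \<open>i\<close> by about \<open>sqrt (D n\<^sub>i)\<close>. The density at a point exceeds a third of the tail mass beyond that
  point, so these quantiles are within \<open>16 sqrt (D / n\<^sub>i)\<close> of \<open>\<lambda>\<^sub>i\<close>. The squares sum to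
  \<open>D \<Sum> 1 / n\<^sub>i\<close>, of order \<open>D log (1 / \<Delta>)\<close>. The remaining ranks, of which there are at most \<open>10 D\<close>, are
  handled by the triangle inequality: the second estimate bounds the coordinates of \<open>\<Gamma> x\<close>, and
  \<open>\<lambda>\<^sub>i\<^sup>2 \<le> 2 log (m / n\<^sub>i)\<close> the quantiles, and the squares again sum to the order \<open>D log (1 / \<Delta>)\<close>
  (\<open>rearrangement_distance\<close>).

  Both uniform estimates come from a near-optimal admissible sequence. Let \<open>p s x\<close> be the points
  of the chain of \<open>x\<close>. At the level \<open>s0\<close>, with \<open>2\<^sup>s\<^sup>0\<close> a small multiple of \<open>D\<close>, a union bound over
  the net is affordable. For the second estimate the increments of the chain are summed in the Euclidean
  norm, on all sets of \<open>k\<close> rows at once (\<open>L2_set_chain_le\<close>).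

  The first estimate is more delicate, because an indicator does not vary continuously with \<open>x\<close>.
  The chain is stopped at a level \<open>S\<close> with \<open>2\<^sup>S\<close> a small multiple of the permitted error
  \<open>E = sqrt (D n\<^sub>j)\<close>. Beyond that level, the threshold is moved by about \<open>E / 16\<close> ranks; only few
  coordinates of \<open>\<Gamma> (x - p S x)\<close> exceed this shift (\<open>card_large_le\<close>). Between \<open>s0\<close> and \<open>S\<close>, the
  difference \<open>N\<^sub>a t - N\<^sub>b t\<close> for two unit vectors is a sum of independent centred variables with values
  in \<open>{-1, 0, 1}\<close>, because both marginals are standard normal. The variance is the probability that
  the two indicators differ. For short steps and up to a negligible term, it is of order
  \<open>|a - b| l\<^sup>2\<close> times the tail mass at \<open>t\<close> (\<open>flip_prob_le\<close>).
  Bernstein's inequality with exponent of order \<open>2\<^sup>s\<close> bounds the increment at level \<open>s\<close> by a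
  multiple of \<open>sqrt (2\<^sup>s |p s x - p (s + 1) x| n\<^sub>j l\<^sup>2) + 2\<^sup>s\<close>. The chain sums
  \<open>2\<^sup>s |p s x - p (s + 1) x|\<close> to at most \<open>3 \<gamma>\<close>, and there are at most \<open>2 l\<close> levels, so by
  Cauchy-Schwarz the sum of the increments is at most of order \<open>sqrt (\<gamma> l\<^sup>3 n\<^sub>j) + 2\<^sup>S\<close>. The
  assumption on \<open>\<Delta>\<close> makes \<open>\<gamma> l\<^sup>3\<close> a small multiple of \<open>D\<close>, and hence this sum a small multiple of \<open>E\<close>.
\<close>

section \<open>The standard normal distribution on the line\<close>

interpretation std_normal: real_distribution std_normal_distribution
  by (rule real_dist_normal_dist)

lemma measure_std_normal:
  assumes "S \<in> sets borel"
  shows "emeasure std_normal_distribution S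
    = (\<integral>\<^sup>+x. ennreal (std_normal_density x) * indicator S x \<partial>lborel)"
  using assms by (simp add: emeasure_density)

lemma measure_std_normal_interval_le:
  assumes "a \<le> b" and "\<And>x. a \<le> x \<Longrightarrow> x \<le> b \<Longrightarrow> std_normal_density x \<le> K"
  shows "measure std_normal_distribution {a..b} \<le> K * (b - a)"
proof -
  have K: "0 \<le> K" using assms order_trans[OF normal_density_nonneg] by (metis order_refl)
  have "emeasure std_normal_distribution {a..b}
      = (\<integral>\<^sup>+x. ennreal (std_normal_density x) * indicator {a..b} x \<partial>lborel)"
    by (rule measure_std_normal) simp
  also have "\<dots> \<le> (\<integral>\<^sup>+x. ennreal K * indicator {a..b} x \<partial>lborel)"
    by (intro nn_integral_mono) (auto simp: indicator_def assms intro!: ennreal_leI)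
  also have "\<dots> = ennreal (K * (b - a))"
    using assms K by (subst nn_integral_cmult_indicator) (auto simp: ennreal_mult)
  finally show ?thesis
    using K assms(1) by (simp add: std_normal.emeasure_eq_measure)
qed

lemma measure_std_normal_interval_ge:
  assumes "a \<le> b" "0 \<le> K" and "\<And>x. a \<le> x \<Longrightarrow> x \<le> b \<Longrightarrow> K \<le> std_normal_density x"
  shows "K * (b - a) \<le> measure std_normal_distribution {a<..b}"
proof -
  have "ennreal (K * (b - a)) = (\<integral>\<^sup>+x. ennreal K * indicator {a<..b} x \<partial>lborel)"
    using assms by (subst nn_integral_cmult_indicator) (auto simp: ennreal_mult)
  also have "\<dots> \<le> (\<integral>\<^sup>+x. ennreal (std_normal_density x) * indicator {a<..b} x \<partial>lborel)"
    by (intro nn_integral_mono) (auto simp: indicator_def assms intro!: ennreal_leI)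
  also have "\<dots> = emeasure std_normal_distribution {a<..b}"
    by (rule measure_std_normal[symmetric]) simp
  finally show ?thesis
    using assms(1) by (simp add: std_normal.emeasure_eq_measure)
qed

lemma Fg_diff: "a \<le> b \<Longrightarrow> Fg b - Fg a = measure std_normal_distribution {a<..b}"
  unfolding Fg_def by (cases "a = b") (auto simp: std_normal.cdf_diff_eq)

lemma std_normal_density_exp: "std_normal_density x = exp (- x\<^sup>2 / 2) / sqrt (2 * pi)"
  by (simp add: std_normal_density_def)

lemma Fg_uminus: "Fg (- t) = 1 - Fg t"
proof -
  have sing: "measure std_normal_distribution {t} = 0"
    using measure_std_normal[of "{t}"] nn_integral_indicator_singleton[of "t" lborel "\<lambda>x. ennreal (std_normal_density x)"]
    by (simp add: measure_def)
  have "emeasure std_normal_distribution {..-t}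
      = (\<integral>\<^sup>+x. ennreal (std_normal_density x) * indicator {..-t} x \<partial>lborel)"
    by (rule measure_std_normal) simp
  also have "\<dots> = (\<integral>\<^sup>+x. ennreal (std_normal_density (0 + (-1) * x)) * indicator {..-t} (0 + (-1) * x) \<partial>lborel)"
    by (subst nn_integral_real_affine[where c="-1" and t=0]) auto
  also have "\<dots> = (\<integral>\<^sup>+x. ennreal (std_normal_density x) * indicator {t..} x \<partial>lborel)"
    by (intro nn_integral_cong) (auto simp: std_normal_density_exp indicator_def)
  also have "\<dots> = emeasure std_normal_distribution {t..}"
    by (rule measure_std_normal[symmetric]) simp
  finally have 1: "Fg (- t) = measure std_normal_distribution {t..}"
    by (simp add: Fg_def cdf_def measure_def)
  have "{t..} = UNIV - {..t} \<union> {t}" by auto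
  then have "measure std_normal_distribution {t..}
      = measure std_normal_distribution (UNIV - {..t}) + measure std_normal_distribution {t}"
    using std_normal.finite_measure_Union[of "UNIV - {..t}" "{t}"] by simp
  also have "\<dots> = 1 - Fg t"
    using std_normal.prob_compl[of "{..t}"] sing by (simp add: Fg_def cdf_def)
  finally show ?thesis using 1 by simp
qed

text \<open>On \<open>{..t}\<close> the standard normal density is at most \<open>exp (- t\<^sup>2 / 2)\<close> times the normal density
  with mean \<^term>\<open>t\<close>. The bound does double duty: it is \<open>sqrt (2 pi)\<close> times the density at
  \<^term>\<open>t\<close>, so it also compares the tail with the density.\<close>

lemma Fg_le_exp:
  assumes "t \<le> 0" shows "Fg t \<le> exp (- t\<^sup>2 / 2)"
proof -
  have "emeasure std_normal_distribution {..t}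
      = (\<integral>\<^sup>+x. ennreal (std_normal_density x) * indicator {..t} x \<partial>lborel)"
    by (rule measure_std_normal) simp
  also have "\<dots> \<le> (\<integral>\<^sup>+x. ennreal (exp (- t\<^sup>2 / 2)) * ennreal (normal_density t 1 x) \<partial>lborel)"
  proof (intro nn_integral_mono)
    fix x :: real
    show "ennreal (std_normal_density x) * indicator {..t} x
        \<le> ennreal (exp (- t\<^sup>2 / 2)) * ennreal (normal_density t 1 x)"
    proof (cases "x \<le> t")
      case True
      have "0 \<le> t * (x - t)" using assms True by (simp add: mult_nonpos_nonpos)
      then have "- x\<^sup>2 / 2 \<le> - t\<^sup>2 / 2 + - (x - t)\<^sup>2 / 2"
        by (simp add: power2_eq_square algebra_simps)
      then have "exp (- x\<^sup>2 / 2) \<le> exp (- t\<^sup>2 / 2) * exp (- (x - t)\<^sup>2 / 2)"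
        by (metis exp_add exp_le_cancel_iff)
      then have "std_normal_density x \<le> exp (- t\<^sup>2 / 2) * normal_density t 1 x"
        by (simp add: normal_density_def divide_right_mono)
      then show ?thesis using True
        by (simp add: ennreal_mult[symmetric] ennreal_leI)
    qed simp
  qed
  also have "\<dots> = ennreal (exp (- t\<^sup>2 / 2)) * (\<integral>\<^sup>+x. ennreal (normal_density t 1 x) \<partial>lborel)"
    by (rule nn_integral_cmult) simp
  also have "(\<integral>\<^sup>+x. ennreal (normal_density t 1 x) \<partial>lborel) = 1"
    by (subst nn_integral_eq_integral) (auto simp: integral_normal_density)
  finally show ?thesis
    by (simp add: Fg_def cdf_def std_normal.emeasure_eq_measure)
qed

definition Fg_tail :: "real \<Rightarrow> real" where
  "Fg_tail t = min (Fg t) (1 - Fg t)"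

lemma Fg_tail_uminus: "Fg_tail (- t) = Fg_tail t"
  by (simp add: Fg_tail_def Fg_uminus min.commute)

lemma Fg_mono: "a \<le> b \<Longrightarrow> Fg a \<le> Fg b"
  using Fg_diff[of a b] by (smt (verit) measure_nonneg)

lemma Fg_zero: "Fg 0 = 1/2" using Fg_uminus[of 0] by simp

lemma Fg_tail_neg: "t \<le> 0 \<Longrightarrow> Fg_tail t = Fg t"
  using Fg_mono[of t 0] by (simp add: Fg_tail_def Fg_zero)

lemma Fg_tail_abs: "Fg_tail t = Fg (- \<bar>t\<bar>)"
  using Fg_tail_neg[of t] Fg_tail_neg[of "- t"] Fg_tail_uminus[of t] by (cases "t \<le> 0") auto

lemma std_normal_density_pos: "0 < std_normal_density x" by (rule normal_density_pos) simp

lemma Fg_strict_mono: assumes "a < b" shows "Fg a < Fg b"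
proof -
  define K where "K = exp (- (max \<bar>a\<bar> \<bar>b\<bar>)\<^sup>2 / 2) / sqrt (2 * pi)"
  have K: "K > 0" by (simp add: K_def)
  have "K * (b - a) \<le> measure std_normal_distribution {a<..b}"
  proof (intro measure_std_normal_interval_ge)
    fix x assume "a \<le> x" "x \<le> b"
    then have "x\<^sup>2 \<le> (max \<bar>a\<bar> \<bar>b\<bar>)\<^sup>2" by (intro abs_le_square_iff[THEN iffD1]) auto
    then show "K \<le> std_normal_density x"
      unfolding K_def std_normal_density_exp by (intro divide_right_mono) auto
  qed (use assms K in auto)
  then show ?thesis using Fg_diff[of a b] assms K
    by (smt (verit) mult_pos_pos)
qed

lemma Fg_le_iff: "Fg a \<le> Fg b \<longleftrightarrow> a \<le> b"
  by (metis Fg_mono Fg_strict_mono linorder_not_le)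

lemma Fg_pos: "0 < Fg t"
proof -
  have "0 \<le> Fg (t - 1)" by (simp add: Fg_def cdf_def)
  also have "\<dots> < Fg t" by (rule Fg_strict_mono) simp
  finally show ?thesis .
qed

lemma Fg_less_1: "Fg t < 1" using Fg_pos[of "-t"] Fg_uminus[of t] by simp

lemma Fg_tail_pos: "0 < Fg_tail t" by (simp add: Fg_tail_abs Fg_pos)

lemma Fg_tail_le_half: "Fg_tail t \<le> 1/2" unfolding Fg_tail_def by linarith

lemma Fg_tail_le_exp: "Fg_tail t \<le> exp (- t\<^sup>2 / 2)"
  using Fg_le_exp[of "- \<bar>t\<bar>"] by (simp add: Fg_tail_abs)

lemma square_le_ln_Fg_tail: "t\<^sup>2 \<le> 2 * ln (1 / Fg_tail t)"
proof -
  have "ln (Fg_tail t) \<le> - t\<^sup>2 / 2"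
    using Fg_tail_le_exp[of t] Fg_tail_pos[of t] by (metis exp_gt_zero ln_exp ln_le_cancel_iff)
  then show ?thesis using Fg_tail_pos[of t] by (simp add: ln_div)
qed

lemma Fg_tail_le_density: "Fg_tail t \<le> 3 * std_normal_density t"
proof -
  have "sqrt (2 * pi) \<le> sqrt 9" using pi_less_4 by (intro real_sqrt_le_mono) simp
  then have "sqrt (2 * pi) \<le> 3" by simp
  moreover have "exp (- t\<^sup>2 / 2) = sqrt (2 * pi) * std_normal_density t"
    by (simp add: std_normal_density_exp)
  ultimately show ?thesis using Fg_tail_le_exp[of t] std_normal_density_pos[of t]
    using mult_right_mono[of "sqrt (2 * pi)" 3 "std_normal_density t"] by linarith
qed

lemma Fg_tail_less_one: "Fg_tail t < 1" using Fg_tail_le_half[of t] by simp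

text \<open>A weak form of the converse comparison in Mills' inequality, with a logarithm in place of its
  square root. The density loses at most a constant factor over an interval of length
  \<open>1 / (1 + |t|)\<close> to the left of a negative \<^term>\<open>t\<close>, and the mass of that interval is part of the
  tail.\<close>

lemma std_normal_density_le_tail:
  "std_normal_density t \<le> 7 * Fg_tail t * ln (exp 1 / Fg_tail t)"
proof -
  define u where "u = - \<bar>t\<bar>"
  define \<eta> where "\<eta> = 1 / (1 - u)"
  define p where "p = Fg_tail t"
  have u: "u \<le> 0" by (simp add: u_def)
  have p: "p = Fg u" by (simp add: p_def Fg_tail_abs u_def)
  have p0: "0 < p" "p < 1" by (auto simp: p_def Fg_tail_pos Fg_tail_less_one)
  have \<eta>: "0 < \<eta>" "\<eta> \<le> 1" "- u * \<eta> \<le> 1" using u by (auto simp: \<eta>_def field_simps)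
  have dens: "exp (- 3 / 2) * std_normal_density u * (u - (u - \<eta>))
      \<le> measure std_normal_distribution {u - \<eta><..u}"
  proof (rule measure_std_normal_interval_ge)
    fix x assume x: "u - \<eta> \<le> x" "x \<le> u"
    define h where "h = u - x"
    have h: "0 \<le> h" "h \<le> \<eta>" using x by (auto simp: h_def)
    have "- u * h \<le> - u * \<eta>" using u h by (intro mult_left_mono) auto
    then have 1: "- u * h \<le> 1" using \<eta>(3) by linarith
    have 2: "h\<^sup>2 \<le> 1" using h \<eta>(2) by (simp add: power_le_one)
    have "x\<^sup>2 = u\<^sup>2 + 2 * (- u * h) + h\<^sup>2"
      by (simp add: h_def power2_eq_square algebra_simps)
    then have "- 3 / 2 + - u\<^sup>2 / 2 \<le> - x\<^sup>2 / 2" using 1 2 by (simp add: field_simps)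
    then have "exp (- 3 / 2) * exp (- u\<^sup>2 / 2) \<le> exp (- x\<^sup>2 / 2)"
      by (metis exp_add exp_le_cancel_iff)
    then show "exp (- 3 / 2) * std_normal_density u \<le> std_normal_density x"
      by (simp add: std_normal_density_exp divide_right_mono)
  qed (use \<eta> in \<open>auto simp: normal_density_nonneg\<close>)
  have "measure std_normal_distribution {u - \<eta><..u} \<le> p"
    using Fg_diff[of "u - \<eta>" u] \<eta> Fg_pos[of "u - \<eta>"] p by simp
  with dens have "exp (- 3 / 2) * std_normal_density u * \<eta> \<le> p" by simp
  then have "exp (- 3 / 2) * std_normal_density u \<le> p * (1 - u)"
    using u by (simp add: \<eta>_def field_simps)
  then have A: "std_normal_density u \<le> exp (3 / 2) * (p * (1 - u))"
    by (simp add: exp_minus field_simps)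
  have "u\<^sup>2 \<le> 2 * ln (1 / p)" using square_le_ln_Fg_tail[of t] by (simp add: p_def u_def)
  moreover have "- u \<le> (1 + u\<^sup>2) / 2" using zero_le_power2[of "1 + u"]
    by (simp add: power2_eq_square algebra_simps)
  ultimately have "1 - u \<le> 3 / 2 + ln (1 / p)" by simp
  also have "\<dots> \<le> 3 / 2 * ln (exp 1 / p)" using p0 by (simp add: ln_div)
  finally have B: "1 - u \<le> 3 / 2 * ln (exp 1 / p)" .
  have e: "exp (3 / 2 :: real) * (3 / 2) \<le> 7"
  proof -
    have "exp (3 / 2 :: real) ^ 2 = exp 1 ^ 3" by (simp flip: exp_of_nat_mult)
    also have "\<dots> \<le> (2.72::real) ^ 3" using e_less_272 by (intro power_mono) auto
    also have "\<dots> \<le> (14 / 3)\<^sup>2" by (simp add: power2_eq_square power3_eq_cube)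
    finally have "exp (3 / 2 :: real) \<le> 14 / 3"
      by (rule power2_le_imp_le) simp
    then show ?thesis by simp
  qed
  have L: "0 \<le> ln (exp 1 / p)" using p0 by (simp add: ln_div) (use ln_less_zero[of p] in linarith)
  have "std_normal_density u \<le> exp (3 / 2) * (p * (3 / 2 * ln (exp 1 / p)))"
    using A B p0 by (smt (verit) exp_gt_zero mult_left_mono)
  also have "\<dots> = (exp (3 / 2) * (3 / 2)) * (p * ln (exp 1 / p))" by simp
  also have "\<dots> \<le> 7 * (p * ln (exp 1 / p))" using e L p0 by (intro mult_right_mono) auto
  finally show ?thesis by (simp add: p_def u_def std_normal_density_exp algebra_simps)
qed

lemma Fg_inv: assumes "0 < u" "u < 1" shows "Fg (inv Fg u) = u"
proof -
  have lip: "\<bar>Fg b - Fg a\<bar> \<le> \<bar>b - a\<bar>" for a b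
  proof -
    have *: "Fg b - Fg a \<le> b - a" if "a \<le> b" for a b
    proof -
      have "std_normal_density x \<le> 1" for x :: real
      proof -
        have "1 \<le> sqrt (2 * pi)" using pi_gt3 by simp
        then have "exp (- x\<^sup>2 / 2) \<le> sqrt (2 * pi)" by (rule order_trans[rotated]) simp
        then show ?thesis using pi_gt_zero by (simp add: std_normal_density_exp divide_le_eq)
      qed
      then have "measure std_normal_distribution {a..b} \<le> 1 * (b - a)"
        using that by (intro measure_std_normal_interval_le)
      moreover have "measure std_normal_distribution {a<..b} \<le> measure std_normal_distribution {a..b}"
        by (intro std_normal.finite_measure_mono) auto
      ultimately show ?thesis using Fg_diff[OF that] by simp
    qed
    show ?thesis
    proof (cases "a \<le> b")
      case True then show ?thesis using *[of a b] Fg_mono[of a b] by simp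
    next
      case False then show ?thesis using *[of b a] Fg_mono[of b a] by simp
    qed
  qed
  have cont: "isCont Fg x" for x
    unfolding continuous_at_eps_delta using lip
    by (metis dist_real_def order_le_less_trans)
  have "((Fg \<longlongrightarrow> 1) at_top)" using std_normal.cdf_lim_at_top std_normal.prob_space
    by (simp add: Fg_def)
  then have "eventually (\<lambda>x. Fg x > u) at_top" using assms by (simp add: order_tendstoD)
  then obtain b where b: "Fg b > u" by (auto simp: eventually_at_top_linorder)
  have "((Fg \<longlongrightarrow> 0) at_bot)" using std_normal.cdf_lim_at_bot by (simp add: Fg_def)
  then have "eventually (\<lambda>x. Fg x < u) at_bot" using assms by (simp add: order_tendstoD)
  then obtain a where a: "Fg a < u" by (auto simp: eventually_at_bot_linorder)
  have ab: "a \<le> b"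
  proof (rule ccontr)
    assume "\<not> a \<le> b" then have "Fg b \<le> Fg a" by (intro Fg_mono) simp
    then show False using a b by simp
  qed
  have "\<exists>x\<ge>a. x \<le> b \<and> Fg x = u"
    using a b cont by (intro IVT ab) auto
  then show ?thesis by (metis f_inv_into_f rangeI)
qed

lemma Fg_gauss_quantile:
  assumes "0 < i" "i < m" shows "Fg (gauss_quantile m i) = real i / real m"
  using assms by (simp add: gauss_quantile_def Fg_inv)

section \<open>Gaussian rows\<close>

text \<open>Coordinates and rows are indexed by \<open>{1..d}\<close> and \<open>{1..m}\<close>, which simplification would
  otherwise rewrite to intervals that start at \<open>Suc 0\<close>.\<close>

declare One_nat_def [simp del]

lemma sets_std_gaussian [measurable_cong]:
  "sets (std_gaussian d) = sets (\<Pi>\<^sub>M j\<in>{1..d}. borel)"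
  unfolding std_gaussian_def by (intro sets_PiM_cong) auto

lemma space_std_gaussian: "space (std_gaussian d) = euclid d"
  by (simp add: std_gaussian_def space_PiM euclid_def)

interpretation std_gaussian: prob_space "std_gaussian d" for d
  unfolding std_gaussian_def by (intro prob_space_PiM std_normal.prob_space_axioms)

lemma measurable_euclid_inner [measurable]:
  "(\<lambda>g. euclid_inner d g z) \<in> borel_measurable (\<Pi>\<^sub>M j\<in>{1..d}. borel)"
  unfolding euclid_inner_def by measurable

lemma distr_std_gaussian_coordinate:
  assumes "j \<in> {1..d}"
  shows "distr (std_gaussian d) borel (\<lambda>g. g j) = std_normal_distribution"
proof -
  have "distr (std_gaussian d) borel (\<lambda>g. g j) = distr (std_gaussian d) std_normal_distribution (\<lambda>g. g j)"
    by (rule distr_cong) auto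
  also have "\<dots> = std_normal_distribution"
    unfolding std_gaussian_def
    by (rule distr_PiM_component) (use assms std_normal.prob_space_axioms in auto)
  finally show ?thesis .
qed

lemma distributed_std_gaussian_coordinate:
  assumes "j \<in> {1..d}"
  shows "distributed (std_gaussian d) lborel (\<lambda>g. g j) std_normal_density"
proof -
  have "distr (std_gaussian d) lborel (\<lambda>g. g j) = distr (std_gaussian d) borel (\<lambda>g. g j)"
    by (rule distr_cong) auto
  then show ?thesis
    unfolding distributed_def using assms by (auto simp: distr_std_gaussian_coordinate)
qed

lemma indep_vars_std_gaussian_coordinates:
  assumes "I \<subseteq> {1..d}"
  shows "std_gaussian.indep_vars d (\<lambda>_. borel) (\<lambda>j g. g j) I"
proof (cases "d = 0")
  case True
  then show ?thesis using assms by (simp add: std_gaussian.indep_vars_def std_gaussian.indep_sets_def)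
next
  case False
  have rv: "std_gaussian.random_variable d borel (\<lambda>g. g j)" if "j \<in> {1..d}" for j
    using that by measurable
  have "distr (std_gaussian d) (\<Pi>\<^sub>M j\<in>{1..d}. borel) (\<lambda>g. \<lambda>j\<in>{1..d}. g j)
      = distr (std_gaussian d) (std_gaussian d) (\<lambda>g. g)"
    by (rule distr_cong) (auto simp: sets_std_gaussian space_std_gaussian euclid_def PiE_def extensional_restrict)
  also have "\<dots> = std_gaussian d" by (rule distr_id)
  also have "\<dots> = (\<Pi>\<^sub>M j\<in>{1..d}. distr (std_gaussian d) borel (\<lambda>g. g j))"
    unfolding std_gaussian_def[of d]
    by (intro PiM_cong) (use distr_std_gaussian_coordinate in \<open>auto simp: std_gaussian_def\<close>)
  finally have "std_gaussian.indep_vars d (\<lambda>_. borel) (\<lambda>j g. g j) {1..d}"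
    using False rv by (subst std_gaussian.indep_vars_iff_distr_eq_PiM') auto
  then show ?thesis using assms by (rule std_gaussian.indep_vars_subset)
qed

text \<open>Rotation invariance, read off from sums of independent normal variables. Zero coordinates are
  left out of the sum, because a normal density needs a positive deviation.\<close>

lemma distr_euclid_inner_std_gaussian:
  assumes "L2_set z {1..d} = 1"
  shows "distr (std_gaussian d) borel (\<lambda>g. euclid_inner d g z) = std_normal_distribution"
proof -
  define I where "I = {j \<in> {1..d}. z j \<noteq> 0}"
  have sq: "(\<Sum>j\<in>I. (z j)\<^sup>2) = 1"
  proof -
    have "(\<Sum>j\<in>{1..d}. (z j)\<^sup>2) = 1" using assms by (simp add: L2_set_def)
    moreover have "(\<Sum>j\<in>{1..d}. (z j)\<^sup>2) = (\<Sum>j\<in>I. (z j)\<^sup>2)"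
      unfolding I_def by (rule sum.mono_neutral_right) auto
    ultimately show ?thesis by simp
  qed
  have I: "finite I" "I \<noteq> {}"
  proof -
    show "finite I" by (simp add: I_def)
    show "I \<noteq> {}" using sq by (metis sum.empty zero_neq_one)
  qed
  have "distributed (std_gaussian d) lborel (\<lambda>g. \<Sum>j\<in>I. g j * z j)
      (normal_density (\<Sum>j\<in>I. 0) (sqrt (\<Sum>j\<in>I. \<bar>z j\<bar>\<^sup>2)))"
  proof (rule std_gaussian.sum_indep_normal[OF I])
    have "std_gaussian.indep_vars d (\<lambda>_. borel) (\<lambda>j g. (\<lambda>x. x * z j) (g j)) I"
      by (rule std_gaussian.indep_vars_compose2[OF indep_vars_std_gaussian_coordinates])
         (auto simp: I_def)
    then show "std_gaussian.indep_vars d (\<lambda>_. borel) (\<lambda>j g. g j * z j) I" by simp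
    fix j assume j: "j \<in> I"
    then show "0 < \<bar>z j\<bar>" by (simp add: I_def)
    show "distributed (std_gaussian d) lborel (\<lambda>g. g j * z j) (\<lambda>x. ennreal (normal_density 0 \<bar>z j\<bar> x))"
      using std_gaussian.normal_density_affine[OF distributed_std_gaussian_coordinate, of j d "z j" 0] j
      by (simp add: I_def mult.commute)
  qed
  moreover have "(\<Sum>j\<in>I. g j * z j) = euclid_inner d g z" for g
    unfolding I_def euclid_inner_def by (rule sum.mono_neutral_left) auto
  ultimately have "distributed (std_gaussian d) lborel (\<lambda>g. euclid_inner d g z) std_normal_density"
    using sq by simp
  then have "distr (std_gaussian d) lborel (\<lambda>g. euclid_inner d g z) = std_normal_distribution"
    by (simp add: distributed_def)
  moreover have "distr (std_gaussian d) borel (\<lambda>g. euclid_inner d g z)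
      = distr (std_gaussian d) lborel (\<lambda>g. euclid_inner d g z)"
    by (rule distr_cong) auto
  ultimately show ?thesis by simp
qed

lemma prob_euclid_inner:
  assumes "L2_set z {1..d} = 1" "S \<in> sets borel"
  shows "measure (std_gaussian d) {g \<in> space (std_gaussian d). euclid_inner d g z \<in> S}
    = measure std_normal_distribution S"
proof -
  have "measure std_normal_distribution S
      = measure (distr (std_gaussian d) borel (\<lambda>g. euclid_inner d g z)) S"
    by (simp add: distr_euclid_inner_std_gaussian assms)
  also have "\<dots> = measure (std_gaussian d)
      ((\<lambda>g. euclid_inner d g z) -` S \<inter> space (std_gaussian d))"
    by (rule measure_distr) (use assms in auto)
  also have "(\<lambda>g. euclid_inner d g z) -` S \<inter> space (std_gaussian d)
      = {g \<in> space (std_gaussian d). euclid_inner d g z \<in> S}" by auto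
  finally show ?thesis ..
qed

lemma nn_integral_exp_square_std_normal:
  "(\<integral>\<^sup>+x. ennreal (exp (x\<^sup>2 / 4)) \<partial>std_normal_distribution) = ennreal (sqrt 2)"
proof -
  have "(\<integral>\<^sup>+x. ennreal (exp (x\<^sup>2 / 4)) \<partial>std_normal_distribution)
      = (\<integral>\<^sup>+x. ennreal (std_normal_density x) * ennreal (exp (x\<^sup>2 / 4)) \<partial>lborel)"
    by (rule nn_integral_density) auto
  also have "\<dots> = (\<integral>\<^sup>+x. ennreal (sqrt 2) * ennreal (normal_density 0 (sqrt 2) x) \<partial>lborel)"
  proof (intro nn_integral_cong)
    fix x :: real
    have "exp (- x\<^sup>2 / 2) * exp (x\<^sup>2 / 4) = exp (- x\<^sup>2 / 4)"
      by (simp flip: exp_add)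
    then have "std_normal_density x * exp (x\<^sup>2 / 4) = sqrt 2 * normal_density 0 (sqrt 2) x"
      by (simp add: normal_density_def real_sqrt_mult field_simps)
    then show "ennreal (std_normal_density x) * ennreal (exp (x\<^sup>2 / 4))
        = ennreal (sqrt 2) * ennreal (normal_density 0 (sqrt 2) x)"
      by (simp flip: ennreal_mult)
  qed
  also have "\<dots> = ennreal (sqrt 2) * (\<integral>\<^sup>+x. ennreal (normal_density 0 (sqrt 2) x) \<partial>lborel)"
    by (rule nn_integral_cmult) simp
  also have "(\<integral>\<^sup>+x. ennreal (normal_density 0 (sqrt 2) x) \<partial>lborel) = 1"
    by (subst nn_integral_eq_integral) (auto simp: integral_normal_density)
  finally show ?thesis by simp
qed

locale gaussian_rows = prob_space M for M :: "'a measure" +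
  fixes d m :: nat and G :: "nat \<Rightarrow> 'a \<Rightarrow> nat \<Rightarrow> real"
  assumes indep: "indep_vars (\<lambda>_. \<Pi>\<^sub>M j\<in>{1..d}. borel) G {1..m}"
    and distr_row: "\<And>i. i \<in> {1..m} \<Longrightarrow> distr M (\<Pi>\<^sub>M j\<in>{1..d}. borel) (G i) = std_gaussian d"
begin

lemma measurable_row [measurable]: "i \<in> {1..m} \<Longrightarrow> G i \<in> measurable M (\<Pi>\<^sub>M j\<in>{1..d}. borel)"
  using indep by (simp add: indep_vars_def)

lemma chernoff:
  assumes [measurable]: "\<phi> \<in> borel_measurable (\<Pi>\<^sub>M j\<in>{1..d}. borel)"
    and mgf: "(\<integral>\<^sup>+g. ennreal (exp (\<phi> g)) \<partial>std_gaussian d) \<le> ennreal (exp a)"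
  shows "measure M {\<omega> \<in> space M. real m * a + w \<le> (\<Sum>i=1..m. \<phi> (G i \<omega>))} \<le> exp (- w)"
proof -
  have "(\<integral>\<^sup>+\<omega>. ennreal (\<Prod>i=1..m. exp (\<phi> (G i \<omega>))) \<partial>M)
      = (\<integral>\<^sup>+\<omega>. (\<Prod>i=1..m. ennreal (exp (\<phi> (G i \<omega>)))) \<partial>M)"
    by (simp add: prod_ennreal)
  also have "\<dots> = (\<Prod>i=1..m. \<integral>\<^sup>+\<omega>. ennreal (exp (\<phi> (G i \<omega>))) \<partial>M)"
    by (intro indep_vars_nn_integral indep_vars_compose2[OF indep]) measurable
  also have "\<dots> = (\<Prod>i=1..m. \<integral>\<^sup>+g. ennreal (exp (\<phi> g)) \<partial>std_gaussian d)"
  proof (intro prod.cong refl)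
    fix i assume i: "i \<in> {1..m}"
    show "(\<integral>\<^sup>+\<omega>. ennreal (exp (\<phi> (G i \<omega>))) \<partial>M) = (\<integral>\<^sup>+g. ennreal (exp (\<phi> g)) \<partial>std_gaussian d)"
      unfolding distr_row[OF i, symmetric] using i by (subst nn_integral_distr) auto
  qed
  also have "\<dots> \<le> (\<Prod>i=1..m. ennreal (exp a))"
    by (intro prod_mono_ennreal mgf)
  also have "\<dots> = ennreal (exp (m * a))"
    by (simp add: ennreal_power exp_of_nat_mult)
  finally have I: "(\<integral>\<^sup>+\<omega>. ennreal (\<Prod>i=1..m. exp (\<phi> (G i \<omega>))) \<partial>M) \<le> ennreal (exp (m * a))" .
  let ?S = "{\<omega> \<in> space M. real m * a + w \<le> (\<Sum>i=1..m. \<phi> (G i \<omega>))}"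
  have S: "?S \<in> sets M" by measurable
  have "emeasure M ?S = (\<integral>\<^sup>+\<omega>. indicator ?S \<omega> \<partial>M)" using S by simp
  also have "\<dots> \<le> (\<integral>\<^sup>+\<omega>. ennreal (exp (- (m * a + w))) * ennreal (\<Prod>i=1..m. exp (\<phi> (G i \<omega>))) \<partial>M)"
  proof (intro nn_integral_mono)
    fix \<omega>
    show "indicator ?S \<omega> \<le> ennreal (exp (- (m * a + w))) * ennreal (\<Prod>i=1..m. exp (\<phi> (G i \<omega>)))"
    proof (cases "\<omega> \<in> ?S")
      case True
      then have "0 \<le> - (m * a + w) + (\<Sum>i=1..m. \<phi> (G i \<omega>))" by simp
      then have "1 \<le> exp (- (m * a + w) + (\<Sum>i=1..m. \<phi> (G i \<omega>)))" by simp
      also have "\<dots> = exp (- (m * a + w)) * (\<Prod>i=1..m. exp (\<phi> (G i \<omega>)))"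
        by (simp only: exp_add exp_sum finite_atLeastAtMost)
      finally show ?thesis using True by (simp flip: ennreal_mult' ennreal_1)
    qed simp
  qed
  also have "\<dots> = ennreal (exp (- (m * a + w))) * (\<integral>\<^sup>+\<omega>. ennreal (\<Prod>i=1..m. exp (\<phi> (G i \<omega>))) \<partial>M)"
    by (rule nn_integral_cmult) measurable
  also have "\<dots> \<le> ennreal (exp (- (m * a + w))) * ennreal (exp (m * a))"
    by (intro mult_left_mono I) simp
  also have "\<dots> = ennreal (exp (- w))"
    by (simp flip: ennreal_mult exp_add)
  finally show ?thesis by (simp add: emeasure_eq_measure)
qed

text \<open>Bernstein's inequality, stated with the threshold as a function of the exponent. The quadratic
  bound \<open>exp (\<theta>\<^sup>2 v)\<close> for the exponential moment is available for \<open>\<theta> \<le> 1\<close>; the term linear in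
  \<^term>\<open>w\<close> pays for the case in which the optimal \<open>\<theta> = sqrt (w / (m v))\<close> exceeds 1.\<close>

lemma bernstein:
  fixes X :: "(nat \<Rightarrow> real) \<Rightarrow> real" and v w :: real
  assumes [measurable]: "X \<in> borel_measurable (\<Pi>\<^sub>M j\<in>{1..d}. borel)"
    and bound: "\<And>g. \<bar>X g\<bar> \<le> 1"
    and mean: "(\<integral>g. X g \<partial>std_gaussian d) = 0"
    and var: "(\<integral>g. (X g)\<^sup>2 \<partial>std_gaussian d) \<le> v"
    and w: "0 < w"
  shows "measure M {\<omega> \<in> space M. 2 * sqrt (m * v * w) + 2 * w \<le> (\<Sum>i=1..m. X (G i \<omega>))} \<le> exp (- w)"
proof -
  have v: "0 \<le> v" using var by (rule order_trans[rotated]) simp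
  have int [simp]: "integrable (std_gaussian d) X"
    by (rule std_gaussian.integrable_const_bound[of _ 1]) (use bound in auto)
  have int2 [simp]: "integrable (std_gaussian d) (\<lambda>g. (X g)\<^sup>2)"
    by (rule std_gaussian.integrable_const_bound[of _ 1]) (use bound in \<open>auto simp: abs_square_le_1\<close>)
  have mgf: "(\<integral>\<^sup>+g. ennreal (exp (\<theta> * X g)) \<partial>std_gaussian d) \<le> ennreal (exp (\<theta>\<^sup>2 * v))"
    if "0 \<le> \<theta>" "\<theta> \<le> 1" for \<theta>
  proof -
    have e: "exp y \<le> 1 + y + y\<^sup>2" if "\<bar>y\<bar> \<le> 1" for y :: real
    proof (cases "y \<ge> 0")
      case True then show ?thesis using exp_bound[of y] that by simp
    next
      case False
      have "exp (- y) \<ge> 1 + (- y)" by (rule exp_ge_add_one_self)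
      then have "exp y \<le> 1 / (1 - y)" using False by (simp add: exp_minus field_simps)
      also have "\<dots> \<le> 1 + y + y\<^sup>2"
      proof -
        have "1 \<le> (1 + y + y\<^sup>2) * (1 - y)"
        proof -
          have "(1 + y + y\<^sup>2) * (1 - y) = 1 - y ^ 3" by (simp add: algebra_simps power2_eq_square power3_eq_cube)
          moreover have "y ^ 3 \<le> 0" using False by (simp add: power3_eq_cube mult_nonneg_nonpos)
          ultimately show ?thesis by simp
        qed
        then show ?thesis using False by (simp add: divide_le_eq)
      qed
      finally show ?thesis .
    qed
    have le: "exp (\<theta> * X g) \<le> 1 + \<theta> * X g + \<theta>\<^sup>2 * (X g)\<^sup>2" for g
      using e[of "\<theta> * X g"] bound[of g] that
      by (simp add: abs_mult mult_le_one power_mult_distrib)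
    have "(\<integral>\<^sup>+g. ennreal (exp (\<theta> * X g)) \<partial>std_gaussian d)
        \<le> (\<integral>\<^sup>+g. ennreal (1 + \<theta> * X g + \<theta>\<^sup>2 * (X g)\<^sup>2) \<partial>std_gaussian d)"
      by (intro nn_integral_mono ennreal_leI le)
    also have "\<dots> = ennreal (\<integral>g. 1 + \<theta> * X g + \<theta>\<^sup>2 * (X g)\<^sup>2 \<partial>std_gaussian d)"
      by (rule nn_integral_eq_integral) (auto intro!: AE_I2 order_trans[OF _ le])
    also have "(\<integral>g. 1 + \<theta> * X g + \<theta>\<^sup>2 * (X g)\<^sup>2 \<partial>std_gaussian d)
        = 1 + \<theta>\<^sup>2 * (\<integral>g. (X g)\<^sup>2 \<partial>std_gaussian d)"
      by (simp add: mean std_gaussian.prob_space)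
    also have "\<dots> \<le> 1 + \<theta>\<^sup>2 * v" by (intro add_left_mono mult_left_mono var) simp
    also have "\<dots> \<le> exp (\<theta>\<^sup>2 * v)" by (rule exp_ge_add_one_self)
    finally show ?thesis by (simp add: ennreal_leI)
  qed
  have *: "measure M {\<omega> \<in> space M. 2 * sqrt (m * v * w) + 2 * w \<le> (\<Sum>i=1..m. X (G i \<omega>))} \<le> exp (- w)"
    if \<theta>: "0 < \<theta>" "\<theta> \<le> 1" "m * \<theta>\<^sup>2 * v + w \<le> \<theta> * (2 * sqrt (m * v * w) + 2 * w)" for \<theta> :: real
  proof -
    have "measure M {\<omega> \<in> space M. 2 * sqrt (m * v * w) + 2 * w \<le> (\<Sum>i=1..m. X (G i \<omega>))}
        \<le> measure M {\<omega> \<in> space M. real m * (\<theta>\<^sup>2 * v) + w \<le> (\<Sum>i=1..m. \<theta> * X (G i \<omega>))}"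
    proof (intro finite_measure_mono subsetI CollectI conjI; (elim CollectE conjE)?)
      fix \<omega> assume "\<omega> \<in> space M" and h: "2 * sqrt (m * v * w) + 2 * w \<le> (\<Sum>i=1..m. X (G i \<omega>))"
      have "real m * (\<theta>\<^sup>2 * v) + w \<le> \<theta> * (2 * sqrt (m * v * w) + 2 * w)" using \<theta>(3) by (simp add: mult.assoc)
      also have "\<dots> \<le> \<theta> * (\<Sum>i=1..m. X (G i \<omega>))" using h \<theta> by (intro mult_left_mono) auto
      finally show "real m * (\<theta>\<^sup>2 * v) + w \<le> (\<Sum>i=1..m. \<theta> * X (G i \<omega>))"
        by (simp add: sum_distrib_left)
    qed auto
    also have "\<dots> \<le> exp (- w)" by (intro chernoff mgf) (use \<theta> in auto)
    finally show ?thesis .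
  qed
  show ?thesis
  proof (cases "w \<le> m * v")
    case True
    then have mv: "0 < m * v" using w by simp
    define \<theta> where "\<theta> = sqrt (w / (m * v))"
    have \<theta>: "0 < \<theta>" "\<theta> \<le> 1" using True mv w by (auto simp: \<theta>_def)
    have nz: "v \<noteq> 0" "0 < m" using mv by (auto intro!: Nat.gr0I)
    then have "m * \<theta>\<^sup>2 * v = w" using mv w by (simp add: \<theta>_def)
    moreover have "\<theta> * sqrt (m * v * w) = w" using mv w nz
      by (simp add: \<theta>_def flip: real_sqrt_mult)
    ultimately have "m * \<theta>\<^sup>2 * v + w \<le> \<theta> * (2 * sqrt (m * v * w) + 2 * w)"
      using mult_pos_pos[OF \<theta>(1) w] by (simp add: distrib_left)
    then show ?thesis using * \<theta> by blast
  next
    case False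
    have "0 \<le> sqrt (m * v * w)" using v w by simp
    then have "real m * v + w \<le> 2 * sqrt (m * v * w) + 2 * w" using False by linarith
    then show ?thesis by (intro *[of 1]) simp_all
  qed
qed

lemma bernstein_abs:
  fixes X :: "(nat \<Rightarrow> real) \<Rightarrow> real" and v w :: real
  assumes [measurable]: "X \<in> borel_measurable (\<Pi>\<^sub>M j\<in>{1..d}. borel)"
    and "\<And>g. \<bar>X g\<bar> \<le> 1"
    and "(\<integral>g. X g \<partial>std_gaussian d) = 0"
    and "(\<integral>g. (X g)\<^sup>2 \<partial>std_gaussian d) \<le> v"
    and "0 < w"
  shows "measure M {\<omega> \<in> space M. 2 * sqrt (m * v * w) + 2 * w < \<bar>\<Sum>i=1..m. X (G i \<omega>)\<bar>} \<le> 2 * exp (- w)"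
    (is "measure M ?B \<le> _")
proof -
  let ?S = "\<lambda>Y. {\<omega> \<in> space M. 2 * sqrt (m * v * w) + 2 * w \<le> (\<Sum>i=1..m. Y (G i \<omega>))}"
  have "measure M ?B \<le> measure M (?S X \<union> ?S (\<lambda>g. - X g))"
    by (intro finite_measure_mono) (auto simp: sum_negf abs_if split: if_splits)
  also have "\<dots> \<le> measure M (?S X) + measure M (?S (\<lambda>g. - X g))"
    by (intro measure_Un_le) auto
  also have "measure M (?S X) \<le> exp (- w)" by (intro bernstein) (use assms in auto)
  also have "measure M (?S (\<lambda>g. - X g)) \<le> exp (- w)" by (intro bernstein) (use assms in auto)
  finally show ?thesis by simp
qed

text \<open>The excess of squares over a threshold controls all sums of \<^term>\<open>k\<close> squares at once: such a sum
  is at most \<open>k \<tau>\<close> plus the excess. This replaces a union bound over subsets of the rows.\<close>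

lemma excess_of_squares:
  assumes w: "0 \<le> w"
  shows "measure M {\<omega> \<in> space M. (L2_set z {1..d})\<^sup>2 * (6 * m * exp (- \<tau> / 4) + 4 * w)
      < (\<Sum>i=1..m. max 0 ((euclid_inner d (G i \<omega>) z)\<^sup>2 - \<tau> * (L2_set z {1..d})\<^sup>2))} \<le> exp (- w)"
    (is "measure M ?B \<le> _")
proof -
  define r where "r = L2_set z {1..d}"
  show ?thesis
  proof (cases "r = 0")
    case True
    then have "z j = 0" if "j \<in> {1..d}" for j
      using that by (simp add: r_def L2_set_eq_0_iff)
    then have "euclid_inner d g z = 0" for g by (simp add: euclid_inner_def)
    then have "?B = {}" using True by (auto simp: r_def)
    then show ?thesis by (simp only: measure_empty) simp
  next
    case False
    then have r: "0 < r" by (simp add: r_def L2_set_nonneg less_le)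
    define u where "u = (\<lambda>j. z j / r)"
    have u: "L2_set u {1..d} = 1"
      using L2_set_left_distrib[of "1 / r" z "{1..d}"] r
      by (simp add: u_def r_def[symmetric])
    have inner: "euclid_inner d g z = r * euclid_inner d g u" for g
      using r by (simp add: euclid_inner_def u_def sum_distrib_left)
    define \<phi> where "\<phi> g = max 0 ((euclid_inner d g u)\<^sup>2 - \<tau>) / 4" for g
    have [measurable]: "\<phi> \<in> borel_measurable (\<Pi>\<^sub>M j\<in>{1..d}. borel)"
      unfolding \<phi>_def by measurable
    have exc: "max 0 ((euclid_inner d g z)\<^sup>2 - \<tau> * r\<^sup>2) = r\<^sup>2 * (4 * \<phi> g)" for g
    proof -
      have "(euclid_inner d g z)\<^sup>2 - \<tau> * r\<^sup>2 = r\<^sup>2 * ((euclid_inner d g u)\<^sup>2 - \<tau>)"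
        by (simp add: inner algebra_simps power_mult_distrib)
      then show ?thesis using r by (simp add: \<phi>_def max_def zero_le_mult_iff mult_le_0_iff not_le)
    qed
    \<comment> \<open>\<open>exp (max 0 y) \<le> 1 + exp y\<close>, and the exponential moment of a quarter of the square of a
      standard normal variable is \<open>sqrt 2\<close>.\<close>
    define a where "a = sqrt 2 * exp (- \<tau> / 4)"
    have "(\<integral>\<^sup>+g. ennreal (exp (\<phi> g)) \<partial>std_gaussian d)
        \<le> (\<integral>\<^sup>+g. 1 + ennreal (exp (- \<tau> / 4)) * ennreal (exp ((euclid_inner d g u)\<^sup>2 / 4)) \<partial>std_gaussian d)"
    proof (intro nn_integral_mono)
      fix g
      have "exp (\<phi> g) \<le> 1 + exp (((euclid_inner d g u)\<^sup>2 - \<tau>) / 4)"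
        by (simp add: \<phi>_def max_def)
      also have "exp (((euclid_inner d g u)\<^sup>2 - \<tau>) / 4) = exp (- \<tau> / 4) * exp ((euclid_inner d g u)\<^sup>2 / 4)"
        by (simp add: diff_divide_distrib flip: exp_add)
      finally show "ennreal (exp (\<phi> g))
          \<le> 1 + ennreal (exp (- \<tau> / 4)) * ennreal (exp ((euclid_inner d g u)\<^sup>2 / 4))"
        by (simp add: ennreal_leI flip: ennreal_mult ennreal_1 ennreal_plus)
    qed
    also have "\<dots> = 1 + ennreal (exp (- \<tau> / 4)) *
        (\<integral>\<^sup>+g. ennreal (exp ((euclid_inner d g u)\<^sup>2 / 4)) \<partial>std_gaussian d)"
      by (subst nn_integral_add) (auto simp: nn_integral_cmult std_gaussian.emeasure_space_1)
    also have "(\<integral>\<^sup>+g. ennreal (exp ((euclid_inner d g u)\<^sup>2 / 4)) \<partial>std_gaussian d)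
        = (\<integral>\<^sup>+x. ennreal (exp (x\<^sup>2 / 4)) \<partial>distr (std_gaussian d) borel (\<lambda>g. euclid_inner d g u))"
      by (subst nn_integral_distr) auto
    also have "\<dots> = ennreal (sqrt 2)"
      by (simp add: distr_euclid_inner_std_gaussian[OF u] nn_integral_exp_square_std_normal)
    also have "1 + ennreal (exp (- \<tau> / 4)) * ennreal (sqrt 2) = ennreal (1 + a)"
      by (simp add: a_def mult.commute flip: ennreal_mult ennreal_1 ennreal_plus)
    also have "\<dots> \<le> ennreal (exp a)" by (intro ennreal_leI exp_ge_add_one_self)
    finally have mgf: "(\<integral>\<^sup>+g. ennreal (exp (\<phi> g)) \<partial>std_gaussian d) \<le> ennreal (exp a)" .
    have sqrt2: "4 * sqrt 2 \<le> (6::real)"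
      by (rule power2_le_imp_le) (auto simp: power_mult_distrib)
    have "measure M ?B \<le> measure M {\<omega> \<in> space M. real m * a + w \<le> (\<Sum>i=1..m. \<phi> (G i \<omega>))}"
    proof (intro finite_measure_mono subsetI CollectI conjI; (elim CollectE conjE)?)
      fix \<omega> assume "(L2_set z {1..d})\<^sup>2 * (6 * m * exp (- \<tau> / 4) + 4 * w)
        < (\<Sum>i=1..m. max 0 ((euclid_inner d (G i \<omega>) z)\<^sup>2 - \<tau> * (L2_set z {1..d})\<^sup>2))"
      then have "r\<^sup>2 * (6 * m * exp (- \<tau> / 4) + 4 * w) < r\<^sup>2 * (4 * (\<Sum>i=1..m. \<phi> (G i \<omega>)))"
        by (simp add: exc sum_distrib_left flip: r_def)
      then have 1: "6 * m * exp (- \<tau> / 4) + 4 * w < 4 * (\<Sum>i=1..m. \<phi> (G i \<omega>))"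
        using r by simp
      have "4 * (m * a) = (4 * sqrt 2) * (m * exp (- \<tau> / 4))" by (simp add: a_def)
      also have "\<dots> \<le> 6 * (m * exp (- \<tau> / 4))" by (intro mult_right_mono sqrt2) simp
      finally show "real m * a + w \<le> (\<Sum>i=1..m. \<phi> (G i \<omega>))" using 1 by (simp only: mult.assoc)
    qed auto
    also have "\<dots> \<le> exp (- w)" by (intro chernoff mgf) auto
    finally show ?thesis .
  qed
qed

end

section \<open>Quantiles\<close>

text \<open>The rank counted from the nearer end, so that \<open>tail_rank m j / m\<close> is the mass of the smaller
  tail at the \<open>j\<close>-th quantile.\<close>

definition tail_rank :: "nat \<Rightarrow> nat \<Rightarrow> nat" where
  "tail_rank m j = min j (m - j)"

lemma Fg_tail_gauss_quantile:
  assumes "0 < j" "j < m"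
  shows "Fg_tail (gauss_quantile m j) = real (tail_rank m j) / real m"
proof -
  have "Fg_tail (gauss_quantile m j) = min (real j / real m) (real (m - j) / real m)"
    unfolding Fg_tail_def using assms by (simp add: Fg_gauss_quantile of_nat_diff field_simps)
  also have "\<dots> = real (tail_rank m j) / real m"
    by (auto simp: tail_rank_def min_def divide_right_mono divide_le_cancel)
  finally show ?thesis .
qed

lemma gauss_quantile_square_le:
  assumes "0 < j" "j < m"
  shows "(gauss_quantile m j)\<^sup>2 \<le> 2 * ln (real m / real (tail_rank m j))"
  using square_le_ln_Fg_tail[of "gauss_quantile m j"] assms by (simp add: Fg_tail_gauss_quantile)

lemma gauss_quantile_le_iff:
  assumes "0 < i" "i < m" "0 < j" "j < m"
  shows "gauss_quantile m i \<le> gauss_quantile m j \<longleftrightarrow> i \<le> j"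
  using assms Fg_le_iff[of "gauss_quantile m i" "gauss_quantile m j"]
  by (simp add: Fg_gauss_quantile divide_le_cancel)

lemma Fg_tail_between_quantiles:
  assumes "0 < i" "i \<le> j" "j < m" "gauss_quantile m i \<le> t" "t \<le> gauss_quantile m j"
  shows "real (min (tail_rank m i) (tail_rank m j)) \<le> real m * Fg_tail t"
    and "real m * Fg_tail t \<le> real (min (tail_rank m i) (tail_rank m j)) + real (j - i)"
proof -
  have "real i / real m \<le> Fg t" "Fg t \<le> real j / real m"
    using Fg_mono[OF assms(4)] Fg_mono[OF assms(5)] assms by (auto simp: Fg_gauss_quantile)
  then have F: "real i \<le> real m * Fg t" "real m * Fg t \<le> real j"
    using assms by (auto simp: field_simps)
  have T: "real m * Fg_tail t = min (real m * Fg t) (real m - real m * Fg t)"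
    using assms by (simp add: Fg_tail_def min_mult_distrib_left algebra_simps)
  have R: "real (min (tail_rank m i) (tail_rank m j))
      = min (min (real i) (real m - real i)) (min (real j) (real m - real j))"
    using assms by (simp add: tail_rank_def of_nat_min of_nat_diff)
  have D: "real (j - i) = real j - real i" using assms by (simp add: of_nat_diff)
  have lower: "min (min a (u - a)) (min b (u - b)) \<le> min x (u - x)"
    and upper: "min x (u - x) \<le> min (min a (u - a)) (min b (u - b)) + (b - a)"
    if "a \<le> x" "x \<le> b" for a b u x :: real
    using that by (auto simp: min_def)
  show "real (min (tail_rank m i) (tail_rank m j)) \<le> real m * Fg_tail t"
    unfolding T R using lower F by blast
  show "real m * Fg_tail t \<le> real (min (tail_rank m i) (tail_rank m j)) + real (j - i)"
    unfolding T R D using upper F by blast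
qed

text \<open>The next two lemmas compare the increments of the quantile function with those of the rank, by
  the two comparisons of the density with the tail.\<close>

lemma gauss_quantile_diff_le:
  assumes "0 < i" "i \<le> j" "j < m"
  shows "real (min (tail_rank m i) (tail_rank m j)) * (gauss_quantile m j - gauss_quantile m i)
    \<le> 3 * real (j - i)"
proof -
  define n where "n = real (min (tail_rank m i) (tail_rank m j))"
  have m: "0 < real m" using assms by simp
  have le: "gauss_quantile m i \<le> gauss_quantile m j" using assms by (simp add: gauss_quantile_le_iff)
  have "n / (3 * real m) * (gauss_quantile m j - gauss_quantile m i)
      \<le> measure std_normal_distribution {gauss_quantile m i<..gauss_quantile m j}"
  proof (rule measure_std_normal_interval_ge[OF le])
    fix t assume "gauss_quantile m i \<le> t" "t \<le> gauss_quantile m j"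
    then have "n \<le> real m * Fg_tail t"
      unfolding n_def using assms by (intro Fg_tail_between_quantiles) auto
    also have "\<dots> \<le> real m * (3 * std_normal_density t)"
      by (intro mult_left_mono Fg_tail_le_density) simp
    finally show "n / (3 * real m) \<le> std_normal_density t" using m by (simp add: field_simps)
  qed (simp add: n_def)
  also have "\<dots> = real j / real m - real i / real m"
    using Fg_diff[OF le] assms by (simp add: Fg_gauss_quantile)
  also have "\<dots> = real (j - i) / real m"
    using assms by (simp add: of_nat_diff diff_divide_distrib)
  finally show ?thesis using m unfolding n_def[symmetric]
    by (simp add: divide_le_eq)
qed

lemma gauss_quantile_diff_ge:
  assumes "0 < i" "i \<le> j" "j < m"
    and l: "ln (exp 1 * real m / real (min (tail_rank m i) (tail_rank m j))) \<le> l"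
    and N: "real (min (tail_rank m i) (tail_rank m j)) + real (j - i) \<le> N"
  shows "real (j - i) \<le> 7 * N * l * (gauss_quantile m j - gauss_quantile m i)"
proof -
  define n where "n = real (min (tail_rank m i) (tail_rank m j))"
  have m: "0 < real m" using assms by simp
  have n: "0 < n" using assms by (simp add: n_def tail_rank_def)
  have le: "gauss_quantile m i \<le> gauss_quantile m j" using assms by (simp add: gauss_quantile_le_iff)
  have "real (j - i) / real m = real j / real m - real i / real m"
    using assms by (simp add: of_nat_diff diff_divide_distrib)
  also have "\<dots> = measure std_normal_distribution {gauss_quantile m i<..gauss_quantile m j}"
    using Fg_diff[OF le] assms by (simp add: Fg_gauss_quantile)
  also have "\<dots> \<le> measure std_normal_distribution {gauss_quantile m i..gauss_quantile m j}"
    by (intro std_normal.finite_measure_mono) auto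
  also have "\<dots> \<le> 7 * N * l / real m * (gauss_quantile m j - gauss_quantile m i)"
  proof (rule measure_std_normal_interval_le[OF le])
    fix t assume t: "gauss_quantile m i \<le> t" "t \<le> gauss_quantile m j"
    have lo: "n \<le> real m * Fg_tail t" and up: "real m * Fg_tail t \<le> N"
      using Fg_tail_between_quantiles[OF assms(1-3) t] N by (auto simp: n_def)
    have "exp 1 / Fg_tail t \<le> exp 1 * real m / n"
      using lo n m Fg_tail_pos[of t] by (simp add: field_simps)
    then have "ln (exp 1 / Fg_tail t) \<le> l"
      using l Fg_tail_pos[of t] n m unfolding n_def[symmetric]
      by (intro order_trans[OF _ l[folded n_def]] ln_mono) auto
    moreover have "1 \<le> ln (exp 1 / Fg_tail t)"
      using Fg_tail_pos[of t] Fg_tail_less_one[of t] ln_less_zero[of "Fg_tail t"]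
      by (simp add: ln_div)
    ultimately have "7 * Fg_tail t * ln (exp 1 / Fg_tail t) \<le> 7 * (N / real m) * l"
      using up m Fg_tail_pos[of t]
    proof (intro mult_mono)
      show "Fg_tail t \<le> N / real m" using up m by (simp add: field_simps)
      show "0 \<le> 7 * (N / real m)" using lo up n m by simp
      show "0 \<le> ln (exp 1 / Fg_tail t)" using \<open>1 \<le> ln (exp 1 / Fg_tail t)\<close> by linarith
    qed auto
    then show "std_normal_density t \<le> 7 * N * l / real m"
      using std_normal_density_le_tail[of t] by simp
  qed
  finally show ?thesis using m by (simp add: field_simps)
qed

section \<open>Counts and excesses of the rows\<close>

definition count_le :: "nat \<Rightarrow> nat \<Rightarrow> (nat \<Rightarrow> nat \<Rightarrow> real) \<Rightarrow> (nat \<Rightarrow> real) \<Rightarrow> real \<Rightarrow> nat" where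
  "count_le d m g x t = card {i \<in> {1..m}. euclid_inner d (g i) x \<le> t}"

definition excess :: "nat \<Rightarrow> nat \<Rightarrow> (nat \<Rightarrow> nat \<Rightarrow> real) \<Rightarrow> (nat \<Rightarrow> real) \<Rightarrow> real \<Rightarrow> real" where
  "excess d m g z \<tau> = (\<Sum>i=1..m. max 0 ((euclid_inner d (g i) z)\<^sup>2 - \<tau> * (L2_set z {1..d})\<^sup>2))"

text \<open>The variance in Bernstein's inequality for a difference of two counts.\<close>

definition flip_prob :: "nat \<Rightarrow> (nat \<Rightarrow> real) \<Rightarrow> (nat \<Rightarrow> real) \<Rightarrow> real \<Rightarrow> real" where
  "flip_prob d a b t = measure (std_gaussian d)
     {g \<in> space (std_gaussian d). (euclid_inner d g a \<le> t) \<noteq> (euclid_inner d g b \<le> t)}"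

lemma euclid_inner_diff:
  "euclid_inner d g (\<lambda>j. a j - b j) = euclid_inner d g a - euclid_inner d g b"
  by (simp add: euclid_inner_def right_diff_distrib sum_subtractf)

lemma count_le_eq_sum:
  "real (count_le d m g x t) = (\<Sum>i=1..m. indicator {..t} (euclid_inner d (g i) x))"
proof -
  have "(\<Sum>i=1..m. indicator {..t} (euclid_inner d (g i) x) :: real)
      = (\<Sum>i\<in>{i \<in> {1..m}. euclid_inner d (g i) x \<le> t}. 1)"
    by (rule sum.mono_neutral_cong_right) (auto simp: indicator_def)
  then show ?thesis by (simp add: count_le_def)
qed

lemma integral_indicator_euclid_inner:
  assumes "L2_set x {1..d} = 1"
  shows "(\<integral>g. indicator {..t} (euclid_inner d g x) \<partial>std_gaussian d) = Fg t"
proof -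
  have "(\<integral>g. indicator {..t} (euclid_inner d g x) \<partial>std_gaussian d)
      = (\<integral>y. indicator {..t} y \<partial>distr (std_gaussian d) borel (\<lambda>g. euclid_inner d g x) :: real)"
    by (subst integral_distr) auto
  also have "\<dots> = Fg t"
    by (simp add: distr_euclid_inner_std_gaussian[OF assms] Fg_def cdf_def)
  finally show ?thesis .
qed

lemma integrable_indicator_euclid_inner [simp]:
  "integrable (std_gaussian d) (\<lambda>g. indicator {..t} (euclid_inner d g x) :: real)"
  by (rule std_gaussian.integrable_const_bound[of _ 1]) (auto simp: indicator_def)

context gaussian_rows
begin

lemma count_le_deviation:
  assumes x: "L2_set x {1..d} = 1" and w: "0 < w"
  shows "measure M {\<omega> \<in> space M. 2 * sqrt (m * Fg_tail t * w) + 2 * w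
      < \<bar>real (count_le d m (\<lambda>i. G i \<omega>) x t) - m * Fg t\<bar>} \<le> 2 * exp (- w)"
proof -
  define X where "X g = indicator {..t} (euclid_inner d g x) - Fg t" for g
  have sum: "(\<Sum>i=1..m. X (G i \<omega>)) = real (count_le d m (\<lambda>i. G i \<omega>) x t) - m * Fg t" for \<omega>
    by (simp add: X_def sum_subtractf count_le_eq_sum)
  have "measure M {\<omega> \<in> space M. 2 * sqrt (m * Fg_tail t * w) + 2 * w < \<bar>\<Sum>i=1..m. X (G i \<omega>)\<bar>}
      \<le> 2 * exp (- w)"
  proof (intro bernstein_abs w)
    show "X \<in> borel_measurable (\<Pi>\<^sub>M j\<in>{1..d}. borel)" unfolding X_def by measurable
    show "\<bar>X g\<bar> \<le> 1" for g using Fg_pos[of t] Fg_less_1[of t] by (auto simp: X_def indicator_def)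
    show "(\<integral>g. X g \<partial>std_gaussian d) = 0"
      by (simp add: X_def integral_indicator_euclid_inner[OF x] std_gaussian.prob_space)
    have "(X g)\<^sup>2 = (1 - 2 * Fg t) * indicator {..t} (euclid_inner d g x) + (Fg t)\<^sup>2" for g
      by (auto simp: X_def indicator_def power2_eq_square algebra_simps)
    then have "(\<integral>g. (X g)\<^sup>2 \<partial>std_gaussian d) = (1 - 2 * Fg t) * Fg t + (Fg t)\<^sup>2"
      by (simp add: integral_indicator_euclid_inner[OF x] std_gaussian.prob_space)
    also have "\<dots> = Fg t * (1 - Fg t)" by (simp add: power2_eq_square algebra_simps)
    also have "\<dots> \<le> Fg_tail t"
      using Fg_pos[of t] Fg_less_1[of t] unfolding Fg_tail_def
      by (auto simp: min_def mult_le_cancel_left1 mult_le_cancel_right1)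
    finally show "(\<integral>g. (X g)\<^sup>2 \<partial>std_gaussian d) \<le> Fg_tail t" .
  qed
  then show ?thesis by (simp only: sum)
qed

lemma count_le_increment:
  assumes a: "L2_set a {1..d} = 1" and b: "L2_set b {1..d} = 1" and w: "0 < w"
  shows "measure M {\<omega> \<in> space M. 2 * sqrt (m * flip_prob d a b t * w) + 2 * w
      < \<bar>real (count_le d m (\<lambda>i. G i \<omega>) a t) - real (count_le d m (\<lambda>i. G i \<omega>) b t)\<bar>} \<le> 2 * exp (- w)"
proof -
  define X :: "(nat \<Rightarrow> real) \<Rightarrow> real" where
    "X g = indicator {..t} (euclid_inner d g a) - indicator {..t} (euclid_inner d g b)" for g
  have sum: "(\<Sum>i=1..m. X (G i \<omega>))
      = real (count_le d m (\<lambda>i. G i \<omega>) a t) - real (count_le d m (\<lambda>i. G i \<omega>) b t)" for \<omega>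
    by (simp add: X_def sum_subtractf count_le_eq_sum)
  have "measure M {\<omega> \<in> space M. 2 * sqrt (m * flip_prob d a b t * w) + 2 * w < \<bar>\<Sum>i=1..m. X (G i \<omega>)\<bar>}
      \<le> 2 * exp (- w)"
  proof (intro bernstein_abs w)
    show "X \<in> borel_measurable (\<Pi>\<^sub>M j\<in>{1..d}. borel)" unfolding X_def by measurable
    show "\<bar>X g\<bar> \<le> 1" for g by (auto simp: X_def indicator_def)
    show "(\<integral>g. X g \<partial>std_gaussian d) = 0"
      by (simp add: X_def integral_indicator_euclid_inner a b)
    let ?S = "{g \<in> space (std_gaussian d). (euclid_inner d g a \<le> t) \<noteq> (euclid_inner d g b \<le> t)}"
    have "(\<integral>g. (X g)\<^sup>2 \<partial>std_gaussian d) = (\<integral>g. indicator ?S g \<partial>std_gaussian d)"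
      by (intro Bochner_Integration.integral_cong) (auto simp: X_def indicator_def)
    also have "\<dots> = flip_prob d a b t"
      unfolding flip_prob_def by (rule Bochner_Integration.integral_indicator[THEN trans]) auto
    finally show "(\<integral>g. (X g)\<^sup>2 \<partial>std_gaussian d) \<le> flip_prob d a b t" by simp
  qed
  then show ?thesis by (simp only: sum)
qed

lemma excess_deviation:
  assumes "0 \<le> w" "0 < k" "0 < m"
  shows "measure M {\<omega> \<in> space M. (L2_set z {1..d})\<^sup>2 * (6 * k + 4 * w)
      < excess d m (\<lambda>i. G i \<omega>) z (4 * ln (real m / k))} \<le> exp (- w)"
proof -
  have "exp (- (4 * ln (real m / k)) / 4) = k / m"
    using assms by (simp add: exp_minus field_simps)
  then show ?thesis
    using excess_of_squares[OF assms(1), of z "4 * ln (real m / k)"] assms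
    by (simp add: excess_def)
qed

end

lemma measure_std_normal_two_sided:
  assumes "0 \<le> s"
  shows "measure std_normal_distribution {x. s < \<bar>x\<bar>} \<le> 2 * exp (- s\<^sup>2 / 2)"
proof -
  have "measure std_normal_distribution {x. s < \<bar>x\<bar>}
      \<le> measure std_normal_distribution ({..-s} \<union> (UNIV - {..s}))"
    by (intro std_normal.finite_measure_mono) auto
  also have "\<dots> \<le> measure std_normal_distribution {..-s} + measure std_normal_distribution (UNIV - {..s})"
    by (intro measure_Un_le) auto
  also have "\<dots> = Fg (- s) + (1 - Fg s)"
    using std_normal.prob_compl[of "{..s}"] by (simp add: Fg_def cdf_def)
  also have "\<dots> = 2 * Fg (- s)" by (simp add: Fg_uminus)
  also have "\<dots> \<le> 2 * exp (- s\<^sup>2 / 2)" using Fg_le_exp[of "-s"] assms by simp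
  finally show ?thesis .
qed

text \<open>A flip forces either \<open>\<langle>g, a\<rangle>\<close> to lie within \<open>\<theta> = 2 |a - b| l\<close> of the threshold or
  \<open>|\<langle>g, a - b\<rangle>| > \<theta>\<close>, and each event concerns one marginal only. The smallness of \<open>|a - b|\<close> keeps
  the density near the threshold comparable to its value at the threshold.\<close>

lemma flip_prob_le:
  assumes a: "L2_set a {1..d} = 1" and b: "L2_set b {1..d} = 1"
    and l: "ln (exp 1 / Fg_tail t) \<le> l"
    and r: "4 * euclid_dist d a b * l\<^sup>2 \<le> 1"
  shows "flip_prob d a b t \<le> 84 * euclid_dist d a b * Fg_tail t * l\<^sup>2 + 2 * exp (- 2 * l)"
proof -
  define r where "r = euclid_dist d a b"
  define p where "p = Fg_tail t"
  have p: "0 < p" "p < 1" by (auto simp: p_def Fg_tail_pos Fg_tail_less_one)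
  have lnp: "ln (exp 1 / p) = 1 + ln (1 / p)" using p by (simp add: ln_div)
  have "0 < ln (1 / p)" using p by simp
  then have l1: "1 \<le> l" using l lnp by (simp add: p_def)
  have r0: "0 \<le> r" by (simp add: r_def euclid_dist_def L2_set_nonneg)
  define \<theta> where "\<theta> = 2 * r * l"
  have \<theta>: "0 \<le> \<theta>" using r0 l1 by (simp add: \<theta>_def)
  have "t\<^sup>2 \<le> 2 * l" using square_le_ln_Fg_tail[of t] l lnp by (simp add: p_def)
  also have "2 * l \<le> (2 * l)\<^sup>2" using l1 by (simp add: power2_eq_square)
  finally have t: "\<bar>t\<bar> \<le> 2 * l" using l1 by (auto intro: power2_le_imp_le[of "\<bar>t\<bar>" "2 * l"])
  have "\<bar>t\<bar> * \<theta> \<le> 2 * l * \<theta>" using t \<theta> by (intro mult_right_mono)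
  also have "\<dots> \<le> 1" using r by (simp add: \<theta>_def r_def power2_eq_square algebra_simps)
  finally have t\<theta>: "\<bar>t\<bar> * \<theta> \<le> 1" .
  have near: "measure std_normal_distribution {t - \<theta>..t + \<theta>} \<le> 84 * r * p * l\<^sup>2"
  proof -
    have "measure std_normal_distribution {t - \<theta>..t + \<theta>} \<le> 21 * p * l * ((t + \<theta>) - (t - \<theta>))"
    proof (rule measure_std_normal_interval_le)
      fix x assume x: "t - \<theta> \<le> x" "x \<le> t + \<theta>"
      have "\<bar>t * (x - t)\<bar> \<le> \<bar>t\<bar> * \<theta>" unfolding abs_mult using x by (intro mult_left_mono) auto
      then have "- 1 \<le> t * (x - t)" using t\<theta> by linarith
      moreover have "x\<^sup>2 = t\<^sup>2 + 2 * (t * (x - t)) + (x - t)\<^sup>2"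
        by (simp add: power2_eq_square algebra_simps)
      moreover have "0 \<le> (x - t)\<^sup>2" by simp
      ultimately have "- x\<^sup>2 / 2 \<le> 1 + - t\<^sup>2 / 2" by linarith
      then have "exp (- x\<^sup>2 / 2) \<le> exp 1 * exp (- t\<^sup>2 / 2)" by (metis exp_add exp_le_cancel_iff)
      also have "\<dots> \<le> 3 * exp (- t\<^sup>2 / 2)" using exp_le by (intro mult_right_mono) auto
      finally have "std_normal_density x \<le> 3 * std_normal_density t"
        by (simp add: std_normal_density_exp divide_right_mono)
      also have "\<dots> \<le> 3 * (7 * p * ln (exp 1 / p))"
        using std_normal_density_le_tail[of t] by (simp add: p_def)
      also have "\<dots> \<le> 3 * (7 * p * l)" using l p by (intro mult_left_mono) (auto simp: p_def)
      finally show "std_normal_density x \<le> 21 * p * l" by simp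
    qed (use \<theta> in simp)
    also have "\<dots> = 84 * r * p * l\<^sup>2" by (simp add: \<theta>_def power2_eq_square)
    finally show ?thesis .
  qed
  show ?thesis
  proof (cases "r = 0")
    case True
    then have "a j = b j" if "j \<in> {1..d}" for j
      using that by (simp add: r_def euclid_dist_def L2_set_eq_0_iff)
    then have "euclid_inner d g a = euclid_inner d g b" for g by (simp add: euclid_inner_def)
    then have "flip_prob d a b t = 0" by (simp add: flip_prob_def)
    then show ?thesis using True by (simp add: r_def)
  next
    case False
    then have rp: "0 < r" using r0 by simp
    define u where "u = (\<lambda>j. (a j - b j) / r)"
    have u: "L2_set u {1..d} = 1"
      using L2_set_left_distrib[of "1 / r" "\<lambda>j. a j - b j" "{1..d}"] rp
      by (simp add: u_def r_def[unfolded euclid_dist_def, symmetric])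
    have inner: "euclid_inner d g a - euclid_inner d g b = r * euclid_inner d g u" for g
    proof -
      have "r * euclid_inner d g u = euclid_inner d g (\<lambda>j. a j - b j)"
        using rp by (simp add: euclid_inner_def u_def sum_distrib_left)
      then show ?thesis by (simp add: euclid_inner_diff)
    qed
    let ?A = "{g \<in> space (std_gaussian d). euclid_inner d g a \<in> {t - \<theta>..t + \<theta>}}"
    let ?B = "{g \<in> space (std_gaussian d). euclid_inner d g u \<in> {x. 2 * l < \<bar>x\<bar>}}"
    have "flip_prob d a b t \<le> measure (std_gaussian d) (?A \<union> ?B)"
      unfolding flip_prob_def
    proof (intro std_gaussian.finite_measure_mono subsetI)
      fix g assume g: "g \<in> {g \<in> space (std_gaussian d). (euclid_inner d g a \<le> t) \<noteq> (euclid_inner d g b \<le> t)}"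
      show "g \<in> ?A \<union> ?B"
      proof (rule ccontr)
        assume n: "g \<notin> ?A \<union> ?B"
        then have "\<bar>euclid_inner d g u\<bar> \<le> 2 * l" using g by auto
        then have "r * \<bar>euclid_inner d g u\<bar> \<le> \<theta>" using rp by (simp add: \<theta>_def)
        then have "\<bar>euclid_inner d g a - euclid_inner d g b\<bar> \<le> \<theta>"
          using rp by (simp add: inner abs_mult)
        moreover have "euclid_inner d g a < t - \<theta> \<or> t + \<theta> < euclid_inner d g a" using n g by auto
        ultimately show False using g \<theta> by auto
      qed
    qed auto
    also have "\<dots> \<le> measure (std_gaussian d) ?A + measure (std_gaussian d) ?B"
      by (intro measure_Un_le) auto
    also have "measure (std_gaussian d) ?A \<le> 84 * r * p * l\<^sup>2"
      by (subst prob_euclid_inner[OF a]) (use near in auto)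
    also have "measure (std_gaussian d) ?B \<le> 2 * exp (- (2 * l)\<^sup>2 / 2)"
      by (subst prob_euclid_inner[OF u]) (use l1 measure_std_normal_two_sided[of "2 * l"] in auto)
    also have "exp (- (2 * l)\<^sup>2 / 2) \<le> exp (- 2 * l)" using l1 by (simp add: power2_eq_square)
    finally show ?thesis by (simp add: r_def p_def)
  qed
qed

section \<open>Chaining\<close>

definition dyadic_log :: "real \<Rightarrow> nat" where
  "dyadic_log x = nat \<lfloor>log 2 x\<rfloor>"

lemma dyadic_log:
  assumes "1 \<le> x" shows "2 ^ dyadic_log x \<le> x" "x < 2 * 2 ^ dyadic_log x"
proof -
  define k where "k = \<lfloor>log 2 x\<rfloor>"
  have k: "0 \<le> k" using assms by (simp add: k_def)
  have e: "(2::real) ^ dyadic_log x = 2 powr of_int k"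
    using k by (simp add: dyadic_log_def k_def[symmetric] powr_realpow[symmetric] of_nat_nat)
  have "of_int k \<le> log 2 x" by (simp add: k_def)
  then show "2 ^ dyadic_log x \<le> x" using assms by (simp add: e powr_le_iff)
  have "log 2 x < of_int k + 1" unfolding k_def by linarith
  then have "x < 2 powr (of_int k + 1)" using assms by (simp add: less_powr_iff)
  then show "x < 2 * 2 ^ dyadic_log x" by (simp add: e powr_add)
qed

lemma dyadic_log_mono: "1 \<le> x \<Longrightarrow> x \<le> y \<Longrightarrow> dyadic_log x \<le> dyadic_log y"
  unfolding dyadic_log_def by (intro nat_mono floor_mono) simp

lemma euclid_dist_triangle: "euclid_dist n x z \<le> euclid_dist n x y + euclid_dist n y z"
  unfolding euclid_dist_def
  using L2_set_triangle_ineq[of "\<lambda>j. x j - y j" "\<lambda>j. y j - z j" "{1..n}"] by simp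

lemma euclid_dist_commute: "euclid_dist n x y = euclid_dist n y x"
  unfolding euclid_dist_def L2_set_def by (simp add: power2_commute)

lemma euclid_dist_nonneg: "0 \<le> euclid_dist n x y"
  by (simp add: euclid_dist_def L2_set_nonneg)

lemma euclid_inner_lipschitz:
  "\<bar>euclid_inner n g x - euclid_inner n g y\<bar> \<le> L2_set g {1..n} * euclid_dist n x y"
proof -
  have "\<bar>\<Sum>j=1..n. g j * (x j - y j)\<bar> \<le> (\<Sum>j=1..n. \<bar>g j\<bar> * \<bar>x j - y j\<bar>)"
    by (rule order_trans[OF sum_abs]) (simp add: abs_mult)
  also have "\<dots> \<le> L2_set g {1..n} * L2_set (\<lambda>j. x j - y j) {1..n}" by (rule L2_set_mult_ineq)
  finally show ?thesis
    by (simp add: euclid_dist_def euclid_inner_def right_diff_distrib sum_subtractf)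
qed

lemma count_le_shift:
  "real (count_le d m g x t) \<le> real (count_le d m g y t')
    + real (card {i \<in> {1..m}. t' - t < \<bar>euclid_inner d (g i) x - euclid_inner d (g i) y\<bar>})"
proof -
  have "count_le d m g x t \<le> card ({i \<in> {1..m}. euclid_inner d (g i) y \<le> t'}
      \<union> {i \<in> {1..m}. t' - t < \<bar>euclid_inner d (g i) x - euclid_inner d (g i) y\<bar>})"
    unfolding count_le_def by (intro card_mono) auto
  also have "\<dots> \<le> count_le d m g y t'
      + card {i \<in> {1..m}. t' - t < \<bar>euclid_inner d (g i) x - euclid_inner d (g i) y\<bar>}"
    unfolding count_le_def by (rule card_Un_le)
  finally show ?thesis by linarith
qed

text \<open>Each square is at most the threshold plus its excess over the threshold. With the threshold
  \<open>4 ln (m / k)\<close>, in units of the squared length of \<open>z\<close>, the thresholds and the part of the excess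
  that does not depend on \<open>W\<close> both sum to at most the order \<open>k ln (e m / k)\<close>.\<close>

lemma L2_set_le_of_excess:
  assumes I: "I \<subseteq> {1..m}" "card I \<le> k" and k: "0 < k" "k \<le> m" and W: "0 \<le> W"
    and exc: "excess d m g z (4 * ln (real m / real k)) \<le> (L2_set z {1..d})\<^sup>2 * (6 * real k + 32 * W)"
  shows "L2_set (\<lambda>i. euclid_inner d (g i) z) I
    \<le> L2_set z {1..d} * (sqrt (6 * real k * ln (exp 1 * m / k)) + 6 * sqrt W)"
proof -
  define r where "r = L2_set z {1..d}"
  define \<tau> where "\<tau> = 4 * ln (real m / real k)"
  define l where "l = ln (exp 1 * m / k)"
  have fin: "finite I" using I(1) by (rule finite_subset) simp
  have l: "l = 1 + ln (real m / real k)" using k by (simp add: l_def ln_mult ln_div)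
  have \<tau>: "0 \<le> \<tau>" using k by (simp add: \<tau>_def)
  have r: "0 \<le> r" by (simp add: r_def L2_set_nonneg)
  have "(\<Sum>i\<in>I. (euclid_inner d (g i) z)\<^sup>2)
      \<le> (\<Sum>i\<in>I. \<tau> * r\<^sup>2 + max 0 ((euclid_inner d (g i) z)\<^sup>2 - \<tau> * r\<^sup>2))"
    by (intro sum_mono) auto
  also have "\<dots> = card I * (\<tau> * r\<^sup>2) + (\<Sum>i\<in>I. max 0 ((euclid_inner d (g i) z)\<^sup>2 - \<tau> * r\<^sup>2))"
    by (simp add: sum.distrib)
  also have "\<dots> \<le> k * (\<tau> * r\<^sup>2) + excess d m g z \<tau>"
  proof (rule add_mono)
    show "real (card I) * (\<tau> * r\<^sup>2) \<le> k * (\<tau> * r\<^sup>2)"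
      using I(2) \<tau> by (intro mult_right_mono) auto
    show "(\<Sum>i\<in>I. max 0 ((euclid_inner d (g i) z)\<^sup>2 - \<tau> * r\<^sup>2)) \<le> excess d m g z \<tau>"
      unfolding excess_def r_def by (intro sum_mono2) (use I in auto)
  qed
  also have "\<dots> \<le> k * (\<tau> * r\<^sup>2) + r\<^sup>2 * (6 * real k + 32 * W)"
    using exc by (simp add: \<tau>_def r_def)
  also have "\<dots> = r\<^sup>2 * (k * \<tau> + 6 * k + 32 * W)" by (simp add: algebra_simps)
  also have "\<dots> \<le> r\<^sup>2 * (6 * real k * l + 36 * W)"
  proof (intro mult_left_mono)
    have "k * \<tau> + 6 * k \<le> 6 * real k * l" using k by (simp add: \<tau>_def l algebra_simps)
    then show "k * \<tau> + 6 * k + 32 * W \<le> 6 * real k * l + 36 * W" using W by linarith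
  qed simp
  finally have "L2_set (\<lambda>i. euclid_inner d (g i) z) I \<le> sqrt (r\<^sup>2 * (6 * real k * l + 36 * W))"
    unfolding L2_set_def by (rule real_sqrt_le_mono)
  also have "\<dots> = r * sqrt (6 * real k * l + 36 * W)" using r by (simp add: real_sqrt_mult)
  also have "\<dots> \<le> r * (sqrt (6 * real k * l) + sqrt (36 * W))"
    using W k by (intro mult_left_mono r sqrt_add_le_add_sqrt) (auto simp: l)
  also have "sqrt (36 * W) = 6 * sqrt W" by (simp add: real_sqrt_mult)
  finally show ?thesis by (simp add: r_def l_def)
qed

text \<open>The nets of a near-optimal admissible sequence for \<open>A\<close>, and for each \<open>x\<close> a chain of points \<open>p s x\<close>.
  The chain is used from the level \<open>s0\<close> on, where \<open>2 ^ s0\<close> is a small multiple of \<open>D = \<Delta> m\<close>. The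
  multiple is so small that deviations with exponent \<open>8 \<cdot> 2 ^ s0\<close> are still harmless, and events of
  probability \<open>exp (- 8 \<cdot> 2 ^ s0)\<close> can be summed over the at most \<open>exp (2 ^ s0)\<close> points of the net.\<close>

locale net =
  fixes d m :: nat and A :: "(nat \<Rightarrow> real) set" and T :: "nat \<Rightarrow> (nat \<Rightarrow> real) set"
    and p :: "nat \<Rightarrow> (nat \<Rightarrow> real) \<Rightarrow> (nat \<Rightarrow> real)" and \<gamma> D :: real
  assumes unit: "\<And>x. x \<in> A \<Longrightarrow> L2_set x {1..d} = 1"
    and T_subset: "\<And>s. T s \<subseteq> A" and T_finite: "\<And>s. finite (T s)"
    and T_card: "\<And>s. card (T s) \<le> 2 ^ 2 ^ s"
    and p_in_T: "\<And>s x. x \<in> A \<Longrightarrow> p s x \<in> T s"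
    and chain: "\<And>n x. x \<in> A \<Longrightarrow> (\<Sum>s<n. 2 ^ s * euclid_dist d x (p s x)) \<le> 2 * \<gamma>"
    and \<gamma>_ge: "1 \<le> \<gamma>" and \<gamma>_le: "\<gamma> \<le> real m"
    and D_ge: "1000000000 * \<gamma> * (ln (exp 1 * real m / \<gamma>)) ^ 3 \<le> D"
    and D_le: "2 * D \<le> real m"
begin

definition l :: real where "l = ln (exp 1 * real m / \<gamma>)"

definition s0 :: nat where "s0 = dyadic_log (D / 2 ^ 20)"

definition step :: "nat \<Rightarrow> (nat \<Rightarrow> real) \<Rightarrow> real" where
  "step s x = euclid_dist d (p s x) (p (Suc s) x)"

lemma m_pos: "0 < m" using \<gamma>_ge \<gamma>_le by (cases m) auto

lemma l_eq: "l = 1 + ln (real m / \<gamma>)"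
  using \<gamma>_ge m_pos by (simp add: l_def ln_mult ln_div)

lemma l_ge: "1 \<le> l" using \<gamma>_ge \<gamma>_le by (simp add: l_eq)

lemma D_ge': "1000000000 * (\<gamma> * l ^ 3) \<le> D" using D_ge by (simp add: l_def)

lemma \<gamma>l_le: "1000000000 * (\<gamma> * l) \<le> D"
proof -
  have "l \<le> l ^ 3" using l_ge by (simp add: self_le_power)
  then have "\<gamma> * l \<le> \<gamma> * l ^ 3" using \<gamma>_ge by (intro mult_left_mono) auto
  then show ?thesis using D_ge' by linarith
qed

lemma \<gamma>_le_D: "1000000000 * \<gamma> \<le> D"
proof -
  have "\<gamma> \<le> \<gamma> * l" using l_ge \<gamma>_ge by simp
  then show ?thesis using \<gamma>l_le by linarith
qed

lemma D_large: "1000000000 \<le> D" using \<gamma>_le_D \<gamma>_ge by linarith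

lemma ln_le_l: assumes "\<gamma> \<le> n" shows "ln (exp 1 * real m / n) \<le> l"
  unfolding l_def using assms \<gamma>_ge m_pos by (intro ln_mono) (auto intro!: divide_left_mono)

lemma ln_m_le: "1000000000 * ln m \<le> D"
proof -
  have "ln \<gamma> \<le> \<gamma>" using \<gamma>_ge ln_le_minus_one[of \<gamma>] by linarith
  moreover have "ln (m / \<gamma>) \<le> \<gamma> * ln (m / \<gamma>)"
    using \<gamma>_ge \<gamma>_le by (simp add: mult_le_cancel_right1)
  moreover have "ln m = ln (m / \<gamma>) + ln \<gamma>" using m_pos \<gamma>_ge by (simp add: ln_div)
  ultimately have "ln m \<le> \<gamma> * l" by (simp add: l_eq algebra_simps)
  then show ?thesis using \<gamma>l_le by linarith
qed

lemma s0: "2 ^ s0 \<le> D / 2 ^ 20" "D / 2 ^ 20 < 2 * 2 ^ s0"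
  using dyadic_log[of "D / 2 ^ 20"] D_large by (simp_all add: s0_def)

lemma \<gamma>_le_s0: "100 * \<gamma> * l ^ 2 \<le> 2 ^ s0"
proof -
  have "\<gamma> * l ^ 2 \<le> \<gamma> * l ^ 3" using l_ge \<gamma>_ge by (intro mult_left_mono power_increasing) auto
  then have "1000000000 * (\<gamma> * l ^ 2) \<le> D" using D_ge' by linarith
  moreover have "D < 2097152 * 2 ^ s0" using s0(2) by (simp add: field_simps)
  moreover have "(0::real) < 2 ^ s0" by simp
  ultimately show ?thesis by linarith
qed

lemma pos_s0: "s0 \<le> s \<Longrightarrow> (2::real) ^ s0 \<le> 2 ^ s" by (simp add: power_increasing)

lemma step_nonneg: "0 \<le> step s x" by (simp add: step_def euclid_dist_nonneg)

lemma dist_p_le: assumes "x \<in> A" shows "2 ^ s * euclid_dist d x (p s x) \<le> 2 * \<gamma>"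
proof -
  have "2 ^ s * euclid_dist d x (p s x) \<le> (\<Sum>s<Suc s. 2 ^ s * euclid_dist d x (p s x))"
    by (rule member_le_sum) (auto simp: euclid_dist_nonneg)
  also have "\<dots> \<le> 2 * \<gamma>" by (rule chain[OF assms])
  finally show ?thesis .
qed

lemma sum_step: assumes x: "x \<in> A" shows "(\<Sum>s=a..<b. 2 ^ s * step s x) \<le> 3 * \<gamma>"
proof -
  define \<rho> where "\<rho> s = euclid_dist d x (p s x)" for s
  have \<rho>: "0 \<le> \<rho> s" for s by (simp add: \<rho>_def euclid_dist_nonneg)
  have "(\<Sum>s=a..<b. 2 ^ s * step s x) \<le> (\<Sum>s<b. 2 ^ s * step s x)"
    by (intro sum_mono2) (auto simp: step_nonneg)
  also have "\<dots> \<le> (\<Sum>s<b. 2 ^ s * \<rho> s + (1 / 2) * (2 ^ Suc s * \<rho> (Suc s)))"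
  proof (intro sum_mono)
    fix s
    have "step s x \<le> \<rho> s + \<rho> (Suc s)"
      using euclid_dist_triangle[of d "p s x" "p (Suc s) x" x]
      by (simp add: step_def \<rho>_def euclid_dist_commute[of d "p s x" x])
    then have "2 ^ s * step s x \<le> 2 ^ s * (\<rho> s + \<rho> (Suc s))" by (intro mult_left_mono) auto
    then show "2 ^ s * step s x \<le> 2 ^ s * \<rho> s + (1 / 2) * (2 ^ Suc s * \<rho> (Suc s))"
      by (simp add: algebra_simps)
  qed
  also have "\<dots> = (\<Sum>s<b. 2 ^ s * \<rho> s) + (1 / 2) * (\<Sum>s<b. 2 ^ Suc s * \<rho> (Suc s))"
    by (simp only: sum.distrib sum_distrib_left)
  also have "(\<Sum>s<b. 2 ^ Suc s * \<rho> (Suc s)) \<le> (\<Sum>s<Suc b. 2 ^ s * \<rho> s)"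
    unfolding sum.lessThan_Suc_shift using \<rho>[of 0] by simp
  finally show ?thesis using chain[OF x, of b] chain[OF x, of "Suc b"] unfolding \<rho>_def by linarith
qed

lemma step_le: assumes "x \<in> A" shows "2 ^ s * step s x \<le> 3 * \<gamma>"
  using sum_step[OF assms, of s "Suc s"] by simp

lemma p_in_A: "x \<in> A \<Longrightarrow> p s x \<in> A" using p_in_T T_subset by blast

lemma p_tendsto: assumes "x \<in> A"
  shows "(\<lambda>s. euclid_inner d h (p s x)) \<longlonglongrightarrow> euclid_inner d h x"
proof -
  have "(\<lambda>s. euclid_inner d h (p s x) - euclid_inner d h x) \<longlonglongrightarrow> 0"
  proof (rule Lim_null_comparison)
    show "\<forall>\<^sub>F s in sequentially. norm (euclid_inner d h (p s x) - euclid_inner d h x)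
        \<le> L2_set h {1..d} * (2 * \<gamma>) * (1 / 2) ^ s"
    proof (intro always_eventually allI)
      fix s
      have "euclid_dist d (p s x) x \<le> (2 * \<gamma>) * (1 / 2) ^ s"
        using dist_p_le[OF assms, of s] by (simp add: euclid_dist_commute[of d x] power_one_over field_simps)
      then have "L2_set h {1..d} * euclid_dist d (p s x) x \<le> L2_set h {1..d} * ((2 * \<gamma>) * (1 / 2) ^ s)"
        by (intro mult_left_mono) (auto simp: L2_set_nonneg)
      then show "norm (euclid_inner d h (p s x) - euclid_inner d h x)
          \<le> L2_set h {1..d} * (2 * \<gamma>) * (1 / 2) ^ s"
        using euclid_inner_lipschitz[of d h "p s x" x] by simp
    qed
    show "(\<lambda>s. L2_set h {1..d} * (2 * \<gamma>) * (1 / 2) ^ s) \<longlonglongrightarrow> 0"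
      by (intro tendsto_mult_right_zero LIMSEQ_power_zero) simp
  qed
  then show ?thesis by (simp add: LIM_zero_iff)
qed

end

text \<open>The deterministic part of the argument concerns a fixed realisation \<open>g\<close> of the rows that
  satisfies all the deviation inequalities, at the level \<open>s0\<close> and for all later increments. The
  exponent at level \<open>s\<close> is \<open>8 \<cdot> 2 ^ s\<close>.\<close>

locale good_rows = net +
  fixes g :: "nat \<Rightarrow> nat \<Rightarrow> real"
  assumes start_count: "\<And>a j. a \<in> T s0 \<Longrightarrow> 0 < j \<Longrightarrow> j < m \<Longrightarrow>
      \<bar>real (count_le d m g a (gauss_quantile m j)) - real j\<bar>
        \<le> 2 * sqrt (m * Fg_tail (gauss_quantile m j) * (8 * 2 ^ s0)) + 2 * (8 * 2 ^ s0)"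
    and step_count: "\<And>s a b j. s0 \<le> s \<Longrightarrow> a \<in> T s \<Longrightarrow> b \<in> T (Suc s) \<Longrightarrow> 0 < j \<Longrightarrow> j < m \<Longrightarrow>
      \<bar>real (count_le d m g a (gauss_quantile m j)) - real (count_le d m g b (gauss_quantile m j))\<bar>
        \<le> 2 * sqrt (m * flip_prob d a b (gauss_quantile m j) * (8 * 2 ^ s)) + 2 * (8 * 2 ^ s)"
    and start_excess: "\<And>a k. a \<in> T s0 \<Longrightarrow> 0 < k \<Longrightarrow> k \<le> m \<Longrightarrow>
      excess d m g a (4 * ln (real m / real k)) \<le> (L2_set a {1..d})\<^sup>2 * (6 * real k + 4 * (8 * 2 ^ s0))"
    and step_excess: "\<And>s a b k. s0 \<le> s \<Longrightarrow> a \<in> T s \<Longrightarrow> b \<in> T (Suc s) \<Longrightarrow> 0 < k \<Longrightarrow> k \<le> m \<Longrightarrow>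
      excess d m g (\<lambda>j. a j - b j) (4 * ln (real m / real k))
        \<le> (L2_set (\<lambda>j. a j - b j) {1..d})\<^sup>2 * (6 * real k + 4 * (8 * 2 ^ s))"
begin

lemma L2_set_step_le:
  assumes x: "x \<in> A" and s: "s0 \<le> s" and I: "I \<subseteq> {1..m}" "card I \<le> k" and k: "0 < k" "k \<le> m"
  shows "L2_set (\<lambda>i. euclid_inner d (g i) (p s x) - euclid_inner d (g i) (p (Suc s) x)) I
    \<le> step s x * (sqrt (6 * real k * ln (exp 1 * m / k)) + 6 * sqrt (2 ^ s))"
  using L2_set_le_of_excess[OF I k, of "2 ^ s" d g "\<lambda>j. p s x j - p (Suc s) x j"]
    step_excess[OF s p_in_T[OF x] p_in_T[OF x] k]
  by (simp add: step_def euclid_dist_def euclid_inner_diff)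

text \<open>For \<open>s \<ge> S\<close> the factor \<open>sqrt (6 k log (e m / k)) + 6 sqrt (2 ^ s)\<close> of a step is \<open>2 ^ s\<close> times a
  decreasing function of \<open>s\<close>, and the chain sums \<open>2 ^ s\<close> times the step lengths.\<close>

lemma L2_set_chain_le:
  assumes x: "x \<in> A" and S: "s0 \<le> S" and I: "I \<subseteq> {1..m}" "card I \<le> k" and k: "0 < k" "k \<le> m"
  shows "L2_set (\<lambda>i. euclid_inner d (g i) x - euclid_inner d (g i) (p S x)) I
    \<le> 3 * \<gamma> * (sqrt (6 * real k * ln (exp 1 * m / k)) / 2 ^ S + 6 / sqrt (2 ^ S))"
proof -
  define y where "y s i = euclid_inner d (g i) (p s x)" for s i
  define u where "u = sqrt (6 * real k * ln (exp 1 * m / k))"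
  have "1 \<le> ln (exp 1 * m / k)" using k by (simp add: ln_mult ln_div)
  then have u: "0 \<le> u" by (simp add: u_def)
  have fin: "finite I" using I(1) by (rule finite_subset) simp
  have "L2_set (\<lambda>i. y (S + n) i - y S i) I \<le> (\<Sum>s=S..<S + n. step s x * (u + 6 * sqrt (2 ^ s)))" for n
  proof (induction n)
    case (Suc n)
    have "L2_set (\<lambda>i. y (S + Suc n) i - y S i) I
        = L2_set (\<lambda>i. - (y (S + n) i - y (Suc (S + n)) i) + (y (S + n) i - y S i)) I"
      by simp
    also have "\<dots> \<le> L2_set (\<lambda>i. - (y (S + n) i - y (Suc (S + n)) i)) I + L2_set (\<lambda>i. y (S + n) i - y S i) I"
      by (rule L2_set_triangle_ineq)
    also have "L2_set (\<lambda>i. - (y (S + n) i - y (Suc (S + n)) i)) I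
        = L2_set (\<lambda>i. y (S + n) i - y (Suc (S + n)) i) I"
      by (simp add: L2_set_def power2_commute)
    also have "\<dots> \<le> step (S + n) x * (u + 6 * sqrt (2 ^ (S + n)))"
      unfolding y_def u_def by (rule L2_set_step_le) (use x S I k in auto)
    finally show ?case using Suc.IH by simp
  qed (simp add: L2_set_def)
  also have "(\<Sum>s=S..<S + n. step s x * (u + 6 * sqrt (2 ^ s)))
      \<le> (\<Sum>s=S..<S + n. 2 ^ s * step s x * (u / 2 ^ S + 6 / sqrt (2 ^ S)))" for n
  proof (intro sum_mono)
    fix s assume "s \<in> {S..<S + n}"
    then have le: "(2::real) ^ S \<le> 2 ^ s" by (simp add: power_increasing)
    have "2 ^ s * (u / 2 ^ s + 6 / sqrt (2 ^ s)) = u + 6 * (2 ^ s / sqrt (2 ^ s))"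
      by (simp add: distrib_left)
    also have "2 ^ s / sqrt (2 ^ s) = sqrt (2 ^ s)" by (rule real_div_sqrt) simp
    finally have "u + 6 * sqrt (2 ^ s) = 2 ^ s * (u / 2 ^ s + 6 / sqrt (2 ^ s))" ..
    also have "\<dots> \<le> 2 ^ s * (u / 2 ^ S + 6 / sqrt (2 ^ S))"
      using le u by (intro mult_left_mono add_mono divide_left_mono) auto
    finally have "step s x * (u + 6 * sqrt (2 ^ s)) \<le> step s x * (2 ^ s * (u / 2 ^ S + 6 / sqrt (2 ^ S)))"
      by (intro mult_left_mono step_nonneg)
    then show "step s x * (u + 6 * sqrt (2 ^ s)) \<le> 2 ^ s * step s x * (u / 2 ^ S + 6 / sqrt (2 ^ S))"
      by (simp only: mult_ac)
  qed
  also have "(\<Sum>s=S..<S + n. 2 ^ s * step s x * (u / 2 ^ S + 6 / sqrt (2 ^ S)))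
      \<le> 3 * \<gamma> * (u / 2 ^ S + 6 / sqrt (2 ^ S))" for n
    unfolding sum_distrib_right[symmetric] using u by (intro mult_right_mono sum_step x) auto
  finally have bound: "L2_set (\<lambda>i. y (S + n) i - y S i) I \<le> 3 * \<gamma> * (u / 2 ^ S + 6 / sqrt (2 ^ S))" for n .
  have "(\<lambda>n. y (S + n) i) \<longlonglongrightarrow> euclid_inner d (g i) x" for i
    using LIMSEQ_ignore_initial_segment[OF p_tendsto[OF x, of "g i"], of S]
    by (simp add: y_def add.commute)
  then have "(\<lambda>n. L2_set (\<lambda>i. y (S + n) i - y S i) I) \<longlonglongrightarrow> L2_set (\<lambda>i. euclid_inner d (g i) x - y S i) I"
    unfolding L2_set_def by (intro tendsto_intros)
  from LIMSEQ_le_const2[OF this] bound show ?thesis by (auto simp: y_def u_def)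
qed

text \<open>The increments beyond \<open>s0\<close> contribute no more than the starting point \<open>p s0 x\<close>, because
  \<open>3 \<gamma> \<le> 2 ^ s0\<close>.\<close>

lemma sum_squares_le:
  assumes x: "x \<in> A" and I: "I \<subseteq> {1..m}" "card I \<le> k" and k: "D \<le> real k" "k \<le> m"
  shows "(\<Sum>i\<in>I. (euclid_inner d (g i) x)\<^sup>2) \<le> 289 * (k * ln (exp 1 * m / k))"
proof -
  define u where "u = sqrt (6 * real k * ln (exp 1 * m / k))"
  have k0: "0 < k" using k D_large by (cases k) auto
  have lk: "1 \<le> ln (exp 1 * m / k)" using k k0 by (simp add: ln_mult ln_div)
  define v where "v = k * ln (exp 1 * m / k)"
  have v: "real k \<le> v" "0 \<le> v" using lk by (auto simp: v_def mult_le_cancel_left1)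
  have uv: "u = sqrt 6 * sqrt v" by (simp add: u_def v_def real_sqrt_mult)
  have "(2::real) ^ s0 \<le> D" using s0(1) D_large by (simp add: field_simps)
  then have w: "sqrt (2 ^ s0) \<le> sqrt v" using v k by (intro real_sqrt_le_mono) linarith
  have "L2_set (\<lambda>i. euclid_inner d (g i) x) I
      = L2_set (\<lambda>i. euclid_inner d (g i) (p s0 x) + (euclid_inner d (g i) x - euclid_inner d (g i) (p s0 x))) I"
    by simp
  also have "\<dots> \<le> L2_set (\<lambda>i. euclid_inner d (g i) (p s0 x)) I
      + L2_set (\<lambda>i. euclid_inner d (g i) x - euclid_inner d (g i) (p s0 x)) I"
    by (rule L2_set_triangle_ineq)
  also have "L2_set (\<lambda>i. euclid_inner d (g i) (p s0 x)) I \<le> u + 6 * sqrt (2 ^ s0)"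
    using L2_set_le_of_excess[OF I k0 k(2), of "2 ^ s0" d g "p s0 x"]
      start_excess[OF p_in_T[OF x] k0 k(2)] unit[OF p_in_A[OF x]] by (simp add: u_def)
  also have "L2_set (\<lambda>i. euclid_inner d (g i) x - euclid_inner d (g i) (p s0 x)) I
      \<le> 3 * \<gamma> * (u / 2 ^ s0 + 6 / sqrt (2 ^ s0))"
    unfolding u_def by (rule L2_set_chain_le[OF x order_refl I k0 k(2)])
  also have "\<dots> \<le> 2 ^ s0 * (u / 2 ^ s0 + 6 / sqrt (2 ^ s0))"
  proof (intro mult_right_mono)
    have "1 \<le> l ^ 2" using l_ge by simp
    then have "\<gamma> \<le> \<gamma> * l ^ 2" using \<gamma>_ge by simp
    then show "3 * \<gamma> \<le> 2 ^ s0" using \<gamma>_le_s0 \<gamma>_ge by linarith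
  qed (use lk in \<open>auto simp: u_def\<close>)
  also have "\<dots> = u + 6 * (2 ^ s0 / sqrt (2 ^ s0))" by (simp add: distrib_left)
  also have "\<dots> = u + 6 * sqrt (2 ^ s0)" by (simp only: real_div_sqrt zero_le_power zero_le_numeral)
  finally have "L2_set (\<lambda>i. euclid_inner d (g i) x) I \<le> 2 * u + 12 * sqrt (2 ^ s0)" by simp
  also have "\<dots> \<le> 17 * sqrt v"
  proof -
    have "2 * sqrt 6 \<le> (5::real)" by (rule power2_le_imp_le) (auto simp: power_mult_distrib)
    then have "2 * sqrt 6 * sqrt v \<le> 5 * sqrt v" using v by (intro mult_right_mono) auto
    then show ?thesis using w uv by linarith
  qed
  finally have "(L2_set (\<lambda>i. euclid_inner d (g i) x) I)\<^sup>2 \<le> (17 * sqrt v)\<^sup>2"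
    by (intro power_mono) (auto simp: L2_set_nonneg)
  then show ?thesis using v by (simp add: L2_set_def sum_nonneg power_mult_distrib v_def)
qed

text \<open>If more than \<^term>\<open>e\<close> coordinates of \<open>\<Gamma> (x - p S x)\<close> exceeded \<^term>\<open>\<delta>\<close>, their Euclidean norm
  would be larger than the chain permits for \<^term>\<open>e\<close> rows.\<close>

lemma card_large_le:
  assumes x: "x \<in> A" and S: "s0 \<le> S" and e: "0 < e" "e \<le> m" "2 ^ S \<le> real e" "\<gamma> \<le> real e"
    and \<delta>: "27 * \<gamma> * sqrt l \<le> \<delta> * 2 ^ S"
  shows "card {i \<in> {1..m}. \<delta> < \<bar>euclid_inner d (g i) x - euclid_inner d (g i) (p S x)\<bar>} \<le> e"
proof (rule ccontr)
  define z where "z i = euclid_inner d (g i) x - euclid_inner d (g i) (p S x)" for i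
  assume "\<not> ?thesis"
  then have "e \<le> card {i \<in> {1..m}. \<delta> < \<bar>z i\<bar>}" by (simp add: z_def)
  then obtain I where I: "I \<subseteq> {i \<in> {1..m}. \<delta> < \<bar>z i\<bar>}" "card I = e" "finite I"
    by (rule obtain_subset_with_card_n)
  have le: "e * ln (exp 1 * m / e) \<le> e * l" using ln_le_l[OF e(4)] by (intro mult_left_mono) auto
  have l0: "0 \<le> l" "1 \<le> sqrt l" using l_ge by auto
  have "0 < 27 * \<gamma> * sqrt l" using \<gamma>_ge l0 by simp
  then have \<delta>0: "0 < \<delta>" using \<delta> by (smt (verit) zero_less_mult_iff zero_less_power)
  have "e * \<delta>\<^sup>2 = (\<Sum>i\<in>I. \<delta>\<^sup>2)" by (simp add: I)
  also have "\<dots> < (\<Sum>i\<in>I. (z i)\<^sup>2)"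
  proof (rule sum_strict_mono)
    show "I \<noteq> {}" using I(2) e(1) by auto
    fix i assume "i \<in> I"
    then have "\<delta> < \<bar>z i\<bar>" using I by auto
    then show "\<delta>\<^sup>2 < (z i)\<^sup>2" using \<delta>0 power_strict_mono[of \<delta> "\<bar>z i\<bar>" 2] by simp
  qed (rule I)
  finally have "sqrt (e * \<delta>\<^sup>2) < L2_set z I" by (simp add: L2_set_def)
  also have "L2_set z I \<le> 3 * \<gamma> * (sqrt (6 * real e * ln (exp 1 * m / e)) / 2 ^ S + 6 / sqrt (2 ^ S))"
    unfolding z_def[abs_def] by (rule L2_set_chain_le[OF x S _ _ e(1,2)]) (use I in auto)
  also have "\<dots> \<le> 3 * \<gamma> * (9 * sqrt (e * l) / 2 ^ S)"
  proof (intro mult_left_mono)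
    have "sqrt (6 * real e * ln (exp 1 * m / e)) \<le> sqrt (9 * (e * l))"
      using le mult_nonneg_nonneg[of "real e" l] l0 by (intro real_sqrt_le_mono) linarith
    then have 1: "sqrt (6 * real e * ln (exp 1 * m / e)) \<le> 3 * sqrt (e * l)" by (simp add: real_sqrt_mult)
    have "sqrt (2 ^ S) \<le> sqrt (e * l)"
    proof (intro real_sqrt_le_mono)
      have "real e \<le> e * l" using l_ge by (simp add: mult_le_cancel_left1)
      then show "2 ^ S \<le> e * l" using e(3) by linarith
    qed
    moreover have "6 / sqrt (2 ^ S) = 6 * sqrt (2 ^ S) / 2 ^ S"
      by (simp add: field_simps)
    ultimately have "6 / sqrt (2 ^ S) \<le> 6 * sqrt (e * l) / 2 ^ S"
      by (simp add: divide_right_mono)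
    moreover have "sqrt (6 * real e * ln (exp 1 * m / e)) / 2 ^ S \<le> 3 * sqrt (e * l) / 2 ^ S"
      using 1 by (simp add: divide_right_mono)
    ultimately show "sqrt (6 * real e * ln (exp 1 * m / e)) / 2 ^ S + 6 / sqrt (2 ^ S) \<le> 9 * sqrt (e * l) / 2 ^ S"
      by (simp add: add_divide_distrib[symmetric])
  qed (use \<gamma>_ge in simp)
  also have "\<dots> = (27 * \<gamma> * sqrt l) / 2 ^ S * sqrt e" by (simp add: real_sqrt_mult)
  also have "\<dots> \<le> \<delta> * sqrt e" using \<delta> by (intro mult_right_mono) (auto simp: divide_le_eq)
  also have "\<dots> = sqrt (e * \<delta>\<^sup>2)" using \<delta>0 by (simp add: real_sqrt_mult)
  finally show False by simp
qed

end

section \<open>The empirical distribution function between the tails\<close>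

context good_rows
begin

definition rk :: "nat \<Rightarrow> real" where "rk i = real (tail_rank m i)"

text \<open>The permitted error of a count at the \<open>i\<close>-th quantile: the standard deviation of a single count
  is about \<open>sqrt (rk i)\<close>, and an exponent of order \<^term>\<open>D\<close> multiplies it by \<open>sqrt D\<close>.\<close>

definition dev :: "nat \<Rightarrow> real" where "dev i = sqrt (D * rk i)"

lemma rk_nonneg: "0 \<le> rk i" by (simp add: rk_def)

lemma dev_nonneg: "0 \<le> dev i" using D_large by (simp add: dev_def rk_nonneg)

lemma Fg_tail_rk: "0 < i \<Longrightarrow> i < m \<Longrightarrow> m * Fg_tail (gauss_quantile m i) = rk i"
  by (simp add: Fg_tail_gauss_quantile rk_def)

text \<open>Steps beyond \<open>s0\<close> have length at most \<open>1 / (4 l\<^sup>2)\<close>, so the bound on the flip probability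
  applies. Its exponentially small term is at most \<open>2 \<gamma> / m\<close>, and \<open>\<gamma> \<le> 2 ^ s\<close>.\<close>

lemma flip_step_le:
  assumes x: "x \<in> A" and s: "s0 \<le> s" and i: "0 < i" "i < m" and rk: "\<gamma> \<le> rk i"
  shows "m * flip_prob d (p s x) (p (Suc s) x) (gauss_quantile m i)
    \<le> 84 * step s x * rk i * l\<^sup>2 + 2 * 2 ^ s"
proof -
  have m0: "0 < real m" using m_pos by simp
  have r0: "0 < rk i" using rk \<gamma>_ge by linarith
  have tail: "Fg_tail (gauss_quantile m i) = rk i / m"
    using i by (simp add: Fg_tail_gauss_quantile rk_def)
  have lg: "ln (exp 1 / Fg_tail (gauss_quantile m i)) \<le> l"
    using ln_le_l[OF rk] by (simp add: tail)
  have "4 * step s x * l\<^sup>2 \<le> 1"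
  proof -
    have "100 * \<gamma> * l\<^sup>2 * step s x \<le> 2 ^ s * step s x"
      using \<gamma>_le_s0 pos_s0[OF s] by (intro mult_right_mono step_nonneg) linarith
    also have "\<dots> \<le> 3 * \<gamma>" by (rule step_le[OF x])
    finally have "\<gamma> * (100 * (l\<^sup>2 * step s x)) \<le> \<gamma> * 3" by (simp add: algebra_simps)
    then have "100 * (l\<^sup>2 * step s x) \<le> 3" using \<gamma>_ge by simp
    then show ?thesis by (simp add: algebra_simps)
  qed
  then have "flip_prob d (p s x) (p (Suc s) x) (gauss_quantile m i)
      \<le> 84 * step s x * (rk i / m) * l\<^sup>2 + 2 * exp (- 2 * l)"
    using flip_prob_le[OF unit[OF p_in_A[OF x]] unit[OF p_in_A[OF x]] lg, of s "Suc s"]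
    by (simp add: step_def tail)
  then have "m * flip_prob d (p s x) (p (Suc s) x) (gauss_quantile m i)
      \<le> m * (84 * step s x * (rk i / m) * l\<^sup>2 + 2 * exp (- 2 * l))"
    by (rule mult_left_mono) simp
  also have "\<dots> = 84 * step s x * rk i * l\<^sup>2 + 2 * (m * exp (- 2 * l))"
    using m0 by (simp add: algebra_simps)
  also have "m * exp (- 2 * l) \<le> 2 ^ s"
  proof -
    have "exp (- 2 * l) \<le> exp (- ln (m / \<gamma>))" using l_eq l_ge by simp
    also have "\<dots> = \<gamma> / m" using m0 \<gamma>_ge by (simp add: exp_minus)
    finally have "m * exp (- 2 * l) \<le> \<gamma>" using m0 by (simp add: field_simps)
    moreover have "\<gamma> \<le> \<gamma> * l\<^sup>2" using \<gamma>_ge l_ge by simp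
    ultimately show ?thesis using \<gamma>_le_s0 pos_s0[OF s] \<gamma>_ge by linarith
  qed
  finally show ?thesis by simp
qed

text \<open>The main term of the Bernstein deviation of one step is a multiple of
  \<open>l sqrt (2 ^ s (step s x) (rk i))\<close>. The arithmetic-geometric mean inequality splits it into a part
  that the chain sums and a part to be multiplied with the number of levels, which is at most
  \<open>2 l\<close>. The weight \<open>8192\<close> is chosen to make the second part small; the first one is then small by
  the size of the constant in \<open>10^9 \<gamma> l\<^sup>3 \<le> D\<close>.\<close>

lemma step_count_le:
  assumes x: "x \<in> A" and s: "s0 \<le> s" and i: "0 < i" "i < m" and rk: "\<gamma> \<le> rk i"
  shows "\<bar>real (count_le d m g (p s x) (gauss_quantile m i))
        - real (count_le d m g (p (Suc s) x) (gauss_quantile m i))\<bar>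
    \<le> dev i * 52 * (8192 * l ^ 3 * (2 ^ s * step s x) / D + 1 / (32768 * l)) + 24 * 2 ^ s"
proof -
  define a where "a = 2 ^ s * step s x"
  define y where "y = sqrt (a / D)"
  have D0: "0 < D" using D_large by linarith
  have a0: "0 \<le> a" by (simp add: a_def step_nonneg)
  have y0: "0 \<le> y" and y2: "y\<^sup>2 = a / D" using a0 D0 by (auto simp: y_def)
  have l0: "0 < l" using l_ge by linarith
  have sq: "sqrt (a * rk i) = dev i * y"
    using D0 by (simp add: dev_def y_def flip: real_sqrt_mult)
  have "m * flip_prob d (p s x) (p (Suc s) x) (gauss_quantile m i) * (8 * 2 ^ s)
      \<le> (84 * step s x * rk i * l\<^sup>2 + 2 * 2 ^ s) * (8 * 2 ^ s)"
    by (intro mult_right_mono flip_step_le x s i rk) simp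
  also have "\<dots> = 672 * (l\<^sup>2 * (a * rk i)) + (4 * 2 ^ s)\<^sup>2"
    by (simp add: a_def power2_eq_square algebra_simps)
  also have "\<dots> \<le> 26\<^sup>2 * (l\<^sup>2 * (a * rk i)) + (4 * 2 ^ s)\<^sup>2"
    using a0 rk_nonneg[of i] by (intro add_right_mono mult_right_mono) auto
  finally have "sqrt (m * flip_prob d (p s x) (p (Suc s) x) (gauss_quantile m i) * (8 * 2 ^ s))
      \<le> sqrt (26\<^sup>2 * (l\<^sup>2 * (a * rk i)) + (4 * 2 ^ s)\<^sup>2)" by (rule real_sqrt_le_mono)
  also have "\<dots> \<le> sqrt (26\<^sup>2 * (l\<^sup>2 * (a * rk i))) + sqrt ((4 * 2 ^ s)\<^sup>2)"
    using a0 rk_nonneg[of i] by (intro sqrt_add_le_add_sqrt) auto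
  also have "\<dots> = 26 * (l * sqrt (a * rk i)) + 4 * 2 ^ s"
    using l0 by (simp add: real_sqrt_mult)
  finally have bound: "sqrt (m * flip_prob d (p s x) (p (Suc s) x) (gauss_quantile m i) * (8 * 2 ^ s))
      \<le> 26 * (l * sqrt (a * rk i)) + 4 * 2 ^ s" .
  define B where "B = 8192 * l ^ 3 * a / D + 1 / (32768 * l)"
  have "l * sqrt (a * rk i) = dev i * (l * y)" by (simp add: sq)
  also have "\<dots> \<le> dev i * (8192 * l ^ 3 * a / D + 1 / (32768 * l))"
  proof (intro mult_left_mono dev_nonneg)
    have "0 \<le> (2 * 8192 * (l\<^sup>2 * y) - 1)\<^sup>2" by simp
    then have "l\<^sup>2 * y \<le> 8192 * (l\<^sup>2 * y)\<^sup>2 + 1 / 32768"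
      by (simp add: power2_eq_square algebra_simps)
    also have "(l\<^sup>2 * y)\<^sup>2 = l * (l ^ 3 * (a / D))"
      unfolding power_mult_distrib y2 by (simp add: power2_eq_square power3_eq_cube)
    finally have "l * (l * y) \<le> l * (8192 * (l ^ 3 * (a / D)) + 1 / (32768 * l))"
      using l0 by (simp add: power2_eq_square algebra_simps)
    then show "l * y \<le> 8192 * l ^ 3 * a / D + 1 / (32768 * l)" using l0 by simp
  qed
  also have "\<dots> = dev i * B" by (simp add: B_def)
  finally show ?thesis
    using step_count[OF s p_in_T[OF x] p_in_T[OF x] i] bound
    unfolding a_def[symmetric] B_def[symmetric] by linarith
qed

lemma chain_count_le:
  assumes x: "x \<in> A" and S: "s0 \<le> S" and levels: "real (S - s0) \<le> 2 * l"
    and i: "0 < i" "i < m" and rk: "\<gamma> \<le> rk i"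
  shows "\<bar>real (count_le d m g (p S x) (gauss_quantile m i))
        - real (count_le d m g (p s0 x) (gauss_quantile m i))\<bar> \<le> dev i / 200 + 24 * 2 ^ S"
proof -
  define N where "N s = real (count_le d m g (p s x) (gauss_quantile m i))" for s
  have D0: "0 < D" using D_large by linarith
  have "\<bar>N S - N s0\<bar> = \<bar>\<Sum>s=s0..<S. N (Suc s) - N s\<bar>" using S by (simp add: sum_Suc_diff')
  also have "\<dots> \<le> (\<Sum>s=s0..<S. \<bar>N (Suc s) - N s\<bar>)" by (rule sum_abs)
  also have "\<dots> \<le> (\<Sum>s=s0..<S. dev i * 52 * (8192 * l ^ 3 * (2 ^ s * step s x) / D + 1 / (32768 * l)) + 24 * 2 ^ s)"
    using step_count_le[OF x _ i rk] by (intro sum_mono) (simp add: N_def abs_minus_commute)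
  also have "\<dots> = dev i * 52 * (8192 * l ^ 3 / D * (\<Sum>s=s0..<S. 2 ^ s * step s x) + (S - s0) * (1 / (32768 * l)))
      + 24 * (\<Sum>s=s0..<S. 2 ^ s)"
    by (simp add: sum.distrib sum_distrib_left sum_divide_distrib distrib_left mult_ac)
  also have "\<dots> \<le> dev i * 52 * (24576 / 1000000000 + 1 / 16384) + 24 * 2 ^ S"
  proof (intro add_mono mult_left_mono)
    have "8192 * l ^ 3 / D * (\<Sum>s=s0..<S. 2 ^ s * step s x) \<le> 8192 * l ^ 3 / D * (3 * \<gamma>)"
      using D0 l_ge by (intro mult_left_mono sum_step x) auto
    also have "\<dots> \<le> 24576 / 1000000000" using D_ge' D0 by (simp add: field_simps)
    finally show "8192 * l ^ 3 / D * (\<Sum>s=s0..<S. 2 ^ s * step s x) \<le> 24576 / 1000000000" .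
    show "(S - s0) * (1 / (32768 * l)) \<le> 1 / 16384" using levels l_ge by (simp add: field_simps)
    have "(\<Sum>s=s0..<S. 2 ^ s :: real) \<le> (\<Sum>s<S. 2 ^ s)" by (intro sum_mono2) auto
    also have "\<dots> \<le> 2 ^ S" by (simp add: sum_power2 lessThan_atLeast0[symmetric] geometric_sum)
    finally show "(\<Sum>s=s0..<S. 2 ^ s :: real) \<le> 2 ^ S" .
  qed (auto simp: dev_nonneg)
  also have "dev i * 52 * (24576 / 1000000000 + 1 / 16384) \<le> dev i / 200"
    using dev_nonneg[of i] by simp
  finally show ?thesis by (simp add: N_def)
qed

lemma start_count_le:
  assumes x: "x \<in> A" and i: "0 < i" "i < m" and rk: "D \<le> 2 * rk i"
  shows "\<bar>real (count_le d m g (p s0 x) (gauss_quantile m i)) - real i\<bar> \<le> dev i / 150"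
proof -
  have D0: "0 < D" using D_large by linarith
  have q: "8 * 2 ^ s0 \<le> D / 131072" using s0(1) by (simp add: field_simps)
  have "sqrt (rk i * (8 * 2 ^ s0)) \<le> dev i / 362"
  proof (rule real_le_lsqrt)
    have "rk i * (8 * 2 ^ s0) \<le> rk i * (D / 131072)" using q by (intro mult_left_mono rk_nonneg)
    also have "\<dots> \<le> D * rk i / 131044" using D0 rk_nonneg[of i] by (simp add: field_simps)
    also have "\<dots> = (dev i / 362)\<^sup>2" using D0 rk_nonneg[of i] by (simp add: dev_def power_divide)
    finally show "rk i * (8 * 2 ^ s0) \<le> (dev i / 362)\<^sup>2" .
  qed (use dev_nonneg in auto)
  moreover have "D \<le> 2 * dev i"
  proof (rule power2_le_imp_le)
    have "D * D \<le> D * (4 * rk i)" using rk D0 by (intro mult_left_mono) auto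
    then show "D\<^sup>2 \<le> (2 * dev i)\<^sup>2" using D0 rk_nonneg[of i]
      by (simp add: dev_def power_mult_distrib power2_eq_square)
  qed (use dev_nonneg in auto)
  ultimately show ?thesis
    using start_count[OF p_in_T[OF x] i] q dev_nonneg[of i] unfolding Fg_tail_rk[OF i]
    by linarith
qed

text \<open>The point \<^term>\<open>x\<close> is compared with \<open>p S x\<close> at a threshold shifted by \<open>e\<close> ranks, where \<open>2 ^ S\<close>
  and \<open>e\<close> are small multiples of \<open>dev j\<close>. The shift absorbs all but \<open>e\<close> of the coordinates of
  \<open>\<Gamma> (x - p S x)\<close>, and \<open>p S x\<close> is compared with \<open>p s0 x\<close> by chaining at the shifted threshold.\<close>

lemma count_le_quantile:
  assumes x: "x \<in> A" and j: "0 < j" "j < m" and rk: "D \<le> rk j"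
  shows "\<bar>real (count_le d m g x (gauss_quantile m j)) - real j\<bar> \<le> dev j / 2"
proof -
  define X where "X = dev j"
  define e where "e = nat \<lceil>X / 16\<rceil>"
  define S where "S = dyadic_log (X / 2048)"
  have D0: "0 < D" using D_large by linarith
  have X2: "X\<^sup>2 = D * rk j" using D0 by (simp add: X_def dev_def rk_nonneg)
  have X_ge: "D \<le> X"
  proof (rule power2_le_imp_le)
    show "D\<^sup>2 \<le> X\<^sup>2" unfolding X2 unfolding power2_eq_square using rk D0 by (intro mult_left_mono) auto
  qed (simp add: X_def dev_nonneg)
  have X_le: "X \<le> rk j"
  proof (rule power2_le_imp_le)
    show "X\<^sup>2 \<le> (rk j)\<^sup>2" unfolding X2 unfolding power2_eq_square using rk D0 by (intro mult_right_mono) auto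
  qed (simp add: rk_nonneg)
  have e: "X / 16 \<le> e" "real e \<le> X / 8"
  proof -
    have c: "real e = of_int \<lceil>X / 16\<rceil>" using X_ge D_large by (simp add: e_def)
    show "X / 16 \<le> e" by (simp add: c)
    have "real e \<le> X / 16 + 1" unfolding c by linarith
    then show "real e \<le> X / 8" using X_ge D_large by linarith
  qed
  have rkj: "rk j \<le> j" "rk j \<le> real m - j" using j by (auto simp: rk_def tail_rank_def of_nat_diff)
  have rkm: "rk j \<le> m" using rkj by linarith
  have S: "2 ^ S \<le> X / 2048" "X / 2048 < 2 * 2 ^ S"
    using dyadic_log[of "X / 2048"] X_ge D_large by (auto simp: S_def)
  have s0S: "s0 \<le> S" unfolding s0_def S_def
    using X_ge D_large by (intro dyadic_log_mono) (auto simp: field_simps)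
  have levels: "real (S - s0) \<le> 2 * l"
  proof -
    have "2 ^ (S - s0) * 2 ^ s0 = (2::real) ^ S" using s0S by (simp flip: power_add)
    also have "\<dots> \<le> m / 2048" using S(1) X_le rkm by linarith
    finally have "2 ^ (S - s0) * (2048 * (2097152 * 2 ^ s0)) \<le> 2097152 * real m"
      by (simp add: field_simps)
    moreover have "1000000000 * \<gamma> \<le> 2097152 * 2 ^ s0"
      using s0(2) \<gamma>_le_D by (simp add: field_simps)
    then have "2 ^ (S - s0) * (2048 * (1000000000 * \<gamma>)) \<le> 2 ^ (S - s0) * (2048 * (2097152 * 2 ^ s0))"
      by (intro mult_left_mono) auto
    ultimately have "2 ^ (S - s0) * \<gamma> \<le> m" using \<gamma>_ge m_pos by linarith
    then have "2 ^ (S - s0) \<le> m / \<gamma>" using \<gamma>_ge by (simp add: field_simps)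
    then have "ln (2 ^ (S - s0)) \<le> ln (m / \<gamma>)" by (intro ln_mono) auto
    then have "real (S - s0) * ln 2 \<le> l" by (simp add: l_eq ln_realpow)
    moreover have "real (S - s0) * (1 / 2) \<le> real (S - s0) * ln 2"
      using ln2_ge_two_thirds by (intro mult_left_mono) auto
    ultimately show ?thesis by linarith
  qed
  have near: "\<bar>real (count_le d m g (p S x) (gauss_quantile m i)) - real i\<bar> \<le> X / 30"
    and large: "card {k \<in> {1..m}. \<bar>gauss_quantile m i - gauss_quantile m j\<bar>
        < \<bar>euclid_inner d (g k) x - euclid_inner d (g k) (p S x)\<bar>} \<le> e"
    if i: "0 < i" "i < m" and ij: "i = j + e \<or> j = i + e" for i
  proof -
    have rki: "rk i \<le> 2 * rk j" "rk j \<le> 2 * rk i" and rki': "rk i \<le> rk j + e" "rk j \<le> rk i + e"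
      using ij i j e X_le unfolding rk_def tail_rank_def by (auto simp: of_nat_diff of_nat_min min_def split: if_splits)
    have dev_i: "dev i \<le> 1.5 * X"
    proof (rule power2_le_imp_le)
      have "D * rk i \<le> D * (2.25 * rk j)" using rki D0 rk_nonneg[of j] by (intro mult_left_mono) auto
      then show "(dev i)\<^sup>2 \<le> (1.5 * X)\<^sup>2" unfolding power_mult_distrib X2 using D0 rk_nonneg[of i]
        by (simp add: dev_def power2_eq_square)
    qed (use dev_nonneg X_def in auto)
    have rk\<gamma>: "\<gamma> \<le> rk i" "\<gamma> \<le> rk j" using \<gamma>_le_D rk rki \<gamma>_ge by linarith+
    show "\<bar>real (count_le d m g (p S x) (gauss_quantile m i)) - real i\<bar> \<le> X / 30"
      using chain_count_le[OF x s0S levels i rk\<gamma>(1)] start_count_le[OF x i] rki rk dev_i S(1)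
      by linarith
    define \<delta> where "\<delta> = \<bar>gauss_quantile m i - gauss_quantile m j\<bar>"
    have \<delta>e: "e \<le> 7 * (2 * rk j) * l * \<delta>"
    proof (cases "i = j + e")
      case True
      have "real (i - j) \<le> 7 * (2 * rk j) * l * (gauss_quantile m i - gauss_quantile m j)"
      proof (rule gauss_quantile_diff_ge)
        show "ln (exp 1 * real m / real (min (tail_rank m j) (tail_rank m i))) \<le> l"
          using rk\<gamma> by (intro ln_le_l) (auto simp: rk_def min_def)
        show "real (min (tail_rank m j) (tail_rank m i)) + real (i - j) \<le> 2 * rk j"
          using True e X_le rk_nonneg[of j] by (simp add: rk_def of_nat_min) 
      qed (use True i j in auto)
      then show ?thesis using True i j by (simp add: \<delta>_def gauss_quantile_le_iff)
    next
      case False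
      then have False': "j = i + e" using ij by simp
      have "real (j - i) \<le> 7 * (2 * rk j) * l * (gauss_quantile m j - gauss_quantile m i)"
      proof (rule gauss_quantile_diff_ge)
        show "ln (exp 1 * real m / real (min (tail_rank m i) (tail_rank m j))) \<le> l"
          using rk\<gamma> by (intro ln_le_l) (auto simp: rk_def min_def)
        show "real (min (tail_rank m i) (tail_rank m j)) + real (j - i) \<le> 2 * rk j"
          using False' e X_le rk_nonneg[of j] by (simp add: rk_def of_nat_min)
      qed (use False' i j in auto)
      moreover have "gauss_quantile m i \<le> gauss_quantile m j"
        using False' i j by (simp add: gauss_quantile_le_iff)
      ultimately show ?thesis using False' by (simp add: \<delta>_def)
    qed
    have e\<gamma>: "\<gamma> \<le> e" using e X_ge \<gamma>_le_D \<gamma>_ge by linarith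
    show "card {k \<in> {1..m}. \<bar>gauss_quantile m i - gauss_quantile m j\<bar>
        < \<bar>euclid_inner d (g k) x - euclid_inner d (g k) (p S x)\<bar>} \<le> e"
      unfolding \<delta>_def[symmetric]
    proof (rule card_large_le[OF x s0S])
      show "0 < e" using e\<gamma> \<gamma>_ge by linarith
      show "e \<le> m" using e X_le rkm rk_nonneg[of j] by linarith
      show "2 ^ S \<le> real e" using S e X_ge D0 by linarith
      show "27 * \<gamma> * sqrt l \<le> \<delta> * 2 ^ S"
      proof -
        have sl: "sqrt l \<le> l\<^sup>2"
        proof -
          have "l \<le> l\<^sup>2" using l_ge by (simp add: power2_eq_square)
          moreover have "sqrt l \<le> l" using l_ge by (intro real_le_lsqrt) (auto simp: power2_eq_square)
          ultimately show ?thesis by linarith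
        qed
        have pos: "0 < rk j * l" using rk D0 l_ge by simp
        have \<delta>0: "0 \<le> \<delta>" by (simp add: \<delta>_def)
        have "X / 16 \<le> 14 * (rk j * l) * \<delta>" using \<delta>e e by (simp add: mult_ac)
        then have "X / 16 * (X / 4096) \<le> (14 * (rk j * l) * \<delta>) * 2 ^ S"
          using S(2) X_ge D0 pos \<delta>0 by (intro mult_mono) auto
        moreover have "X / 16 * (X / 4096) = D * rk j / 65536"
          using X2 by (simp add: power2_eq_square)
        ultimately have 1: "D * rk j \<le> (917504 * (\<delta> * 2 ^ S)) * (rk j * l)" by (simp add: mult_ac)
        have "27 * \<gamma> * sqrt l * l \<le> 27 * \<gamma> * l\<^sup>2 * l"
          using sl \<gamma>_ge l_ge by (intro mult_right_mono mult_left_mono) auto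
        also have "\<dots> = 27 * (\<gamma> * l ^ 3)" by (simp add: power2_eq_square power3_eq_cube)
        finally have "917504 * (27 * \<gamma> * sqrt l * l) \<le> D" using D_ge' \<gamma>_ge l_ge
          by (smt (verit) mult_nonneg_nonneg zero_le_power)
        then have "917504 * (27 * \<gamma> * sqrt l * l) * rk j \<le> D * rk j"
          by (intro mult_right_mono rk_nonneg)
        also note 1
        finally have "(917504 * (27 * \<gamma> * sqrt l)) * (rk j * l) \<le> (917504 * (\<delta> * 2 ^ S)) * (rk j * l)"
          by (simp add: mult_ac)
        then have "917504 * (27 * \<gamma> * sqrt l) \<le> 917504 * (\<delta> * 2 ^ S)"
          using pos by (simp only: mult_le_cancel_right_pos)
        then show ?thesis by simp
      qed
    qed (rule e\<gamma>)
  qed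
  \<comment> \<open>On either side, \<open>e\<close> is lost to the shift and at most \<open>e\<close> to the large coordinates, and
    \<open>2 e + X / 30 \<le> X / 2\<close>.\<close>
  have je: "j + e < m" "e < j"
    using e X_le X_ge D0 rkj by linarith+
  define N where "N y i = real (count_le d m g y (gauss_quantile m i))" for y i
  have "N x j \<le> N (p S x) (j + e) + e"
  proof -
    have "gauss_quantile m j \<le> gauss_quantile m (j + e)" using je j by (simp add: gauss_quantile_le_iff)
    then show ?thesis
      using count_le_shift[of d m g x "gauss_quantile m j" "p S x" "gauss_quantile m (j + e)"] large[of "j + e"] je j
      by (simp add: N_def)
  qed
  moreover have "N (p S x) (j - e) \<le> N x j + e"
  proof -
    have "gauss_quantile m (j - e) \<le> gauss_quantile m j" using je j by (simp add: gauss_quantile_le_iff)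
    then show ?thesis
      using count_le_shift[of d m g "p S x" "gauss_quantile m (j - e)" x "gauss_quantile m j"] large[of "j - e"] je j
      by (simp add: N_def abs_minus_commute less_imp_diff_less)
  qed
  moreover have "\<bar>N (p S x) (j + e) - (real j + e)\<bar> \<le> X / 30" using near[of "j + e"] je j by (simp add: N_def)
  moreover have "\<bar>N (p S x) (j - e) - (real j - e)\<bar> \<le> X / 30"
    using near[of "j - e"] je j by (simp add: N_def of_nat_diff)
  ultimately have "\<bar>N x j - real j\<bar> \<le> X / 2" using e by linarith
  then show ?thesis by (simp add: N_def X_def)
qed

end

section \<open>Rearrangements\<close>

lemma rearrangement_bij:
  obtains \<sigma> where "bij_betw \<sigma> {1..m} {1..m}" "\<And>i. i \<in> {1..m} \<Longrightarrow> rearrangement m v i = v (\<sigma> i)"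
proof -
  define xs where "xs = map v [1..<Suc m]"
  have len: "length xs = m" by (simp add: xs_def)
  have "mset (sort xs) = mset xs" by simp
  then obtain \<pi> where \<pi>: "\<pi> permutes {..<length xs}" "permute_list \<pi> xs = sort xs"
    by (rule mset_eq_permutation)
  define \<sigma> where "\<sigma> i = Suc (\<pi> (i - 1))" for i
  have "bij_betw (\<lambda>i. i - 1) {1..m} {..<m}"
    by (rule bij_betwI[where g=Suc]) auto
  from bij_betw_trans[OF this, of \<pi> "{..<m}"] have "bij_betw (\<pi> \<circ> (\<lambda>i. i - 1)) {1..m} {..<m}" using \<pi>(1) len by (simp add: permutes_imp_bij)
  moreover have "bij_betw Suc {..<m} {1..m}"
    by (rule bij_betwI[where g="\<lambda>i. i - 1"]) auto
  ultimately have "bij_betw (Suc \<circ> (\<pi> \<circ> (\<lambda>i. i - 1))) {1..m} {1..m}"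
    by (rule bij_betw_trans)
  then have "bij_betw \<sigma> {1..m} {1..m}" by (simp add: \<sigma>_def[abs_def] comp_def)
  moreover have "rearrangement m v i = v (\<sigma> i)" if "i \<in> {1..m}" for i
  proof -
    have i: "i - 1 < m" using that by auto
    then have pi: "\<pi> (i - 1) < m" using permutes_in_image[OF \<pi>(1), of "i - 1"] len by simp
    have "rearrangement m v i = permute_list \<pi> xs ! (i - 1)"
      by (simp only: rearrangement_def \<pi>(2) xs_def[symmetric])
    also have "\<dots> = xs ! \<pi> (i - 1)" using \<pi>(1) i len by (simp add: permute_list_nth)
    also have "\<dots> = v (\<sigma> i)" using pi by (simp add: xs_def \<sigma>_def plus_1_eq_Suc del: upt_Suc)
    finally show ?thesis .
  qed
  ultimately show ?thesis by (rule that)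
qed

lemma rearrangement_mono:
  assumes "1 \<le> i" "i \<le> j" "j \<le> m" shows "rearrangement m v i \<le> rearrangement m v j"
  unfolding rearrangement_def using assms by (intro sorted_nth_mono) auto

lemma rearrangement_le_iff:
  assumes i: "i \<in> {1..m}"
  shows "rearrangement m v i \<le> t \<longleftrightarrow> i \<le> card {k \<in> {1..m}. v k \<le> t}"
proof -
  obtain \<sigma> where \<sigma>: "bij_betw \<sigma> {1..m} {1..m}" "\<And>i. i \<in> {1..m} \<Longrightarrow> rearrangement m v i = v (\<sigma> i)"
    using rearrangement_bij[of m v] by blast
  have "bij_betw \<sigma> {k \<in> {1..m}. rearrangement m v k \<le> t} {k \<in> {1..m}. v k \<le> t}"
    unfolding bij_betw_def
  proof
      show "inj_on \<sigma> {k \<in> {1..m}. rearrangement m v k \<le> t}"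
      using \<sigma>(1) by (rule inj_on_subset[OF bij_betw_imp_inj_on]) auto
    have im: "\<sigma> ` {1..m} = {1..m}" using \<sigma>(1) by (simp add: bij_betw_def)
    show "\<sigma> ` {k \<in> {1..m}. rearrangement m v k \<le> t} = {k \<in> {1..m}. v k \<le> t}" (is "?L = ?R")
    proof
      show "?L \<subseteq> ?R" using im \<sigma>(2) by fastforce
      show "?R \<subseteq> ?L"
      proof
        fix k assume k: "k \<in> ?R"
        then have "k \<in> \<sigma> ` {1..m}" using im by simp
        then obtain j where "j \<in> {1..m}" "k = \<sigma> j" by blast
        then show "k \<in> ?L" using k \<sigma>(2) by auto
      qed
    qed
  qed
  then have card: "card {k \<in> {1..m}. v k \<le> t} = card {k \<in> {1..m}. rearrangement m v k \<le> t}"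
    by (simp add: bij_betw_same_card)
  show ?thesis
  proof
    assume "rearrangement m v i \<le> t"
    then have "{1..i} \<subseteq> {k \<in> {1..m}. rearrangement m v k \<le> t}"
      using i rearrangement_mono[of _ i m v] by fastforce
    then have "card {1..i} \<le> card {k \<in> {1..m}. rearrangement m v k \<le> t}" by (intro card_mono) auto
    then show "i \<le> card {k \<in> {1..m}. v k \<le> t}" unfolding card by simp
  next
    assume le: "i \<le> card {k \<in> {1..m}. v k \<le> t}"
    show "rearrangement m v i \<le> t"
    proof (rule ccontr)
      assume "\<not> rearrangement m v i \<le> t"
      then have "{k \<in> {1..m}. rearrangement m v k \<le> t} \<subseteq> {1..<i}"
        using i rearrangement_mono[of i _ m v] by (fastforce simp: not_le)
      then have "card {k \<in> {1..m}. rearrangement m v k \<le> t} \<le> card {1..<i}" by (intro card_mono) auto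
      moreover have "card {1..<i} < i" using i by simp
      ultimately show False using le unfolding card by linarith
    qed
  qed
qed

lemma card_matrix_le:
  "card {k \<in> {1..m}. matrix_of_rows m d g x k \<le> t} = count_le d m g x t"
  unfolding count_le_def matrix_of_rows_def by (rule arg_cong[where f=card]) auto

section \<open>Sums over the ranks\<close>

lemma sum_inverse_le_ln:
  assumes D: "1 \<le> D" "D \<le> real m"
  shows "(\<Sum>n\<in>{n \<in> {1..<m}. 4 * D \<le> real n}. 1 / real n) \<le> ln (real m / D)"
proof -
  define a where "a = nat \<lceil>4 * D\<rceil>"
  have a: "4 * D \<le> real a" using D by (simp add: a_def)
  have set: "{n \<in> {1..<m}. 4 * D \<le> real n} = {a..<m}"
  proof -
    have iff: "4 * D \<le> real n \<longleftrightarrow> a \<le> n" for n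
      unfolding a_def using D by (simp add: nat_le_iff ceiling_le_iff)
    have "1 \<le> a" using a D by linarith
    then show ?thesis unfolding iff by auto
  qed
  show ?thesis
  proof (cases "a \<le> m")
    case True
    define f where "f n = ln (real n - 1)" for n
    have "(\<Sum>n=a..<m. 1 / real n) \<le> (\<Sum>n=a..<m. f (Suc n) - f n)"
    proof (rule sum_mono)
      fix n assume "n \<in> {a..<m}"
      then have n: "2 \<le> real n" using a D by simp
      have "ln ((real n - 1) / real n) \<le> (real n - 1) / real n - 1"
        using n by (intro ln_le_minus_one) simp
      moreover have "ln ((real n - 1) / real n) = ln (real n - 1) - ln (real n)"
        using n by (simp add: ln_div)
      moreover have "(real n - 1) / real n - 1 = - (1 / real n)" using n by (simp add: field_simps)
      ultimately show "1 / real n \<le> f (Suc n) - f n" by (simp add: f_def)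
    qed
    also have "\<dots> = f m - f a" using True by (rule sum_Suc_diff')
    also have "\<dots> \<le> ln m - ln D"
    proof (rule diff_mono)
      have "2 \<le> real m" using True a D by linarith
      then show "f m \<le> ln m" by (simp add: f_def)
      show "ln D \<le> f a" using a D by (simp add: f_def)
    qed
    also have "\<dots> = ln (m / D)" using D by (simp add: ln_div)
    finally show ?thesis unfolding set .
  next
    case False
    then show ?thesis unfolding set using D by simp
  qed
qed

lemma sum_inverse_sqrt_le: "(\<Sum>n=1..K. 1 / sqrt (real n)) \<le> 2 * sqrt (real K)"
proof (induction K)
  case (Suc K)
  have "1 / sqrt (real (Suc K)) \<le> 2 * sqrt (real (Suc K)) - 2 * sqrt (real K)"
  proof -
    have "(sqrt (real (Suc K)) - sqrt (real K))\<^sup>2 \<ge> 0" by simp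
    then have "2 * sqrt (real K) * sqrt (real (Suc K)) \<le> 2 * real K + 1"
      by (simp add: power2_diff mult_ac)
    then have "1 \<le> (2 * sqrt (real (Suc K)) - 2 * sqrt (real K)) * sqrt (real (Suc K))"
      by (simp add: left_diff_distrib mult.assoc)
    then show ?thesis by (simp add: divide_le_eq)
  qed
  then show ?case using Suc.IH by simp
qed simp

lemma sum_ln_le:
  assumes D: "1 \<le> D" "D \<le> real m"
  shows "(\<Sum>n\<in>{n \<in> {1..<m}. real n < 4 * D}. ln (real m / real n)) \<le> 4 * D * ln (real m / D) + 8 * D"
proof -
  define K where "K = nat \<lfloor>4 * D\<rfloor>"
  have K: "real K \<le> 4 * D" using D by (simp add: K_def)
  have L: "0 \<le> ln (m / D)" using D by simp
  have "(\<Sum>n\<in>{n \<in> {1..<m}. real n < 4 * D}. ln (real m / real n))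
      \<le> (\<Sum>n\<in>{n \<in> {1..<m}. real n < 4 * D}. ln (m / D) + 2 * sqrt D * (1 / sqrt n))"
  proof (rule sum_mono)
    fix n assume "n \<in> {n \<in> {1..<m}. real n < 4 * D}"
    then have n: "0 < real n" by auto
    have "ln (sqrt (D / n)) \<le> sqrt (D / n) - 1" using n D by (intro ln_le_minus_one) simp
    then have "ln (D / n) \<le> 2 * sqrt (D / n)" using n D by (simp add: ln_sqrt)
    moreover have "ln (m / n) = ln (m / D) + ln (D / n)" using n D by (simp add: ln_div)
    ultimately show "ln (real m / real n) \<le> ln (m / D) + 2 * sqrt D * (1 / sqrt n)"
      using n by (simp add: real_sqrt_divide)
  qed
  also have "\<dots> \<le> (\<Sum>n=1..K. ln (m / D) + 2 * sqrt D * (1 / sqrt n))"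
  proof (rule sum_mono2)
    show "{n \<in> {1..<m}. real n < 4 * D} \<subseteq> {1..K}" by (auto simp: K_def le_nat_iff le_floor_iff)
  qed (use L D in auto)
  also have "\<dots> = K * ln (m / D) + 2 * sqrt D * (\<Sum>n=1..K. 1 / sqrt n)"
    by (simp only: sum.distrib sum_distrib_left sum_constant card_atLeastAtMost) simp
  also have "\<dots> \<le> 4 * D * ln (m / D) + 2 * sqrt D * (2 * sqrt (4 * D))"
  proof (intro add_mono mult_right_mono mult_left_mono K L)
    have "sqrt K \<le> sqrt (4 * D)" using K by (intro real_sqrt_le_mono)
    then show "(\<Sum>n=1..K. 1 / sqrt n) \<le> 2 * sqrt (4 * D)" using sum_inverse_sqrt_le[of K] by linarith
  qed (use D in auto)
  also have "2 * sqrt D * (2 * sqrt (4 * D)) = 8 * D" using D by (simp add: real_sqrt_mult)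
  finally show ?thesis .
qed

text \<open>Every value of the tail rank is attained at most twice.\<close>

lemma sum_tail_rank_le:
  fixes f :: "nat \<Rightarrow> real"
  assumes f: "\<And>n. 0 < n \<Longrightarrow> n < m \<Longrightarrow> 0 \<le> f n"
  shows "(\<Sum>i\<in>{i \<in> {1..<m}. P (tail_rank m i)}. f (tail_rank m i))
    \<le> 2 * (\<Sum>n\<in>{n \<in> {1..<m}. P n}. f n)"
proof -
  define S where "S = {i \<in> {1..<m}. P (tail_rank m i)}"
  have "(\<Sum>i\<in>S. f (tail_rank m i))
      = (\<Sum>i\<in>{i \<in> S. i \<le> m - i}. f (tail_rank m i)) + (\<Sum>i\<in>{i \<in> S. \<not> i \<le> m - i}. f (tail_rank m i))"
    by (subst sum.union_disjoint[symmetric]) (auto simp: S_def intro: sum.cong)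
  also have "(\<Sum>i\<in>{i \<in> S. i \<le> m - i}. f (tail_rank m i)) = (\<Sum>i\<in>{i \<in> S. i \<le> m - i}. f i)"
    by (rule sum.cong) (auto simp: tail_rank_def)
  also have "\<dots> \<le> (\<Sum>n\<in>{n \<in> {1..<m}. P n}. f n)"
    by (rule sum_mono2) (auto simp: S_def tail_rank_def intro!: f)
  also have "(\<Sum>i\<in>{i \<in> S. \<not> i \<le> m - i}. f (tail_rank m i))
      = (\<Sum>n\<in>(\<lambda>i. m - i) ` {i \<in> S. \<not> i \<le> m - i}. f n)"
    by (subst sum.reindex) (auto simp: inj_on_def S_def tail_rank_def intro!: sum.cong)
  also have "\<dots> \<le> (\<Sum>n\<in>{n \<in> {1..<m}. P n}. f n)"
    by (rule sum_mono2) (auto simp: S_def tail_rank_def min_def intro!: f)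
  finally show ?thesis by (simp add: S_def)
qed

context good_rows
begin

text \<open>The estimate for the counts is applied at the ranks \<open>i + b\<close> and \<open>i - b\<close> with \<open>b\<close> the permitted
  error \<open>dev i\<close> rounded up. The tail ranks in between stay comparable to \<open>rk i\<close> because
  \<open>4 D \<le> rk i\<close> implies \<open>dev i \<le> rk i / 2\<close>.\<close>

lemma rearrangement_near_quantile:
  assumes x: "x \<in> A" and i: "0 < i" "i < m" and rk: "4 * D \<le> rk i"
  shows "(rearrangement m (matrix_of_rows m d g x) i - gauss_quantile m i)\<^sup>2 \<le> 256 * (D / rk i)"
proof -
  define X where "X = dev i"
  define b where "b = nat \<lceil>X\<rceil>"
  define Y where "Y = rearrangement m (matrix_of_rows m d g x) i"
  have D0: "0 < D" using D_large by linarith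
  have X2: "X\<^sup>2 = D * rk i" using D0 by (simp add: X_def dev_def rk_nonneg)
  have X_ge: "D \<le> X"
  proof (rule power2_le_imp_le)
    show "D\<^sup>2 \<le> X\<^sup>2" unfolding X2 unfolding power2_eq_square using rk D0 by (intro mult_left_mono) auto
  qed (simp add: X_def dev_nonneg)
  have X_le: "X \<le> rk i / 2"
  proof (rule power2_le_imp_le)
    have "D * rk i \<le> rk i / 4 * rk i" using rk by (intro mult_right_mono rk_nonneg) auto
    then show "X\<^sup>2 \<le> (rk i / 2)\<^sup>2" unfolding X2 by (simp add: power2_eq_square)
  qed (simp add: rk_nonneg)
  have b: "X \<le> b" "real b \<le> 2 * X" "8 * real b \<le> 5 * rk i"
  proof -
    have c: "real b = of_int \<lceil>X\<rceil>" using X_ge D0 by (simp add: b_def)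
    show "X \<le> b" by (simp add: c)
    have "real b \<le> X + 1" unfolding c by linarith
    then show "real b \<le> 2 * X" "8 * real b \<le> 5 * rk i" using X_ge X_le D_large rk by linarith+
  qed
  have rki: "rk i \<le> i" "rk i \<le> real m - i" using i by (auto simp: rk_def tail_rank_def of_nat_diff)
  have ib: "i + b < m" "b < i" using b rki rk D0 by linarith+
  have half: "dev j / 2 < b" and rkj: "D \<le> rk j" "3 * rk i \<le> 8 * rk j"
    if "i = j + b \<or> j = i + b" "0 < j" "j < m" for j
  proof -
    have "rk j \<le> rk i + b" "rk i \<le> rk j + b"
      using that i unfolding rk_def tail_rank_def by (auto simp: of_nat_diff of_nat_min min_def)
    then show "D \<le> rk j" "3 * rk i \<le> 8 * rk j" using b rk D0 by linarith+
    have "8 * rk j \<le> 13 * rk i" using \<open>rk j \<le> rk i + b\<close> b by linarith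
    have "dev j \<le> 1.5 * X"
    proof (rule power2_le_imp_le)
      have "D * rk j \<le> D * (2.25 * rk i)" using \<open>8 * rk j \<le> 13 * rk i\<close> D0 rk_nonneg[of i]
        by (intro mult_left_mono) auto
      then show "(dev j)\<^sup>2 \<le> (1.5 * X)\<^sup>2" unfolding power_mult_distrib X2 using D0 rk_nonneg[of j]
        by (simp add: dev_def power2_eq_square)
    qed (use dev_nonneg X_def in auto)
    then show "dev j / 2 < b" using b X_ge D0 by linarith
  qed
  have im: "i \<in> {1..m}" using i by auto
  have up: "Y \<le> gauss_quantile m (i + b)"
  proof -
    have "\<bar>real (count_le d m g x (gauss_quantile m (i + b))) - real (i + b)\<bar> \<le> dev (i + b) / 2"
      using ib i rkj(1)[of "i + b"] by (intro count_le_quantile x) auto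
    moreover have "dev (i + b) / 2 < b" using ib i by (intro half) auto
    ultimately have "i \<le> count_le d m g x (gauss_quantile m (i + b))" by linarith
    then show ?thesis unfolding Y_def rearrangement_le_iff[OF im] card_matrix_le .
  qed
  have lo: "gauss_quantile m (i - b) \<le> Y"
  proof -
    have "\<bar>real (count_le d m g x (gauss_quantile m (i - b))) - real (i - b)\<bar> \<le> dev (i - b) / 2"
      using ib i rkj(1)[of "i - b"] by (intro count_le_quantile x) auto
    moreover have "dev (i - b) / 2 < b" using ib i by (intro half) auto
    moreover have "real (i - b) = real i - b" using ib by (simp add: of_nat_diff)
    ultimately have "count_le d m g x (gauss_quantile m (i - b)) < i" by linarith
    then have "\<not> Y \<le> gauss_quantile m (i - b)"
      unfolding Y_def rearrangement_le_iff[OF im] card_matrix_le by simp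
    then show ?thesis by simp
  qed
  have gap: "3 / 8 * rk i * (gauss_quantile m j' - gauss_quantile m j) \<le> 3 * b"
    if "0 < j" "j' = j + b" "j' < m" "i = j \<or> i = j'" for j j'
  proof -
    have "3 / 8 * rk i \<le> real (min (tail_rank m j) (tail_rank m j'))"
      using that rkj(2)[of j] rkj(2)[of j'] rk_nonneg[of i] by (auto simp: rk_def min_def)
    moreover have "0 \<le> gauss_quantile m j' - gauss_quantile m j" using that by (simp add: gauss_quantile_le_iff)
    ultimately have "3 / 8 * rk i * (gauss_quantile m j' - gauss_quantile m j)
        \<le> real (min (tail_rank m j) (tail_rank m j')) * (gauss_quantile m j' - gauss_quantile m j)"
      by (rule mult_right_mono)
    also have "\<dots> \<le> 3 * real (j' - j)" using that by (intro gauss_quantile_diff_le) auto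
    finally show ?thesis using that by simp
  qed
  have rk0: "0 < rk i" using rk D0 by linarith
  have "gauss_quantile m (i + b) - gauss_quantile m i \<le> 8 * b / rk i"
    using gap[of i "i + b"] ib i rk0 by (simp add: field_simps)
  moreover have "gauss_quantile m i - gauss_quantile m (i - b) \<le> 8 * b / rk i"
    using gap[of "i - b" i] ib i rk0 by (simp add: field_simps)
  ultimately have "\<bar>Y - gauss_quantile m i\<bar> \<le> 8 * b / rk i" using up lo by linarith
  also have "\<dots> \<le> 16 * X / rk i" using b rk0 by (intro divide_right_mono) auto
  finally have "\<bar>Y - gauss_quantile m i\<bar>\<^sup>2 \<le> (16 * X / rk i)\<^sup>2" by (rule power_mono) simp
  also have "\<dots> = 256 * (D / rk i)" unfolding power_divide power_mult_distrib X2
    using rk0 by (simp add: power2_eq_square)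
  finally show ?thesis by (simp add: Y_def)
qed

text \<open>Ranks with \<open>4 D \<le> rk i\<close> contribute \<open>D \<Sum> 1 / rk i\<close>. The set \<open>E\<close> of the other ranks has at most
  \<open>10 D\<close> elements, and there the ordered coordinates and the quantiles are estimated separately.\<close>

lemma rearrangement_distance:
  assumes x: "x \<in> A"
  shows "(\<Sum>i=1..m. (rearrangement m (matrix_of_rows m d g x) i - gauss_quantile m i)\<^sup>2)
    \<le> 40000 * (D * ln (m / D))"
proof -
  define Y where "Y = rearrangement m (matrix_of_rows m d g x)"
  define L where "L = ln (m / D)"
  define E where "E = {i \<in> {1..m}. rk i < 4 * D}"
  have D0: "1 \<le> D" "0 < D" using D_large by linarith+
  have Dm: "D \<le> m" using D_le D0 by linarith
  have L: "2 / 3 \<le> L"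
  proof -
    have "ln 2 \<le> ln (m / D)" using D_le D0 by (intro ln_mono) (auto simp: field_simps)
    then show ?thesis using ln2_ge_two_thirds by (simp add: L_def)
  qed
  have m2: "2 \<le> m" using D_le D0 by linarith
  have split: "(\<Sum>i=1..m. f i) = (\<Sum>i\<in>{i \<in> {1..<m}. 4 * D \<le> rk i}. f i) + (\<Sum>i\<in>E. f i)" for f :: "nat \<Rightarrow> real"
  proof -
    have "{1..m} = {i \<in> {1..<m}. 4 * D \<le> rk i} \<union> E"
      using D0 m_pos by (auto simp: E_def rk_def tail_rank_def)
    then have "(\<Sum>i=1..m. f i) = sum f ({i \<in> {1..<m}. 4 * D \<le> rk i} \<union> E)" by (simp only:)
    also have "\<dots> = (\<Sum>i\<in>{i \<in> {1..<m}. 4 * D \<le> rk i}. f i) + (\<Sum>i\<in>E. f i)"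
      by (rule sum.union_disjoint) (auto simp: E_def)
    finally show ?thesis .
  qed
  have middle: "(\<Sum>i\<in>{i \<in> {1..<m}. 4 * D \<le> rk i}. (Y i - gauss_quantile m i)\<^sup>2) \<le> 512 * (D * L)"
  proof -
    have "(\<Sum>i\<in>{i \<in> {1..<m}. 4 * D \<le> rk i}. (Y i - gauss_quantile m i)\<^sup>2)
        \<le> (\<Sum>i\<in>{i \<in> {1..<m}. 4 * D \<le> rk i}. 256 * (D / rk i))"
      unfolding Y_def by (intro sum_mono rearrangement_near_quantile x) auto
    also have "\<dots> = 256 * D * (\<Sum>i\<in>{i \<in> {1..<m}. 4 * D \<le> real (tail_rank m i)}. 1 / real (tail_rank m i))"
      by (simp add: sum_distrib_left rk_def)
    also have "\<dots> \<le> 256 * D * (2 * (\<Sum>n\<in>{n \<in> {1..<m}. 4 * D \<le> real n}. 1 / real n))"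
      using D0 by (intro mult_left_mono sum_tail_rank_le) auto
    also have "\<dots> \<le> 256 * D * (2 * L)"
      unfolding L_def using D0 Dm by (intro mult_left_mono sum_inverse_le_ln) auto
    finally show ?thesis by simp
  qed
  have E: "finite E" "E \<subseteq> {1..m}" by (auto simp: E_def)
  have cardE: "real (card E) \<le> 10 * D"
  proof -
    define K where "K = nat \<lfloor>4 * D\<rfloor>"
    have K: "real K \<le> 4 * D" using D0 by (simp add: K_def)
    have "E \<subseteq> {1..K} \<union> {m - K..m}"
    proof
      fix i assume i: "i \<in> E"
      then have "real (tail_rank m i) < 4 * D" by (simp add: E_def rk_def)
      then have "tail_rank m i \<le> K" by (simp add: K_def le_nat_iff le_floor_iff)
      then show "i \<in> {1..K} \<union> {m - K..m}" using i by (auto simp: E_def tail_rank_def min_def split: if_splits)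
    qed
    then have "card E \<le> card ({1..K} \<union> {m - K..m})" by (intro card_mono) auto
    also have "\<dots> \<le> card {1..K} + card {m - K..m}" by (rule card_Un_le)
    also have "\<dots> \<le> 2 * K + 1" by simp
    finally show ?thesis using K D_large by linarith
  qed
  have Ysum: "(\<Sum>i\<in>E. (Y i)\<^sup>2) \<le> 2890 * D * (1 + L)"
  proof -
    obtain \<sigma> where \<sigma>: "bij_betw \<sigma> {1..m} {1..m}" "\<And>i. i \<in> {1..m} \<Longrightarrow> Y i = matrix_of_rows m d g x (\<sigma> i)"
      unfolding Y_def using rearrangement_bij[of m "matrix_of_rows m d g x"] by blast
    have inj: "inj_on \<sigma> E" using E(2) by (rule inj_on_subset[OF bij_betw_imp_inj_on[OF \<sigma>(1)]])
    have im: "\<sigma> ` E \<subseteq> {1..m}" using \<sigma>(1) E by (auto simp: bij_betw_def)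
    define k where "k = min m (nat \<lfloor>10 * D\<rfloor>)"
    have n10: "10 * D - 1 < real (nat \<lfloor>10 * D\<rfloor>)" "real (nat \<lfloor>10 * D\<rfloor>) \<le> 10 * D" using D0 by linarith+
    have k: "D \<le> real k" "k \<le> m" "real k \<le> 10 * D"
    proof -
      consider "k = m" "m \<le> nat \<lfloor>10 * D\<rfloor>" | "k = nat \<lfloor>10 * D\<rfloor>" "k \<le> m"
        unfolding k_def by linarith
      then show "D \<le> real k" "k \<le> m" "real k \<le> 10 * D"
        using n10 D0 Dm by (cases; linarith)+
    qed
    have cE: "card (\<sigma> ` E) \<le> k"
    proof -
      have "card E \<le> m" using card_mono[OF _ E(2)] by simp
      moreover have "card E \<le> nat \<lfloor>10 * D\<rfloor>" using cardE by (simp add: le_nat_iff le_floor_iff)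
      ultimately show ?thesis using inj by (simp add: k_def card_image)
    qed
    have "(\<Sum>i\<in>E. (Y i)\<^sup>2) = (\<Sum>i\<in>E. (euclid_inner d (g (\<sigma> i)) x)\<^sup>2)"
    proof (intro sum.cong refl)
      fix i assume "i \<in> E"
      then have "i \<in> {1..m}" "\<sigma> i \<in> {1..m}" using E im by auto
      then show "(Y i)\<^sup>2 = (euclid_inner d (g (\<sigma> i)) x)\<^sup>2"
        using \<sigma>(2)[of i] by (simp add: matrix_of_rows_def)
    qed
    also have "\<dots> = (\<Sum>i\<in>\<sigma> ` E. (euclid_inner d (g i) x)\<^sup>2)" by (simp add: sum.reindex[OF inj])
    also have "\<dots> \<le> 289 * (k * ln (exp 1 * m / k))" by (rule sum_squares_le[OF x im cE k(1,2)])
    also have "\<dots> \<le> 289 * (10 * D * (1 + L))"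
    proof (intro mult_left_mono mult_mono)
      have "ln (exp 1 * m / k) \<le> ln (exp 1 * m / D)"
        using k D0 m_pos by (intro ln_mono) (auto intro!: divide_left_mono)
      also have "\<dots> = 1 + L" using D0 m_pos by (simp add: L_def ln_mult ln_div)
      finally show "ln (exp 1 * m / k) \<le> 1 + L" .
      have "1 \<le> real m / real k" using k D0 by simp
      then have "0 \<le> ln (real m / real k)" by (rule ln_ge_zero)
      moreover have "ln (exp 1 * m / k) = 1 + ln (real m / real k)"
        using k D0 m_pos by (simp add: ln_mult ln_div)
      ultimately show "0 \<le> ln (exp 1 * m / k)" by linarith
    qed (use k D0 in auto)
    finally show ?thesis by simp
  qed
  have qsum: "(\<Sum>i\<in>E. (gauss_quantile m i)\<^sup>2) \<le> 16 * (D * L) + 33 * D"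
  proof -
    have Em: "E = insert m {i \<in> {1..<m}. real (tail_rank m i) < 4 * D}"
      using D0 m_pos by (auto simp: E_def rk_def tail_rank_def)
    have "(\<Sum>i\<in>{i \<in> {1..<m}. real (tail_rank m i) < 4 * D}. (gauss_quantile m i)\<^sup>2)
        \<le> (\<Sum>i\<in>{i \<in> {1..<m}. real (tail_rank m i) < 4 * D}. 2 * ln (m / tail_rank m i))"
      by (intro sum_mono gauss_quantile_square_le) auto
    also have "\<dots> \<le> 2 * (\<Sum>n\<in>{n \<in> {1..<m}. real n < 4 * D}. 2 * ln (m / n))"
      by (rule sum_tail_rank_le) simp
    also have "\<dots> = 4 * (\<Sum>n\<in>{n \<in> {1..<m}. real n < 4 * D}. ln (m / n))"
      by (simp add: sum_distrib_left[symmetric])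
    also have "\<dots> \<le> 4 * (4 * D * L + 8 * D)"
      unfolding L_def using D0 Dm by (intro mult_left_mono sum_ln_le) auto
    finally have 1: "(\<Sum>i\<in>{i \<in> {1..<m}. real (tail_rank m i) < 4 * D}. (gauss_quantile m i)\<^sup>2)
        \<le> 16 * (D * L) + 32 * D" by simp
    have "(gauss_quantile m m)\<^sup>2 = (gauss_quantile m (m - 1))\<^sup>2" using m2 by (simp add: gauss_quantile_def)
    also have "\<dots> \<le> 2 * ln (m / tail_rank m (m - 1))" using m2 by (intro gauss_quantile_square_le) auto
    also have "tail_rank m (m - 1) = 1" using m2 by (auto simp: tail_rank_def)
    finally have "(gauss_quantile m m)\<^sup>2 \<le> 2 * ln m" by simp
    moreover have "0 \<le> ln (real m)" using m_pos by simp
    ultimately have "(gauss_quantile m m)\<^sup>2 \<le> D" using ln_m_le by linarith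
    then show ?thesis using 1 unfolding Em by simp
  qed
  have "(\<Sum>i\<in>E. (Y i - gauss_quantile m i)\<^sup>2) \<le> (\<Sum>i\<in>E. 2 * (Y i)\<^sup>2 + 2 * (gauss_quantile m i)\<^sup>2)"
  proof (rule sum_mono)
    fix i
    have "0 \<le> (Y i + gauss_quantile m i)\<^sup>2" by simp
    then show "(Y i - gauss_quantile m i)\<^sup>2 \<le> 2 * (Y i)\<^sup>2 + 2 * (gauss_quantile m i)\<^sup>2"
      by (simp add: power2_eq_square algebra_simps)
  qed
  also have "\<dots> = 2 * (\<Sum>i\<in>E. (Y i)\<^sup>2) + 2 * (\<Sum>i\<in>E. (gauss_quantile m i)\<^sup>2)"
    by (simp add: sum.distrib sum_distrib_left)
  also have "\<dots> \<le> 2 * (2890 * D * (1 + L)) + 2 * (16 * (D * L) + 33 * D)"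
    by (intro add_mono mult_left_mono Ysum qsum) auto
  also have "\<dots> = 5812 * (D * L) + 5846 * D" by (simp add: algebra_simps)
  finally have "(\<Sum>i=1..m. (Y i - gauss_quantile m i)\<^sup>2) \<le> 6324 * (D * L) + 5846 * D"
    unfolding split using middle by linarith
  moreover have "D * (2 / 3) \<le> D * L" using L D0 by (intro mult_left_mono) auto
  ultimately have "(\<Sum>i=1..m. (Y i - gauss_quantile m i)\<^sup>2) \<le> 40000 * (D * L)" using D0 by linarith
  then show ?thesis by (simp add: Y_def L_def)
qed

end

section \<open>The exceptional events\<close>

context gaussian_rows
begin

lemma measurable_inner_row:
  "i \<in> {1..m} \<Longrightarrow> (\<lambda>\<omega>. euclid_inner d (G i \<omega>) x) \<in> borel_measurable M"
  by (rule measurable_compose[OF measurable_row measurable_euclid_inner])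

lemma measurable_count_le [measurable]:
  "(\<lambda>\<omega>. real (count_le d m (\<lambda>i. G i \<omega>) x t)) \<in> borel_measurable M"
  unfolding count_le_eq_sum
  by (intro borel_measurable_sum measurable_compose[OF measurable_inner_row]) simp_all

lemma measurable_excess [measurable]: "(\<lambda>\<omega>. excess d m (\<lambda>i. G i \<omega>) z \<tau>) \<in> borel_measurable M"
  unfolding excess_def
  by (intro borel_measurable_sum borel_measurable_max borel_measurable_diff borel_measurable_power
      borel_measurable_const measurable_inner_row)

lemma measurable_rearrangement [measurable]:
  assumes i: "i \<in> {1..m}"
  shows "(\<lambda>\<omega>. rearrangement m (matrix_of_rows m d (\<lambda>k. G k \<omega>) x) i) \<in> borel_measurable M"
proof (rule borel_measurable_iff_le[THEN iffD2], rule allI)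
  fix t
  have "{\<omega> \<in> space M. rearrangement m (matrix_of_rows m d (\<lambda>k. G k \<omega>) x) i \<le> t}
      = {\<omega> \<in> space M. real i \<le> real (count_le d m (\<lambda>k. G k \<omega>) x t)}"
    unfolding rearrangement_le_iff[OF i] card_matrix_le by simp
  also have "\<dots> \<in> sets M" by measurable
  finally show "{\<omega> \<in> space M. rearrangement m (matrix_of_rows m d (\<lambda>k. G k \<omega>) x) i \<le> t} \<in> sets M" .
qed

lemma measure_UN_le_card:
  fixes c :: real
  assumes "finite I" "\<And>i. i \<in> I \<Longrightarrow> F i \<in> sets M" "\<And>i. i \<in> I \<Longrightarrow> measure M (F i) \<le> c"
  shows "measure M (\<Union>i\<in>I. F i) \<le> real (card I) * c"
proof -
  have "measure M (\<Union>i\<in>I. F i) \<le> (\<Sum>i\<in>I. measure M (F i))"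
    by (rule measure_UNION_le) (use assms in auto)
  also have "\<dots> \<le> (\<Sum>i\<in>I. c)" by (intro sum_mono assms)
  finally show ?thesis by simp
qed

end

locale gaussian_net = gaussian_rows M d m G + net d m A T p \<gamma> D
  for M :: "'a measure" and d m G A T p \<gamma> D
begin

definition bad_start :: "(nat \<Rightarrow> real) \<Rightarrow> 'a set" where
  "bad_start a =
    (\<Union>j\<in>{1..<m}. {\<omega> \<in> space M.
        2 * sqrt (m * Fg_tail (gauss_quantile m j) * (8 * 2 ^ s0)) + 2 * (8 * 2 ^ s0)
        < \<bar>real (count_le d m (\<lambda>i. G i \<omega>) a (gauss_quantile m j)) - m * Fg (gauss_quantile m j)\<bar>})
    \<union> (\<Union>k\<in>{1..m}. {\<omega> \<in> space M. (L2_set a {1..d})\<^sup>2 * (6 * real k + 4 * (8 * 2 ^ s0))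
        < excess d m (\<lambda>i. G i \<omega>) a (4 * ln (real m / real k))})"

definition bad_step :: "nat \<Rightarrow> (nat \<Rightarrow> real) \<Rightarrow> (nat \<Rightarrow> real) \<Rightarrow> 'a set" where
  "bad_step s a b =
    (\<Union>j\<in>{1..<m}. {\<omega> \<in> space M.
        2 * sqrt (m * flip_prob d a b (gauss_quantile m j) * (8 * 2 ^ s)) + 2 * (8 * 2 ^ s)
        < \<bar>real (count_le d m (\<lambda>i. G i \<omega>) a (gauss_quantile m j))
          - real (count_le d m (\<lambda>i. G i \<omega>) b (gauss_quantile m j))\<bar>})
    \<union> (\<Union>k\<in>{1..m}. {\<omega> \<in> space M.
        (L2_set (\<lambda>j. a j - b j) {1..d})\<^sup>2 * (6 * real k + 4 * (8 * 2 ^ s))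
        < excess d m (\<lambda>i. G i \<omega>) (\<lambda>j. a j - b j) (4 * ln (real m / real k))})"

lemma sets_bad_start: "bad_start a \<in> sets M"
  unfolding bad_start_def by (intro sets.Un sets.finite_UN) measurable

lemma sets_bad_step: "bad_step s a b \<in> sets M"
  unfolding bad_step_def by (intro sets.Un sets.finite_UN) measurable

lemma union_bound_thresholds:
  fixes c :: real
  assumes "\<And>j. j \<in> {1..<m} \<Longrightarrow> E j \<in> sets M" "\<And>k. k \<in> {1..m} \<Longrightarrow> F k \<in> sets M"
    and "\<And>j. j \<in> {1..<m} \<Longrightarrow> measure M (E j) \<le> 2 * c"
    and "\<And>k. k \<in> {1..m} \<Longrightarrow> measure M (F k) \<le> c"
  shows "measure M ((\<Union>j\<in>{1..<m}. E j) \<union> (\<Union>k\<in>{1..m}. F k)) \<le> 3 * real m * c"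
proof -
  have "1 \<in> {1..m}" using m_pos by simp
  then have c: "0 \<le> c" using assms(4) order_trans[OF measure_nonneg] by blast
  have "measure M ((\<Union>j\<in>{1..<m}. E j) \<union> (\<Union>k\<in>{1..m}. F k))
      \<le> measure M (\<Union>j\<in>{1..<m}. E j) + measure M (\<Union>k\<in>{1..m}. F k)"
    by (intro measure_Un_le sets.finite_UN) (use assms in auto)
  also have "\<dots> \<le> real (card {1..<m}) * (2 * c) + real (card {1..m}) * c"
    by (intro add_mono measure_UN_le_card) (use assms in auto)
  also have "\<dots> \<le> real m * (2 * c) + real m * c"
    using c by (intro add_mono mult_right_mono) auto
  finally show ?thesis by (simp add: algebra_simps)
qed

lemma prob_bad_start:
  assumes a: "a \<in> A"
  shows "measure M (bad_start a) \<le> 3 * real m * exp (- (8 * 2 ^ s0))"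
  unfolding bad_start_def
proof (rule union_bound_thresholds)
  fix j assume "j \<in> {1..<m}"
  show "measure M {\<omega> \<in> space M.
      2 * sqrt (m * Fg_tail (gauss_quantile m j) * (8 * 2 ^ s0)) + 2 * (8 * 2 ^ s0)
      < \<bar>real (count_le d m (\<lambda>i. G i \<omega>) a (gauss_quantile m j)) - m * Fg (gauss_quantile m j)\<bar>}
      \<le> 2 * exp (- (8 * 2 ^ s0))"
    by (rule count_le_deviation[OF unit[OF a]]) simp
next
  fix k assume "k \<in> {1..m}"
  then show "measure M {\<omega> \<in> space M. (L2_set a {1..d})\<^sup>2 * (6 * real k + 4 * (8 * 2 ^ s0))
      < excess d m (\<lambda>i. G i \<omega>) a (4 * ln (real m / real k))} \<le> exp (- (8 * 2 ^ s0))"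
    using m_pos by (intro excess_deviation) auto
qed measurable

lemma prob_bad_step:
  assumes a: "a \<in> A" and b: "b \<in> A"
  shows "measure M (bad_step s a b) \<le> 3 * real m * exp (- (8 * 2 ^ s))"
  unfolding bad_step_def
proof (rule union_bound_thresholds)
  fix j assume "j \<in> {1..<m}"
  show "measure M {\<omega> \<in> space M.
      2 * sqrt (m * flip_prob d a b (gauss_quantile m j) * (8 * 2 ^ s)) + 2 * (8 * 2 ^ s)
      < \<bar>real (count_le d m (\<lambda>i. G i \<omega>) a (gauss_quantile m j))
          - real (count_le d m (\<lambda>i. G i \<omega>) b (gauss_quantile m j))\<bar>}
      \<le> 2 * exp (- (8 * 2 ^ s))"
    by (rule count_le_increment[OF unit[OF a] unit[OF b]]) simp
next
  fix k assume "k \<in> {1..m}"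
  then show "measure M {\<omega> \<in> space M.
      (L2_set (\<lambda>j. a j - b j) {1..d})\<^sup>2 * (6 * real k + 4 * (8 * 2 ^ s))
      < excess d m (\<lambda>i. G i \<omega>) (\<lambda>j. a j - b j) (4 * ln (real m / real k))} \<le> exp (- (8 * 2 ^ s))"
    using m_pos by (intro excess_deviation) auto
qed measurable

definition bad :: "'a set" where
  "bad = (\<Union>a\<in>T s0. bad_start a) \<union> (\<Union>n. \<Union>a\<in>T (s0 + n). \<Union>b\<in>T (Suc (s0 + n)). bad_step (s0 + n) a b)"

lemma sets_bad: "bad \<in> sets M"
  unfolding bad_def
  by (intro sets.Un sets.finite_UN sets.countable_nat_UN image_subsetI sets_bad_start sets_bad_step T_finite)

lemma card_T_le_exp: "real (card (T s)) \<le> exp (2 ^ s)"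
proof -
  have "real (card (T s)) \<le> 2 ^ 2 ^ s" using T_card[of s] by (metis of_nat_le_iff of_nat_numeral of_nat_power)
  also have "\<dots> \<le> exp 1 ^ 2 ^ s" using exp_ge_add_one_self[of 1] by (intro power_mono) auto
  also have "\<dots> = exp (2 ^ s)" by (simp flip: exp_of_nat_mult)
  finally show ?thesis .
qed

lemma m_le_exp: assumes "s0 \<le> s" shows "real m \<le> exp (2 ^ s)"
proof -
  have "D < 2097152 * 2 ^ s0" using s0(2) by (simp add: field_simps)
  then have "ln m \<le> 2 ^ s" using ln_m_le pos_s0[OF assms] zero_less_power[of "2::real" s0] by linarith
  then have "exp (ln m) \<le> exp (2 ^ s)" by (simp only: exp_le_cancel_iff)
  then show ?thesis using m_pos by simp
qed

text \<open>There are at most \<open>exp (3 \<cdot> 2\<^sup>s)\<close> pairs of points and \<open>m \<le> exp (2\<^sup>s)\<close> thresholds,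
  against events of probability of order \<open>exp (- 8 \<cdot> 2\<^sup>s)\<close>.\<close>

lemma prob_bad_level:
  assumes s: "s0 \<le> s"
  shows "measure M (\<Union>a\<in>T s. \<Union>b\<in>T (Suc s). bad_step s a b) \<le> 3 * exp (- 4 * 2 ^ s)"
proof -
  have "measure M (\<Union>a\<in>T s. \<Union>b\<in>T (Suc s). bad_step s a b)
      \<le> real (card (T s)) * (real (card (T (Suc s))) * (3 * real m * exp (- (8 * 2 ^ s))))"
    using T_subset by (intro measure_UN_le_card sets.finite_UN T_finite sets_bad_step prob_bad_step) auto
  also have "\<dots> \<le> exp (2 ^ s) * (exp (2 ^ Suc s) * (3 * exp (2 ^ s) * exp (- (8 * 2 ^ s))))"
    by (intro mult_mono card_T_le_exp m_le_exp[OF s]) auto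
  also have "\<dots> = 3 * exp (- 4 * 2 ^ s)" by (simp flip: exp_add)
  finally show ?thesis .
qed

lemma prob_bad: "measure M bad \<le> 2 * exp (- (2 ^ s0))"
proof -
  define E where "E n = (\<Union>a\<in>T (s0 + n). \<Union>b\<in>T (Suc (s0 + n)). bad_step (s0 + n) a b)" for n
  have E: "E n \<in> sets M" for n
    unfolding E_def by (intro sets.finite_UN T_finite sets_bad_step)
  have En: "measure M (E n) \<le> 3 * exp (- 4 * 2 ^ s0) * exp (- 4) ^ n" for n
  proof -
    have "(1::real) * n \<le> 2 ^ s0 * (2 ^ n - 1)"
    proof (rule mult_mono)
      have "Suc n \<le> 2 ^ n" using less_exp[of n] by (rule Suc_leI)
      then have "real (Suc n) \<le> real (2 ^ n)" by (simp only: of_nat_le_iff)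
      then show "real n \<le> 2 ^ n - 1" by simp
    qed auto
    then have "2 ^ s0 + n \<le> (2::real) ^ (s0 + n)" by (simp add: power_add algebra_simps)
    then have "exp (- 4 * 2 ^ (s0 + n)) \<le> exp (- 4 * 2 ^ s0 + real n * - 4)" by simp
    also have "\<dots> = exp (- 4 * 2 ^ s0) * exp (- 4) ^ n" by (simp only: exp_add exp_of_nat_mult)
    finally show ?thesis using prob_bad_level[of "s0 + n"] by (simp add: E_def)
  qed
  have e4: "exp (- 4 :: real) \<le> 1 / 2"
  proof -
    have "2 \<le> exp (4::real)" using exp_ge_add_one_self[of 4] by linarith
    then show ?thesis by (simp add: exp_minus field_simps)
  qed
  have geom: "summable (\<lambda>n. 3 * exp (- 4 * 2 ^ s0) * exp (- 4 :: real) ^ n)"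
    using e4 by (intro summable_mult summable_geometric) simp
  have summ: "summable (\<lambda>n. measure M (E n))"
    by (rule summable_comparison_test_ev[OF always_eventually geom]) (use En in simp)
  have "measure M (\<Union>n. E n) \<le> (\<Sum>n. measure M (E n))"
    by (rule finite_measure_subadditive_countably[OF _ summ]) (use E in auto)
  also have "\<dots> \<le> (\<Sum>n. 3 * exp (- 4 * 2 ^ s0) * exp (- 4) ^ n)"
    by (rule suminf_le[OF En summ geom])
  also have "\<dots> = 3 * exp (- 4 * 2 ^ s0) * (1 / (1 - exp (- 4)))"
    using e4 by (subst suminf_mult) (auto simp: suminf_geometric intro!: summable_geometric)
  also have "\<dots> \<le> 3 * exp (- 4 * 2 ^ s0) * 2"
    using e4 by (intro mult_left_mono) (auto simp: field_simps)
  finally have later: "measure M (\<Union>n. E n) \<le> 6 * exp (- 4 * 2 ^ s0)" by simp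
  have "measure M (\<Union>a\<in>T s0. bad_start a) \<le> real (card (T s0)) * (3 * real m * exp (- (8 * 2 ^ s0)))"
    using T_subset by (intro measure_UN_le_card T_finite sets_bad_start prob_bad_start) auto
  also have "\<dots> \<le> exp (2 ^ s0) * (3 * exp (2 ^ s0) * exp (- (8 * 2 ^ s0)))"
    by (intro mult_mono card_T_le_exp m_le_exp) auto
  also have "\<dots> = 3 * exp (- 6 * 2 ^ s0)" by (simp flip: exp_add)
  also have "\<dots> \<le> 3 * exp (- 4 * 2 ^ s0)" by simp
  finally have start: "measure M (\<Union>a\<in>T s0. bad_start a) \<le> 3 * exp (- 4 * 2 ^ s0)" .
  have "measure M bad \<le> measure M (\<Union>a\<in>T s0. bad_start a) + measure M (\<Union>n. E n)"
    unfolding bad_def E_def[symmetric]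
    by (intro measure_Un_le sets.finite_UN T_finite sets_bad_start sets.countable_nat_UN image_subsetI E)
  also have "\<dots> \<le> 9 * exp (- 4 * 2 ^ s0)" using later start by simp
  also have "- 4 * 2 ^ s0 \<le> - 3 + - (2 ^ s0 :: real)" using one_le_power[of "2::real" s0] by linarith
  then have "9 * exp (- 4 * 2 ^ s0) \<le> 9 * exp (- 3 + - (2 ^ s0 :: real))" by simp
  also have "\<dots> = 9 * exp (- 3) * exp (- (2 ^ s0))" by (simp only: exp_add mult.assoc)
  also have "\<dots> \<le> 2 * exp (- (2 ^ s0))"
  proof (intro mult_right_mono)
    have "(2::real) ^ 3 \<le> exp 1 ^ 3" using exp_ge_add_one_self[of 1] by (intro power_mono) auto
    also have "exp 1 ^ 3 = exp (3::real)" by (simp flip: exp_of_nat_mult)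
    finally show "9 * exp (- 3) \<le> (2::real)" by (simp add: exp_minus field_simps)
  qed simp
  finally show ?thesis by simp
qed

lemma not_in_bad_start: "\<omega> \<notin> bad \<Longrightarrow> a \<in> T s0 \<Longrightarrow> \<omega> \<notin> bad_start a"
  by (auto simp: bad_def)

lemma not_in_bad_step:
  assumes "\<omega> \<notin> bad" "s0 \<le> s" "a \<in> T s" "b \<in> T (Suc s)" shows "\<omega> \<notin> bad_step s a b"
proof -
  from assms(2) obtain n where "s = s0 + n" using le_Suc_ex by blast
  with assms show ?thesis by (auto simp: bad_def)
qed

lemma good_rows_outside_bad:
  assumes "\<omega> \<in> space M - bad"
  shows "good_rows d m A T p \<gamma> D (\<lambda>i. G i \<omega>)"
proof unfold_locales
  have \<omega>: "\<omega> \<notin> bad" using assms by simp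
  note start = not_in_bad_start[OF \<omega>]
  fix a j assume a: "a \<in> T s0" and j: "0 < j" "j < m"
  have mean: "m * Fg (gauss_quantile m j) = j" using j by (simp add: Fg_gauss_quantile)
  have "j \<in> {1..<m}" using j by simp
  then have "\<bar>real (count_le d m (\<lambda>i. G i \<omega>) a (gauss_quantile m j)) - m * Fg (gauss_quantile m j)\<bar>
      \<le> 2 * sqrt (m * Fg_tail (gauss_quantile m j) * (8 * 2 ^ s0)) + 2 * (8 * 2 ^ s0)"
    using start[OF a] assms by (fastforce simp: bad_start_def not_less)
  then show "\<bar>real (count_le d m (\<lambda>i. G i \<omega>) a (gauss_quantile m j)) - real j\<bar>
      \<le> 2 * sqrt (m * Fg_tail (gauss_quantile m j) * (8 * 2 ^ s0)) + 2 * (8 * 2 ^ s0)"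
    by (simp only: mean)
next
  have \<omega>: "\<omega> \<notin> bad" using assms by simp
  note start = not_in_bad_start[OF \<omega>]
  fix a k assume a: "a \<in> T s0" and k: "0 < k" "k \<le> m"
  then have "k \<in> {1..m}" by simp
  then show "excess d m (\<lambda>i. G i \<omega>) a (4 * ln (real m / real k))
      \<le> (L2_set a {1..d})\<^sup>2 * (6 * real k + 4 * (8 * 2 ^ s0))"
    using start[OF a] assms by (fastforce simp: bad_start_def not_less)
next
  have \<omega>: "\<omega> \<notin> bad" using assms by simp
  note step = not_in_bad_step[OF \<omega>]
  fix s a b j assume h: "s0 \<le> s" "a \<in> T s" "b \<in> T (Suc s)" and j: "0 < j" "j < m"
  then have "j \<in> {1..<m}" by simp
  then show "\<bar>real (count_le d m (\<lambda>i. G i \<omega>) a (gauss_quantile m j))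
        - real (count_le d m (\<lambda>i. G i \<omega>) b (gauss_quantile m j))\<bar>
      \<le> 2 * sqrt (m * flip_prob d a b (gauss_quantile m j) * (8 * 2 ^ s)) + 2 * (8 * 2 ^ s)"
    using step[OF h] assms by (fastforce simp: bad_step_def not_less)
next
  have \<omega>: "\<omega> \<notin> bad" using assms by simp
  note step = not_in_bad_step[OF \<omega>]
  fix s a b k assume h: "s0 \<le> s" "a \<in> T s" "b \<in> T (Suc s)" and k: "0 < k" "k \<le> m"
  then have "k \<in> {1..m}" by simp
  then show "excess d m (\<lambda>i. G i \<omega>) (\<lambda>j. a j - b j) (4 * ln (real m / real k))
      \<le> (L2_set (\<lambda>j. a j - b j) {1..d})\<^sup>2 * (6 * real k + 4 * (8 * 2 ^ s))"
    using step[OF h] assms by (fastforce simp: bad_step_def not_less)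
qed

end

section \<open>Measurability of the supremum and the theorem\<close>

definition quantile_distance :: "nat \<Rightarrow> nat \<Rightarrow> (nat \<Rightarrow> nat \<Rightarrow> real) \<Rightarrow> (nat \<Rightarrow> real) \<Rightarrow> real" where
  "quantile_distance d m g x = sqrt (1 / real m *
     (\<Sum>i=1..m. (rearrangement m (matrix_of_rows m d g x) i - gauss_quantile m i)\<^sup>2))"

lemma rearrangement_diff_le:
  assumes i: "i \<in> {1..m}" and le: "\<And>k. k \<in> {1..m} \<Longrightarrow> v k \<le> w k + \<epsilon>"
  shows "rearrangement m v i \<le> rearrangement m w i + \<epsilon>"
proof -
  have "i \<le> card {k \<in> {1..m}. w k \<le> rearrangement m w i}"
    using rearrangement_le_iff[OF i, of w "rearrangement m w i"] by simp
  also have "\<dots> \<le> card {k \<in> {1..m}. v k \<le> rearrangement m w i + \<epsilon>}"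
    using le by (intro card_mono) fastforce+
  finally show ?thesis unfolding rearrangement_le_iff[OF i] .
qed

lemma tendsto_rearrangement:
  assumes i: "i \<in> {1..m}" and lim: "\<And>k. k \<in> {1..m} \<Longrightarrow> (\<lambda>s. v s k) \<longlonglongrightarrow> w k"
  shows "(\<lambda>s. rearrangement m (v s) i) \<longlonglongrightarrow> rearrangement m w i"
proof (rule LIMSEQ_I)
  fix r :: real assume r: "0 < r"
  have "\<forall>\<^sub>F s in sequentially. \<forall>k\<in>{1..m}. \<bar>v s k - w k\<bar> < r / 2"
    using r tendstoD[OF lim, of _ "r / 2"] by (intro eventually_ball_finite) (auto simp: dist_real_def)
  then obtain N where N: "\<And>s k. N \<le> s \<Longrightarrow> k \<in> {1..m} \<Longrightarrow> \<bar>v s k - w k\<bar> < r / 2"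
    unfolding eventually_sequentially by blast
  have "norm (rearrangement m (v s) i - rearrangement m w i) < r" if s: "N \<le> s" for s
  proof -
    have "rearrangement m (v s) i \<le> rearrangement m w i + r / 2"
      using N[OF s] by (intro rearrangement_diff_le[OF i]) (smt (verit))
    moreover have "rearrangement m w i \<le> rearrangement m (v s) i + r / 2"
      using N[OF s] by (intro rearrangement_diff_le[OF i]) (smt (verit))
    ultimately show ?thesis using r by (simp add: abs_le_iff)
  qed
  then show "\<exists>no. \<forall>n\<ge>no. norm (rearrangement m (v n) i - rearrangement m w i) < r" by blast
qed

context gaussian_net
begin

lemma quantile_distance_le:
  assumes "\<omega> \<in> space M - bad" and x: "x \<in> A"
  shows "quantile_distance d m (\<lambda>i. G i \<omega>) x \<le> 200 * sqrt (D / m * ln (m / D))"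
proof -
  interpret good_rows d m A T p \<gamma> D "\<lambda>i. G i \<omega>" by (rule good_rows_outside_bad[OF assms(1)])
  have "1 / real m * (\<Sum>i=1..m. (rearrangement m (matrix_of_rows m d (\<lambda>i. G i \<omega>) x) i - gauss_quantile m i)\<^sup>2)
      \<le> 1 / real m * (40000 * (D * ln (m / D)))"
    by (intro mult_left_mono rearrangement_distance x) simp
  also have "\<dots> = 200\<^sup>2 * (D / m * ln (m / D))" by simp
  finally have "quantile_distance d m (\<lambda>i. G i \<omega>) x \<le> sqrt (200\<^sup>2 * (D / m * ln (m / D)))"
    unfolding quantile_distance_def by (rule real_sqrt_le_mono)
  then show ?thesis unfolding real_sqrt_mult by simp
qed

text \<open>The set \<^term>\<open>A\<close> may be uncountable, but the countable union of the nets is dense in it and the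
  distance depends continuously on the point.\<close>

lemma sets_quantile_distance_le:
  "{\<omega> \<in> space M. (SUP x\<in>A. ereal (quantile_distance d m (\<lambda>k. G k \<omega>) x)) \<le> ereal K} \<in> sets M"
proof -
  have dense: "(\<forall>x\<in>A. quantile_distance d m g x \<le> K) \<longleftrightarrow> (\<forall>s. \<forall>a\<in>T s. quantile_distance d m g a \<le> K)" for g
  proof (intro iffI ballI)
    fix x assume h: "\<forall>s. \<forall>a\<in>T s. quantile_distance d m g a \<le> K" and x: "x \<in> A"
    have "(\<lambda>s. matrix_of_rows m d g (p s x) k) \<longlonglongrightarrow> matrix_of_rows m d g x k" if "k \<in> {1..m}" for k
      using p_tendsto[OF x, of "g k"] that by (simp add: matrix_of_rows_def)
    then have "(\<lambda>s. quantile_distance d m g (p s x)) \<longlonglongrightarrow> quantile_distance d m g x"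
      unfolding quantile_distance_def by (intro tendsto_intros tendsto_rearrangement)
    then show "quantile_distance d m g x \<le> K"
      by (rule LIMSEQ_le_const2) (use h p_in_T[OF x] in blast)
  qed (use T_subset in blast)
  have [measurable]: "(\<lambda>\<omega>. quantile_distance d m (\<lambda>k. G k \<omega>) a) \<in> borel_measurable M" for a
    unfolding quantile_distance_def
    by (intro measurable_compose[OF _ borel_measurable_sqrt] borel_measurable_times
        borel_measurable_sum borel_measurable_power borel_measurable_diff borel_measurable_const
        measurable_rearrangement)
  have "{\<omega> \<in> space M. (SUP x\<in>A. ereal (quantile_distance d m (\<lambda>k. G k \<omega>) x)) \<le> ereal K}
      = {\<omega> \<in> space M. \<forall>s. \<forall>a\<in>T s. quantile_distance d m (\<lambda>k. G k \<omega>) a \<le> K}"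
    unfolding SUP_le_iff ereal_less_eq dense ..
  also have "\<dots> \<in> sets M"
    by (intro sets.sets_Collect_countable_All sets.sets_Collect_finite_All T_finite) measurable
  finally show ?thesis .
qed

lemma prob_quantile_distance_le:
  "1 - 2 * exp (- (D / 2097152)) \<le> measure M {\<omega> \<in> space M.
     (SUP x\<in>A. ereal (quantile_distance d m (\<lambda>k. G k \<omega>) x)) \<le> ereal (200 * sqrt (D / m * ln (m / D)))}"
    (is "_ \<le> measure M ?E")
proof -
  have "D / 2097152 \<le> 2 ^ s0" using s0(2) by (simp add: field_simps)
  then have "1 - 2 * exp (- (D / 2097152)) \<le> 1 - 2 * exp (- (2 ^ s0))" by simp
  also have "\<dots> \<le> 1 - measure M bad" using prob_bad by simp
  also have "\<dots> = measure M (space M - bad)" by (rule prob_compl[OF sets_bad, symmetric])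
  also have "\<dots> \<le> measure M ?E"
  proof (rule finite_measure_mono[OF _ sets_quantile_distance_le], rule subsetI)
    fix \<omega> assume \<omega>: "\<omega> \<in> space M - bad"
    then show "\<omega> \<in> ?E" using quantile_distance_le[OF \<omega>] by (auto intro!: SUP_least)
  qed
  finally show ?thesis .
qed

end

lemma nearest_point_in: "finite B \<Longrightarrow> B \<noteq> {} \<Longrightarrow> nearest_point n B x \<in> B"
  unfolding nearest_point_def by (rule arg_min_if_finite(1))

text \<open>A point of a symmetric subset of the sphere is at distance 2 from its antipode, so the
  one-point net at level 0 already contributes 2. This keeps \<open>\<gamma>\<^sub>1\<close> away from 0.\<close>

lemma gamma1_ge_one:
  assumes A: "A \<subseteq> euclid_sphere d" and sym: "symmetric_set d A"
  shows "1 \<le> gamma1 d A"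
  unfolding gamma1_def
proof (rule INF_greatest)
  fix As assume "As \<in> {As. admissible A As}"
  then have adm: "admissible A As" by simp
  then obtain a where a: "As 0 = {a}" using card_1_singletonE unfolding admissible_def by metis
  have aA: "a \<in> A" using adm a unfolding admissible_def by blast
  then have unit: "L2_set a {1..d} = 1" using A by (auto simp: euclid_sphere_def)
  define b where "b = euclid_uminus d a"
  have bA: "b \<in> A" using sym aA unfolding symmetric_set_def b_def by blast
  have near: "nearest_point d (As 0) b = a" using nearest_point_in[of "As 0" d b] a by simp
  have "euclid_dist d b a = L2_set (\<lambda>j. (- 2) * a j) {1..d}"
    unfolding euclid_dist_def by (rule L2_set_cong) (auto simp: b_def euclid_uminus_def)
  also have "\<dots> = sqrt (\<Sum>j=1..d. 4 * (a j)\<^sup>2)" by (simp add: L2_set_def power_mult_distrib)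
  also have "\<dots> = 2 * L2_set a {1..d}"
    unfolding sum_distrib_left[symmetric] by (simp add: L2_set_def real_sqrt_mult)
  finally have dist: "euclid_dist d b a = 2" by (simp add: unit)
  have "1 \<le> (\<Sum>s<1. ennreal (2 ^ s * euclid_dist d b (nearest_point d (As s) b)))"
    by (simp add: One_nat_def near dist)
  also have "\<dots> \<le> (\<Sum>s. ennreal (2 ^ s * euclid_dist d b (nearest_point d (As s) b)))"
    by (intro sum_le_suminf) auto
  also have "\<dots> \<le> (SUP x\<in>A. \<Sum>s. ennreal (2 ^ s * euclid_dist d x (nearest_point d (As s) x)))"
    by (intro SUP_upper bA)
  finally show "1 \<le> (SUP x\<in>A. \<Sum>s. ennreal (2 ^ s * euclid_dist d x (nearest_point d (As s) x)))" .
qed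

lemma near_optimal_admissible:
  assumes "gamma1 d A < ennreal c" "0 \<le> c"
  obtains As where "admissible A As"
    "\<And>n x. x \<in> A \<Longrightarrow> (\<Sum>s<n. 2 ^ s * euclid_dist d x (nearest_point d (As s) x)) \<le> c"
proof -
  obtain As where adm: "admissible A As"
    and sup: "(SUP x\<in>A. \<Sum>s. ennreal (2 ^ s * euclid_dist d x (nearest_point d (As s) x))) < ennreal c"
    using assms(1) unfolding gamma1_def INF_less_iff by blast
  have "(\<Sum>s<n. 2 ^ s * euclid_dist d x (nearest_point d (As s) x)) \<le> c" if x: "x \<in> A" for n x
  proof -
    have "ennreal (\<Sum>s<n. 2 ^ s * euclid_dist d x (nearest_point d (As s) x))
        = (\<Sum>s<n. ennreal (2 ^ s * euclid_dist d x (nearest_point d (As s) x)))"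
      by (rule sum_ennreal[symmetric]) (simp add: euclid_dist_nonneg)
    also have "\<dots> \<le> (\<Sum>s. ennreal (2 ^ s * euclid_dist d x (nearest_point d (As s) x)))"
      by (intro sum_le_suminf) auto
    also have "\<dots> \<le> (SUP x\<in>A. \<Sum>s. ennreal (2 ^ s * euclid_dist d x (nearest_point d (As s) x)))"
      by (intro SUP_upper x)
    also have "\<dots> \<le> ennreal c" using sup by simp
    finally show ?thesis using assms(2) by (simp add: ennreal_le_iff)
  qed
  with adm show ?thesis by (rule that)
qed

theorem theorem1p8:
  shows "\<exists>C1 c2 C3 :: real. C1 > 0 \<and> c2 > 0 \<and> C3 > 0 \<and>
    (\<forall>(d::nat) (m::nat) (A :: (nat \<Rightarrow> real) set) (\<Delta>::real)
       (M :: 'a measure) (G :: nat \<Rightarrow> 'a \<Rightarrow> (nat \<Rightarrow> real)).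
       A \<subseteq> euclid_sphere d \<longrightarrow>
       symmetric_set d A \<longrightarrow>
       prob_space M \<longrightarrow>
       prob_space.indep_vars M (\<lambda>_. \<Pi>\<^sub>M j\<in>{1..d}. borel) G {1..m} \<longrightarrow>
       (\<forall>i\<in>{1..m}. distr M (\<Pi>\<^sub>M j\<in>{1..d}. borel) (G i) = std_gaussian d) \<longrightarrow>
       gamma1 d A \<le> of_nat m \<longrightarrow>
       \<Delta> \<ge> C1 * (enn2real (gamma1 d A) / real m)
              * (ln (exp 1 * real m / enn2real (gamma1 d A))) ^ 3 \<longrightarrow>
       \<Delta> \<le> 1 / 2 \<longrightarrow>
       measure M {\<omega> \<in> space M.
         (SUP x\<in>A. ereal (sqrt (1 / real m *
             (\<Sum>i=1..m. (rearrangement m (matrix_of_rows m d (\<lambda>k. G k \<omega>) x) i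
                         - gauss_quantile m i)\<^sup>2))))
           \<le> ereal (C3 * sqrt (\<Delta> * ln (1 / \<Delta>)))}
         \<ge> 1 - 2 * exp (- c2 * \<Delta> * real m))"
proof (rule exI[of _ 1000000000], rule exI[of _ "1 / 2097152"], rule exI[of _ 200], intro conjI allI impI)
  \<comment> \<open>The first constant is the one required of a net, the second is \<open>2 ^ (- 21)\<close>, from
    \<open>D / 2 ^ 21 \<le> 2 ^ s0\<close>, and the third is the square root of \<open>40000\<close>.\<close>
  fix d m :: nat and A :: "(nat \<Rightarrow> real) set" and \<Delta> :: real
    and M :: "'a measure" and G :: "nat \<Rightarrow> 'a \<Rightarrow> (nat \<Rightarrow> real)"
  assume A: "A \<subseteq> euclid_sphere d" and sym: "symmetric_set d A" and M: "prob_space M"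
    and indep: "prob_space.indep_vars M (\<lambda>_. \<Pi>\<^sub>M j\<in>{1..d}. borel) G {1..m}"
    and distr: "\<forall>i\<in>{1..m}. distr M (\<Pi>\<^sub>M j\<in>{1..d}. borel) (G i) = std_gaussian d"
    and \<gamma>m: "gamma1 d A \<le> of_nat m"
    and \<Delta>: "\<Delta> \<ge> 1000000000 * (enn2real (gamma1 d A) / real m)
              * (ln (exp 1 * real m / enn2real (gamma1 d A))) ^ 3"
    and \<Delta>_le: "\<Delta> \<le> 1 / 2"
  define \<gamma> where "\<gamma> = enn2real (gamma1 d A)"
  have fin: "gamma1 d A < top" using \<gamma>m by (rule le_less_trans) (simp add: ennreal_of_nat_eq_real_of_nat)
  then have \<gamma>: "gamma1 d A = ennreal \<gamma>" by (simp add: \<gamma>_def)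
  have \<gamma>0: "0 \<le> \<gamma>" by (simp add: \<gamma>_def)
  have \<gamma>1: "1 \<le> \<gamma>" using gamma1_ge_one[OF A sym] \<gamma>0 unfolding \<gamma> by simp
  have \<gamma>_le: "\<gamma> \<le> real m" using \<gamma>m unfolding \<gamma> by (simp add: ennreal_of_nat_eq_real_of_nat)
  have m: "0 < real m" using \<gamma>1 \<gamma>_le by linarith
  have "gamma1 d A < ennreal (2 * \<gamma>)" unfolding \<gamma> using \<gamma>1 by (simp add: ennreal_less_iff)
  then obtain As where adm: "admissible A As"
    and chain: "\<And>n x. x \<in> A \<Longrightarrow> (\<Sum>s<n. 2 ^ s * euclid_dist d x (nearest_point d (As s) x)) \<le> 2 * \<gamma>"
    by (rule near_optimal_admissible) (use \<gamma>0 in auto)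
  interpret prob_space M by (rule M)
  interpret gaussian_net M d m G A As "\<lambda>s. nearest_point d (As s)" \<gamma> "\<Delta> * m"
  proof unfold_locales
    show "indep_vars (\<lambda>_. \<Pi>\<^sub>M j\<in>{1..d}. borel) G {1..m}" by (rule indep)
    show "distr M (\<Pi>\<^sub>M j\<in>{1..d}. borel) (G i) = std_gaussian d" if "i \<in> {1..m}" for i
      using distr that by blast
    show "L2_set x {1..d} = 1" if "x \<in> A" for x using A that by (auto simp: euclid_sphere_def)
    show "As s \<subseteq> A" "finite (As s)" for s using adm by (auto simp: admissible_def)
    show "card (As s) \<le> 2 ^ 2 ^ s" for s
      using adm by (cases "s = 0") (auto simp: admissible_def)
    show "nearest_point d (As s) x \<in> As s" for s x
      using adm by (intro nearest_point_in) (auto simp: admissible_def)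
    show "(\<Sum>s<n. 2 ^ s * euclid_dist d x (nearest_point d (As s) x)) \<le> 2 * \<gamma>" if "x \<in> A" for n x
      by (rule chain[OF that])
    have "1000000000 * (\<gamma> / real m) * (ln (exp 1 * real m / \<gamma>)) ^ 3 * m \<le> \<Delta> * m"
      using \<Delta> m unfolding \<gamma>_def by (intro mult_right_mono) auto
    then show "1000000000 * \<gamma> * (ln (exp 1 * real m / \<gamma>)) ^ 3 \<le> \<Delta> * m" using m by simp
    show "2 * (\<Delta> * m) \<le> real m" using \<Delta>_le m by simp
  qed (use \<gamma>1 \<gamma>_le in auto)
  have ratio: "\<Delta> * m / m = \<Delta>" "m / (\<Delta> * m) = 1 / \<Delta>" using m by auto
  show "measure M {\<omega> \<in> space M.
         (SUP x\<in>A. ereal (sqrt (1 / real m *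
             (\<Sum>i=1..m. (rearrangement m (matrix_of_rows m d (\<lambda>k. G k \<omega>) x) i
                         - gauss_quantile m i)\<^sup>2))))
           \<le> ereal (200 * sqrt (\<Delta> * ln (1 / \<Delta>)))}
         \<ge> 1 - 2 * exp (- (1 / 2097152) * \<Delta> * real m)"
    using prob_quantile_distance_le unfolding ratio quantile_distance_def by simp
qed auto

end
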